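(* Let $\lambda\in\mathbb{R}$ with $\lambda\le 0$, and let $M^n\subset\mathbb{R}^{n+1}$ be a smooth, closed, embedded $\lambda$-hypersurface, i.e. $H-\frac{\langle x,\mathbf{n}\rangle}{2}=\lambda$ at every point $x\in M$. If $M$ is mean convex (that is, $H\ge 0$ on $M$), then $M$ is convex (that is, all principal curvatures of $M$ are nonnegative at every point).
   Context: For a hypersurface $M^n\subset\mathbb{R}^{n+1}$, $x$ denotes the position vector, $\mathbf{n}$ the outer unit normal, and $\langle\cdot,\cdot\rangle$ the Euclidean inner product. The second fundamental form is $A(v,w)=\langle\nabla_v w,\mathbf{n}\rangle$, where $\nabla$ is the Euclidean derivative. The principal curvatures $k_1\le\cdots\le k_n$ are the eigenvalues of $-A$ (with respect to the induced metric), and the mean curvature is $H=-\operatorname{tr}A=k_1+\cdots+k_n$. With this convention the round sphere of radius $R$ with its outer normal has $k_i=1/R$ and $H=n/R$. For a constant $\lambda\in\mathbb{R}$, $M$ is called a $\lambda$-hypersurface if $H-\frac{\langle x,\mathbf{n}\rangle}{2}=\lambda$ on $M$. "Closed" means compact without boundary. *)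

theory Defs
  imports "HOL-Analysis.Analysis"
begin

text \<open>\<open>k_smooth_on k S f\<close> is membership in \<open>C\<^sup>k\<close>; it is only meant for open \<open>S\<close>.  On
  finite-dimensional spaces, continuity of all iterated directional derivatives of a differentiable
  function is the same as continuity of its iterated Frechet derivatives.\<close>

primrec k_smooth_on ::
    "nat \<Rightarrow> 'a::real_normed_vector set \<Rightarrow> ('a \<Rightarrow> 'b::real_normed_vector) \<Rightarrow> bool" where
  "k_smooth_on 0 S f \<longleftrightarrow> continuous_on S f"
| "k_smooth_on (Suc k) S f \<longleftrightarrow>
     (\<forall>x\<in>S. f differentiable (at x)) \<and>
     (\<forall>v. k_smooth_on k S (\<lambda>x. frechet_derivative f (at x) v))"

definition smooth_on ::
    "'a::real_normed_vector set \<Rightarrow> ('a \<Rightarrow> 'b::real_normed_vector) \<Rightarrow> bool" where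
  "smooth_on S f \<longleftrightarrow> (\<forall>k. k_smooth_on k S f)"

text \<open>Hypersurfaces are embedded submanifolds of codimension one, given by slice charts: a
  diffeomorphism of open sets of the ambient space flattens \<open>M\<close> locally to a hyperplane through
  the origin.  In particular they have no boundary.\<close>

definition smooth_embedded_hypersurface :: "'a::euclidean_space set \<Rightarrow> bool" where
  "smooth_embedded_hypersurface M \<longleftrightarrow>
     (\<forall>p\<in>M. \<exists>U V \<phi> \<psi> b. open U \<and> open V \<and> p \<in> U \<and>
        homeomorphism U V \<phi> \<psi> \<and> smooth_on U \<phi> \<and> smooth_on V \<psi> \<and>
        b \<noteq> (0::'a) \<and> \<phi> ` (M \<inter> U) = {y \<in> V. y \<bullet> b = 0})"

definition closed_embedded_hypersurface :: "'a::euclidean_space set \<Rightarrow> bool" where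
  "closed_embedded_hypersurface M \<longleftrightarrow> compact M \<and> smooth_embedded_hypersurface M"

definition tangent_space :: "'a::euclidean_space set \<Rightarrow> 'a \<Rightarrow> 'a set" where
  "tangent_space M p =
     {v. \<exists>\<gamma> \<epsilon>. \<epsilon> > (0::real) \<and> smooth_on {-\<epsilon><..<\<epsilon>} \<gamma> \<and> \<gamma> ` {-\<epsilon><..<\<epsilon>} \<subseteq> M \<and>
               \<gamma> 0 = p \<and> (\<gamma> has_vector_derivative v) (at 0)}"

text \<open>\<open>n\<close> is the outer unit normal field of \<open>M\<close>: at \<open>p\<close> it points from the bounded side to the
  unbounded side of the connected component of \<open>M\<close> through \<open>p\<close>.  Passing to components only
  matters for disconnected \<open>M\<close>.  Values of \<open>n\<close> off \<open>M\<close> are irrelevant.\<close>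

definition outer_unit_normal :: "'a::euclidean_space set \<Rightarrow> ('a \<Rightarrow> 'a) \<Rightarrow> bool" where
  "outer_unit_normal M n \<longleftrightarrow>
     (\<forall>p\<in>M. norm (n p) = 1 \<and> (\<forall>v\<in>tangent_space M p. v \<bullet> n p = 0) \<and>
        (\<forall>\<^sub>F t in at_right 0.
           p + t *\<^sub>R n p \<in> outside (connected_component_set M p) \<and>
           p - t *\<^sub>R n p \<in> inside (connected_component_set M p)))"

text \<open>\<open>A(v,w) = \<langle>\<nabla>\<^sub>v w, n\<rangle>\<close>: the tangent vector \<open>w\<close> is extended to a smooth vector field \<open>W\<close> near
  \<open>p\<close> that is tangent to \<open>M\<close> along \<open>M\<close>; for \<open>v\<close> tangent to \<open>M\<close> at \<open>p\<close> the value does not depend on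
  the extension.  Only meaningful for \<open>v\<close>, \<open>w\<close> in \<open>tangent_space M p\<close>.\<close>

definition second_fundamental_form ::
    "'a::euclidean_space set \<Rightarrow> ('a \<Rightarrow> 'a) \<Rightarrow> 'a \<Rightarrow> 'a \<Rightarrow> 'a \<Rightarrow> real" where
  "second_fundamental_form M n p v w =
     (THE a. \<exists>U W. open U \<and> p \<in> U \<and> smooth_on U W \<and>
        (\<forall>q\<in>M \<inter> U. W q \<in> tangent_space M q) \<and> W p = w \<and>
        a = frechet_derivative W (at p) v \<bullet> n p)"

text \<open>Eigenvalues of \<open>-A\<close> with respect to the induced metric.\<close>

definition principal_curvature ::
    "'a::euclidean_space set \<Rightarrow> ('a \<Rightarrow> 'a) \<Rightarrow> 'a \<Rightarrow> real \<Rightarrow> bool" where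
  "principal_curvature M n p k \<longleftrightarrow>
     (\<exists>v\<in>tangent_space M p. v \<noteq> 0 \<and>
        (\<forall>w\<in>tangent_space M p. - second_fundamental_form M n p v w = k * (v \<bullet> w)))"

definition orthonormal_basis :: "'a::euclidean_space set \<Rightarrow> 'a set \<Rightarrow> bool" where
  "orthonormal_basis T B \<longleftrightarrow> pairwise orthogonal B \<and> (\<forall>e\<in>B. norm e = 1) \<and> span B = T"

text \<open>\<open>H = - tr A\<close>, the trace being taken in an orthonormal basis of the tangent space (its value is
  independent of the basis chosen).\<close>

definition mean_curvature ::
    "'a::euclidean_space set \<Rightarrow> ('a \<Rightarrow> 'a) \<Rightarrow> 'a \<Rightarrow> real" where
  "mean_curvature M n p =
     - (\<Sum>e\<in>(SOME B. orthonormal_basis (tangent_space M p) B). second_fundamental_form M n p e e)"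

definition lambda_hypersurface ::
    "real \<Rightarrow> 'a::euclidean_space set \<Rightarrow> ('a \<Rightarrow> 'a) \<Rightarrow> bool" where
  "lambda_hypersurface l M n \<longleftrightarrow> (\<forall>x\<in>M. mean_curvature M n x - (x \<bullet> n x) / 2 = l)"

definition mean_convex :: "'a::euclidean_space set \<Rightarrow> ('a \<Rightarrow> 'a) \<Rightarrow> bool" where
  "mean_convex M n \<longleftrightarrow> (\<forall>x\<in>M. mean_curvature M n x \<ge> 0)"

definition convex_hypersurface :: "'a::euclidean_space set \<Rightarrow> ('a \<Rightarrow> 'a) \<Rightarrow> bool" where
  "convex_hypersurface M n \<longleftrightarrow> (\<forall>x\<in>M. \<forall>k. principal_curvature M n x k \<longrightarrow> k \<ge> 0)"

end

theory Submission
  imports Defs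
begin

text \<open>
  Write \<open>u = \<langle>x, n\<rangle>/2\<close>, let \<open>k\<close> be the smallest principal curvature, and put
  \<open>L w = \<Delta> w - \<langle>x, \<nabla> w\<rangle>/2\<close> for functions \<open>w\<close> on \<open>M\<close>.  The equation \<open>H = u + \<lambda>\<close> gives

    \<open>L u + |A|\<^sup>2 u = u/2 + \<lambda>/2\<close>   and   \<open>L k + |A|\<^sup>2 k \<le> k/2 + \<lambda> k\<^sup>2\<close>,

  the second in the sense of upper barriers, since \<open>k\<close> need not be differentiable.  Hence, if
  \<open>\<lambda> \<le> 0\<close>, every nonnegative combination \<open>w = \<sigma> k + c u\<close> with \<open>\<sigma>, c \<ge> 0\<close> satisfies \<open>L w \<le> w/2\<close>, and
  the strong maximum principle says that \<open>w\<close> vanishes on a whole connected component as soon as it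
  vanishes at one of its points.  At a point of the component that is farthest from the origin both
  \<open>u\<close> and \<open>k\<close> are positive, so in fact such a \<open>w\<close>, if it is not the trivial combination, is positive.

  Mean convexity enters through \<open>u = H - \<lambda> \<ge> 0\<close>.  Taking \<open>w = u\<close> gives \<open>u > 0\<close>.  If \<open>k\<close> were negative
  somewhere, let \<open>-c < 0\<close> be the minimum of \<open>k/u\<close>; then \<open>w = k + c u\<close> is nonnegative and has a zero,
  which was just excluded.  So \<open>k \<ge> 0\<close>.

  The differential inequality is obtained without covariant derivatives.  Near \<open>z \<in> M\<close> the
  hypersurface is the graph of a smooth function \<open>f\<close> over its tangent plane at \<open>z\<close>
  (\<open>smooth_graph_representation\<close>), and \<open>H = u + \<lambda>\<close> becomes a quasilinear equation for \<open>f\<close>.  At \<open>z\<close> both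
  \<open>f\<close> and its gradient vanish, so the first two derivatives of that equation at \<open>z\<close> are short formulas
  (\<open>graph_equation_derivatives\<close>); the second one takes the place of Simons' identity.  The function
  \<open>f\<close> is kept as a function of the ambient point that is constant along \<open>n z\<close>, which lets all
  derivatives be directional derivatives in the ambient space, and all traces be sums over its
  standard basis.  Derivatives at \<open>z\<close> are computed along lines, with the product and chain rules for
  2-jets.

  The minimum over directions that defines \<open>k\<close> is avoided by working on the compact unit tangent
  bundle, with the function \<open>(q, v) \<mapsto> \<sigma> \<cdot> (normal curvature of v) + c \<cdot> u q\<close>.  The comparison with
  Gaussians is \<open>test_function_touching\<close>; it is turned into the strong maximum principle by Hopf's
  barrier argument in \<open>hopf_barrier\<close>.
\<close>

section \<open>Smooth functions\<close>

text \<open>Iterated directional derivatives \<open>dd v (dd w f)\<close> are the form in which \<^const>\<open>k_smooth_on\<close> speaks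
  of higher derivatives, so they serve as the only notion of higher derivative below.\<close>

abbreviation dd :: "'a::real_normed_vector \<Rightarrow> ('a \<Rightarrow> 'b::real_normed_vector) \<Rightarrow> 'a \<Rightarrow> 'b" where
  "dd v f \<equiv> (\<lambda>x. frechet_derivative f (at x) v)"

lemma k_smooth_on_cong:
  assumes "open S" "\<And>x. x \<in> S \<Longrightarrow> f x = g x" "k_smooth_on k S f"
  shows "k_smooth_on k S g"
  using assms(2,3)
proof (induction k arbitrary: f g)
  case 0
  then show ?case by (simp cong: continuous_on_cong)
next
  case (Suc k)
  have d: "f differentiable at x" if "x \<in> S" for x using Suc.prems(2) that by simp
  have g: "g differentiable at x" if "x \<in> S" for x
    using d[OF that] has_derivative_transform_within_open[where f=f and g=g and s=S, OF _ \<open>open S\<close> that Suc.prems(1)]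
    unfolding differentiable_def by blast
  have e: "frechet_derivative f (at x) = frechet_derivative g (at x)" if "x \<in> S" for x
    using frechet_derivative_transform_within_open[OF d[OF that] \<open>open S\<close> that Suc.prems(1)] .
  have "k_smooth_on k S (dd v g)" for v
    by (rule Suc.IH[of "dd v f"]) (use e Suc.prems(2) in auto)
  with g show ?case by simp
qed

lemma k_smooth_on_Suc_imp: "k_smooth_on (Suc k) S f \<Longrightarrow> k_smooth_on k S f"
proof (induction k arbitrary: f)
  case 0
  then show ?case
    by (simp add: continuous_at_imp_continuous_on differentiable_imp_continuous_within)
next
  case (Suc k)
  then show ?case by simp
qed

lemma k_smooth_on_subset: "k_smooth_on k S f \<Longrightarrow> T \<subseteq> S \<Longrightarrow> k_smooth_on k T f"
proof (induction k arbitrary: f)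
  case 0
  then show ?case by (simp add: continuous_on_subset)
next
  case (Suc k)
  then show ?case by (simp add: subset_iff)
qed

text \<open>The recursive clause of \<^const>\<open>k_smooth_on\<close> mentions the choice term \<^const>\<open>frechet_derivative\<close>;
  with this rule any known formula for the derivative can be used instead.  Openness of \<open>S\<close> is what
  makes directional derivatives insensitive to replacing that term by the formula on \<open>S\<close> only.\<close>

lemma k_smooth_on_SucI:
  assumes "open S" "\<And>x. x \<in> S \<Longrightarrow> (f has_derivative F x) (at x)"
    and "\<And>v. k_smooth_on k S (\<lambda>x. F x v)"
  shows "k_smooth_on (Suc k) S f"
proof -
  have "F x = frechet_derivative f (at x)" if "x \<in> S" for x
    using frechet_derivative_at[OF assms(2)[OF that]] .
  then have "k_smooth_on k S (dd v f)" for v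
    by (intro k_smooth_on_cong[OF assms(1) _ assms(3)]) simp
  then show ?thesis using assms(2) by (auto simp: differentiable_def)
qed

lemma k_smooth_on_SucD:
  assumes "k_smooth_on (Suc k) S f" "x \<in> S"
  shows "(f has_derivative frechet_derivative f (at x)) (at x)"
  using assms frechet_derivative_works by auto

lemma k_smooth_on_const: "open S \<Longrightarrow> k_smooth_on k S (\<lambda>x. c)"
  by (induction k arbitrary: c) (auto intro!: k_smooth_on_SucI[where F="\<lambda>x v. 0"])

lemma k_smooth_on_bounded_linear:
  assumes "open S" "bounded_linear f"
  shows "k_smooth_on k S f"
proof (cases k)
  case 0
  then show ?thesis using assms by (simp add: linear_continuous_on)
next
  case (Suc m)
  show ?thesis unfolding Suc
    by (rule k_smooth_on_SucI[OF assms(1), where F="\<lambda>x. f"])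
      (use assms in \<open>auto intro: bounded_linear_imp_has_derivative k_smooth_on_const\<close>)
qed

lemma k_smooth_on_add:
  assumes "open S" "k_smooth_on k S f" "k_smooth_on k S g"
  shows "k_smooth_on k S (\<lambda>x. f x + g x)"
  using assms(2,3)
proof (induction k arbitrary: f g)
  case 0
  then show ?case by (simp add: continuous_on_add)
next
  case (Suc k)
  show ?case
  proof (rule k_smooth_on_SucI[OF assms(1)])
    fix x assume "x \<in> S"
    then show "((\<lambda>x. f x + g x) has_derivative
        (\<lambda>v. frechet_derivative f (at x) v + frechet_derivative g (at x) v)) (at x)"
      by (intro has_derivative_add k_smooth_on_SucD[OF Suc.prems(1)] k_smooth_on_SucD[OF Suc.prems(2)])
  qed (use Suc in auto)
qed

lemma k_smooth_on_sum:
  assumes "open S" "\<And>i. i \<in> I \<Longrightarrow> k_smooth_on k S (f i)"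
  shows "k_smooth_on k S (\<lambda>x. \<Sum>i\<in>I. f i x)"
  using assms(2)
  by (induction I rule: infinite_finite_induct)
    (auto intro: k_smooth_on_const k_smooth_on_add assms(1))

text \<open>By the product rule the derivative is a sum of two products of functions that have at least one
  derivative less, so the induction runs on the order of smoothness.\<close>

lemma k_smooth_on_bilinear:
  assumes "open S" "bounded_bilinear pr" "k_smooth_on k S f" "k_smooth_on k S g"
  shows "k_smooth_on k S (\<lambda>x. pr (f x) (g x))"
  using assms(3,4)
proof (induction k arbitrary: f g)
  case 0
  then show ?case using bounded_bilinear.continuous_on[OF assms(2)] by simp
next
  case (Suc k)
  show ?case
  proof (rule k_smooth_on_SucI[OF assms(1)])
    fix x assume "x \<in> S"
    then show "((\<lambda>x. pr (f x) (g x)) has_derivative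
        (\<lambda>v. pr (f x) (frechet_derivative g (at x) v) + pr (frechet_derivative f (at x) v) (g x))) (at x)"
      by (intro bounded_bilinear.FDERIV[OF assms(2)] k_smooth_on_SucD[OF Suc.prems(1)]
          k_smooth_on_SucD[OF Suc.prems(2)])
  qed (use Suc k_smooth_on_Suc_imp[OF Suc.prems(1)] k_smooth_on_Suc_imp[OF Suc.prems(2)] in
      \<open>auto intro!: k_smooth_on_add[OF assms(1)]\<close>)
qed

lemmas k_smooth_on_mult = k_smooth_on_bilinear[OF _ bounded_bilinear_mult]
lemmas k_smooth_on_scaleR = k_smooth_on_bilinear[OF _ bounded_bilinear_scaleR]
lemmas k_smooth_on_inner = k_smooth_on_bilinear[OF _ bounded_bilinear_inner]

lemma k_smooth_on_inverse:
  fixes r :: "'a::real_normed_vector \<Rightarrow> real"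
  assumes "open S" "k_smooth_on k S r" "\<And>x. x \<in> S \<Longrightarrow> r x \<noteq> 0"
  shows "k_smooth_on k S (\<lambda>x. inverse (r x))"
  using assms(2)
proof (induction k)
  case 0
  then show ?case using assms(3) by (auto intro: continuous_on_inverse)
next
  case (Suc k)
  note ih = Suc.IH[OF k_smooth_on_Suc_imp[OF Suc.prems]]
  show ?case
  proof (rule k_smooth_on_SucI[OF assms(1)])
    fix x assume "x \<in> S"
    then show "((\<lambda>x. inverse (r x)) has_derivative
        (\<lambda>v. (-1) * (inverse (r x) * frechet_derivative r (at x) v * inverse (r x)))) (at x)"
      using Deriv.has_derivative_inverse[OF assms(3)[OF \<open>x \<in> S\<close>] k_smooth_on_SucD[OF Suc.prems]] by simp
  next
    fix v
    have "k_smooth_on k S (dd v r)" using Suc.prems by simp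
    then show "k_smooth_on k S
        (\<lambda>x. (-1) * (inverse (r x) * frechet_derivative r (at x) v * inverse (r x)))"
      by (intro k_smooth_on_mult k_smooth_on_const ih assms(1))
  qed
qed

lemma frechet_derivative_expand:
  fixes f :: "'a::euclidean_space \<Rightarrow> 'b::real_normed_vector"
  assumes "f differentiable (at x)"
  shows "frechet_derivative f (at x) v = (\<Sum>b\<in>Basis. (v \<bullet> b) *\<^sub>R frechet_derivative f (at x) b)"
proof -
  interpret linear "frechet_derivative f (at x)" by (rule linear_frechet_derivative[OF assms])
  have "frechet_derivative f (at x) (\<Sum>b\<in>Basis. (v \<bullet> b) *\<^sub>R b)
      = (\<Sum>b\<in>Basis. (v \<bullet> b) *\<^sub>R frechet_derivative f (at x) b)"
    by (simp add: sum scale)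
  then show ?thesis by (simp add: euclidean_representation)
qed

text \<open>The derivative of a composition involves the inner derivative in a linear argument.  Expanding
  that argument in the standard basis turns it into products of scalar functions, to which the
  induction hypothesis applies.\<close>

lemma k_smooth_on_compose:
  fixes f :: "'a::real_normed_vector \<Rightarrow> 'b::euclidean_space"
    and g :: "'b \<Rightarrow> 'c::real_normed_vector"
  assumes "open U" "k_smooth_on k V g" "k_smooth_on k U f" "f ` U \<subseteq> V"
  shows "k_smooth_on k U (\<lambda>x. g (f x))"
  using assms(2,3)
proof (induction k arbitrary: g)
  case 0
  then show ?case using assms(4) continuous_on_compose2 by fastforce
next
  case (Suc k)
  have fV: "f x \<in> V" if "x \<in> U" for x using assms(4) that by auto
  show ?case
  proof (rule k_smooth_on_SucI[OF assms(1)])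
    fix x assume x: "x \<in> U"
    have "((\<lambda>x. g (f x)) has_derivative
        (\<lambda>v. frechet_derivative g (at (f x)) (frechet_derivative f (at x) v))) (at x)"
      using diff_chain_at[OF k_smooth_on_SucD[OF Suc.prems(2) x] k_smooth_on_SucD[OF Suc.prems(1) fV[OF x]]]
      by (simp add: o_def)
    also have "(\<lambda>v. frechet_derivative g (at (f x)) (frechet_derivative f (at x) v))
        = (\<lambda>v. \<Sum>b\<in>Basis. (frechet_derivative f (at x) v \<bullet> b) *\<^sub>R frechet_derivative g (at (f x)) b)"
      by (rule ext, rule frechet_derivative_expand) (use Suc.prems(1) fV[OF x] in simp)
    finally show "((\<lambda>x. g (f x)) has_derivative (\<lambda>v. \<Sum>b\<in>Basis.
        (frechet_derivative f (at x) v \<bullet> b) *\<^sub>R frechet_derivative g (at (f x)) b)) (at x)" .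
  next
    fix v
    have 1: "k_smooth_on k U (\<lambda>x. frechet_derivative g (at (f x)) b)" for b
      by (rule Suc.IH) (use Suc.prems k_smooth_on_Suc_imp in auto)
    show "k_smooth_on k U (\<lambda>x. \<Sum>b\<in>Basis.
        (frechet_derivative f (at x) v \<bullet> b) *\<^sub>R frechet_derivative g (at (f x)) b)"
      by (intro k_smooth_on_sum k_smooth_on_scaleR k_smooth_on_inner k_smooth_on_const assms(1) 1)
        (use Suc.prems in simp)
  qed
qed

lemma has_real_derivative_along_line:
  fixes f :: "'a::real_normed_vector \<Rightarrow> real"
  assumes "f differentiable (at (x + t *\<^sub>R v))"
  shows "((\<lambda>t. f (x + t *\<^sub>R v)) has_real_derivative dd v f (x + t *\<^sub>R v)) (at t)"
proof -
  have 1: "((\<lambda>t. x + t *\<^sub>R v) has_derivative (\<lambda>s. s *\<^sub>R v)) (at t)"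
    by (auto intro!: derivative_eq_intros)
  have 2: "(f has_derivative frechet_derivative f (at (x + t *\<^sub>R v))) (at (x + t *\<^sub>R v))"
    using assms frechet_derivative_works by blast
  have "((\<lambda>t. f (x + t *\<^sub>R v)) has_derivative
      (\<lambda>s. frechet_derivative f (at (x + t *\<^sub>R v)) (s *\<^sub>R v))) (at t)"
    using diff_chain_at[OF 1 2] by (simp add: o_def)
  moreover have "(\<lambda>s. frechet_derivative f (at (x + t *\<^sub>R v)) (s *\<^sub>R v))
      = (*) (frechet_derivative f (at (x + t *\<^sub>R v)) v)"
    using linear_frechet_derivative[OF assms] by (auto simp: linear_cmul)
  ultimately show ?thesis by (simp add: has_field_derivative_def)
qed

text \<open>The symmetric second difference is a second derivative at an intermediate point of the
  parallelogram.  Since the difference does not change when \<open>v\<close> and \<open>w\<close> are exchanged, letting the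
  parallelogram shrink yields the symmetry of second derivatives.\<close>

lemma second_difference_mvt:
  fixes f :: "'a::real_normed_vector \<Rightarrow> real"
  assumes f: "k_smooth_on 2 S f" and s: "s > 0"
    and sub: "\<And>a b. 0 \<le> a \<Longrightarrow> a \<le> s \<Longrightarrow> 0 \<le> b \<Longrightarrow> b \<le> s \<Longrightarrow> x + a *\<^sub>R v + b *\<^sub>R w \<in> S"
  obtains a b where "0 \<le> a" "a \<le> s" "0 \<le> b" "b \<le> s"
    "f (x + s *\<^sub>R v + s *\<^sub>R w) - f (x + s *\<^sub>R v) - f (x + s *\<^sub>R w) + f x
       = s * s * dd w (dd v f) (x + a *\<^sub>R v + b *\<^sub>R w)"
proof -
  have df: "f differentiable (at y)" and ddf: "dd v f differentiable (at y)" if "y \<in> S" for y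
    using f that by (auto simp: numeral_2_eq_2)
  define g where "g a = f (x + s *\<^sub>R w + a *\<^sub>R v) - f (x + a *\<^sub>R v)" for a
  have g: "(g has_real_derivative (dd v f (x + s *\<^sub>R w + a *\<^sub>R v) - dd v f (x + a *\<^sub>R v))) (at a)"
    if "0 \<le> a" "a \<le> s" for a
    unfolding g_def
    by (intro DERIV_diff has_real_derivative_along_line df)
      (use sub[OF that, of s] sub[OF that, of 0] s in \<open>auto simp: add_ac\<close>)
  obtain a where a: "0 < a" "a < s"
    "g s - g 0 = (s - 0) * (dd v f (x + s *\<^sub>R w + a *\<^sub>R v) - dd v f (x + a *\<^sub>R v))"
    using MVT2[OF s g] by auto
  have h: "((\<lambda>b. dd v f (x + a *\<^sub>R v + b *\<^sub>R w)) has_real_derivative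
      dd w (dd v f) (x + a *\<^sub>R v + b *\<^sub>R w)) (at b)" if "0 \<le> b" "b \<le> s" for b
    by (rule has_real_derivative_along_line[OF ddf]) (use sub[of a b] a that in auto)
  obtain b where b: "0 < b" "b < s"
    "dd v f (x + a *\<^sub>R v + s *\<^sub>R w) - dd v f (x + a *\<^sub>R v + 0 *\<^sub>R w)
      = (s - 0) * dd w (dd v f) (x + a *\<^sub>R v + b *\<^sub>R w)"
    using MVT2[OF s h] by auto
  show ?thesis
    by (rule that[of a b]) (use a b in \<open>auto simp: g_def algebra_simps\<close>)
qed

lemma second_derivative_symmetric:
  fixes f :: "'a::real_normed_vector \<Rightarrow> real"
  assumes "open S" "k_smooth_on 2 S f" "x \<in> S"
  shows "dd v (dd w f) x = dd w (dd v f) x"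
proof (rule ccontr)
  define e where "e = \<bar>dd v (dd w f) x - dd w (dd v f) x\<bar> / 2"
  assume "\<not> ?thesis"
  then have e: "e > 0" by (simp add: e_def)
  have c: "continuous (at x) (dd w (dd v f))" for v w
  proof -
    have "continuous_on S (dd w (dd v f))" using assms(2) by (simp add: numeral_2_eq_2)
    then show ?thesis using continuous_on_eq_continuous_at[OF assms(1)] assms(3) by blast
  qed
  obtain d1 where d1: "d1 > 0" "\<And>y. dist y x < d1 \<Longrightarrow> dist (dd w (dd v f) y) (dd w (dd v f) x) < e"
    using c e unfolding continuous_at_eps_delta by blast
  obtain d2 where d2: "d2 > 0" "\<And>y. dist y x < d2 \<Longrightarrow> dist (dd v (dd w f) y) (dd v (dd w f) x) < e"
    using c e unfolding continuous_at_eps_delta by blast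
  obtain d3 where d3: "d3 > 0" "ball x d3 \<subseteq> S"
    using assms open_contains_ball by blast
  define d where "d = min d1 (min d2 d3)"
  define s where "s = d / (2 * (norm v + norm w + 1))"
  have d: "d > 0" using d1 d2 d3 by (simp add: d_def)
  have s: "s > 0" unfolding s_def by (intro divide_pos_pos mult_pos_pos d) (auto simp: add_nonneg_pos)
  have near: "dist (x + a *\<^sub>R v' + b *\<^sub>R w') x < d"
    if "0 \<le> a" "a \<le> s" "0 \<le> b" "b \<le> s" "norm v' + norm w' = norm v + norm w" for a b v' w'
  proof -
    have "dist (x + a *\<^sub>R v' + b *\<^sub>R w') x = norm (a *\<^sub>R v' + b *\<^sub>R w')"
      by (simp add: dist_norm add.assoc)
    also have "\<dots> \<le> a * norm v' + b * norm w'"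
      using norm_triangle_ineq[of "a *\<^sub>R v'" "b *\<^sub>R w'"] that by simp
    also have "\<dots> \<le> s * norm v' + s * norm w'"
      using that by (intro add_mono mult_right_mono) auto
    also have "\<dots> = s * (norm v + norm w)" using that(5) by (metis distrib_left)
    also have "\<dots> < s * (2 * (norm v + norm w + 1))"
      using s by (intro mult_strict_left_mono) (auto simp: add_nonneg_pos intro: add_pos_nonneg)
    also have "\<dots> = d" unfolding s_def using norm_ge_zero[of v] norm_ge_zero[of w]
      by (simp add: field_simps add_nonneg_eq_0_iff)
    finally show ?thesis .
  qed
  obtain a b where ab: "0 \<le> a" "a \<le> s" "0 \<le> b" "b \<le> s"
    "f (x + s *\<^sub>R v + s *\<^sub>R w) - f (x + s *\<^sub>R v) - f (x + s *\<^sub>R w) + f x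
       = s * s * dd w (dd v f) (x + a *\<^sub>R v + b *\<^sub>R w)"
    by (rule second_difference_mvt[OF assms(2) s, of x v w])
      (use near d3 in \<open>force simp: d_def dist_commute\<close>)+
  obtain a' b' where ab': "0 \<le> a'" "a' \<le> s" "0 \<le> b'" "b' \<le> s"
    "f (x + s *\<^sub>R w + s *\<^sub>R v) - f (x + s *\<^sub>R w) - f (x + s *\<^sub>R v) + f x
       = s * s * dd v (dd w f) (x + a' *\<^sub>R w + b' *\<^sub>R v)"
    by (rule second_difference_mvt[OF assms(2) s, of x w v])
      (use near d3 in \<open>force simp: d_def dist_commute add.commute\<close>)+
  have "s * s * dd w (dd v f) (x + a *\<^sub>R v + b *\<^sub>R w) = s * s * dd v (dd w f) (x + a' *\<^sub>R w + b' *\<^sub>R v)"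
  proof -
    have "x + s *\<^sub>R w + s *\<^sub>R v = x + s *\<^sub>R v + s *\<^sub>R w" by (simp add: add_ac)
    from ab'(5)[unfolded this] show ?thesis using ab(5) by linarith
  qed
  then have eq: "dd w (dd v f) (x + a *\<^sub>R v + b *\<^sub>R w) = dd v (dd w f) (x + a' *\<^sub>R w + b' *\<^sub>R v)"
    using s by simp
  have "dist (dd w (dd v f) (x + a *\<^sub>R v + b *\<^sub>R w)) (dd w (dd v f) x) < e"
    by (rule d1(2)) (use near[OF ab(1-4)] in \<open>simp add: d_def\<close>)
  moreover have "dist (dd v (dd w f) (x + a' *\<^sub>R w + b' *\<^sub>R v)) (dd v (dd w f) x) < e"
    by (rule d2(2)) (use near[OF ab'(1-4), of w v] in \<open>simp add: d_def add.commute\<close>)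
  moreover have "\<bar>p - q\<bar> \<le> \<bar>r - q\<bar> + \<bar>r - p\<bar>" for p q r :: real by linarith
  ultimately show False
    unfolding eq dist_real_def e_def by (smt (verit) field_sum_of_halves)
qed

section \<open>Defining functions of a hypersurface\<close>

definition grad :: "('a::euclidean_space \<Rightarrow> real) \<Rightarrow> 'a \<Rightarrow> 'a" where
  "grad f x = (\<Sum>b\<in>Basis. dd b f x *\<^sub>R b)"

lemma inner_grad:
  assumes "f differentiable (at x)"
  shows "v \<bullet> grad f x = dd v f x"
  using frechet_derivative_expand[OF assms, of v]
  by (simp add: grad_def inner_sum_right mult.commute)

lemma dd_add:
  assumes "f differentiable (at x)"
  shows "dd (v + w) f x = dd v f x + dd w f x"
  using linear_frechet_derivative[OF assms] by (rule linear_add)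

lemma dd_scaleR:
  assumes "f differentiable (at x)"
  shows "dd (c *\<^sub>R v) f x = c *\<^sub>R dd v f x"
  using linear_frechet_derivative[OF assms] by (rule linear_cmul)

lemma smooth_onD: "smooth_on S f \<Longrightarrow> k_smooth_on k S f"
  by (simp add: smooth_on_def)

lemma smooth_on_dd: "smooth_on S f \<Longrightarrow> smooth_on S (dd v f)"
  unfolding smooth_on_def by (metis k_smooth_on.simps(2))

lemma smooth_on_differentiable: "smooth_on S f \<Longrightarrow> x \<in> S \<Longrightarrow> f differentiable (at x)"
  unfolding smooth_on_def by (metis k_smooth_on.simps(2))

lemma smooth_on_grad:
  assumes "open S" "smooth_on S f"
  shows "smooth_on S (grad f)"
  unfolding smooth_on_def grad_def
  using smooth_on_dd[OF assms(2)]
  by (intro allI k_smooth_on_sum k_smooth_on_scaleR k_smooth_on_const assms(1)) (simp add: smooth_on_def)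

lemma smooth_on_continuous_on: "smooth_on S f \<Longrightarrow> continuous_on S f"
  using smooth_onD[of S f 0] by simp

lemma dd_cong:
  assumes "open S" "x \<in> S" "f differentiable (at x)" "\<And>y. y \<in> S \<Longrightarrow> f y = g y"
  shows "dd v f x = dd v g x"
  using frechet_derivative_transform_within_open[OF assms(3,1,2,4)] by metis

lemma dd_sum_scale:
  fixes f :: "'i \<Rightarrow> 'a::real_normed_vector \<Rightarrow> real"
  assumes "\<And>i. i \<in> I \<Longrightarrow> f i differentiable (at x)"
  shows "dd v (\<lambda>x. \<Sum>i\<in>I. c i * f i x) x = (\<Sum>i\<in>I. c i * dd v (f i) x)"
proof -
  have "((\<lambda>x. \<Sum>i\<in>I. c i * f i x) has_derivative
      (\<lambda>v. \<Sum>i\<in>I. c i * frechet_derivative (f i) (at x) v)) (at x)"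
    using assms frechet_derivative_works by (intro has_derivative_sum has_derivative_mult_right) blast
  from fun_cong[OF frechet_derivative_at[OF this], of v] show ?thesis by simp
qed

lemma dd_dd_expand:
  fixes f :: "'a::euclidean_space \<Rightarrow> real"
  assumes "open S" "smooth_on S f" "x \<in> S"
  shows "dd v (dd w f) x = (\<Sum>b\<in>Basis. (w \<bullet> b) * dd v (dd b f) x)"
proof -
  have "dd w f y = (\<Sum>b\<in>Basis. (w \<bullet> b) * dd b f y)" if "y \<in> S" for y
    using frechet_derivative_expand[OF smooth_on_differentiable[OF assms(2) that], of w] by simp
  then have "dd v (dd w f) x = dd v (\<lambda>y. \<Sum>b\<in>Basis. (w \<bullet> b) * dd b f y) x"
    by (intro dd_cong[OF assms(1,3) smooth_on_differentiable[OF smooth_on_dd[OF assms(2)] assms(3)]])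
  also have "\<dots> = (\<Sum>b\<in>Basis. (w \<bullet> b) * dd v (dd b f) x)"
    by (intro dd_sum_scale smooth_on_differentiable[OF smooth_on_dd[OF assms(2)] assms(3)])
  finally show ?thesis .
qed

lemma dd_dd_commute:
  fixes f :: "'a::euclidean_space \<Rightarrow> real"
  assumes "open S" "smooth_on S f" "x \<in> S"
  shows "dd v (dd w f) x = dd w (dd v f) x"
  using second_derivative_symmetric[OF assms(1) _ assms(3)] assms(2) by (simp add: smooth_on_def)

text \<open>A tangent vector is the velocity of a curve in \<open>M\<close>, and \<open>F\<close> is constant along that curve.  The
  lemma is used for defining functions and for inner products of vector fields along \<open>M\<close>.\<close>

lemma tangent_space_dd_zero:
  fixes F :: "'a::euclidean_space \<Rightarrow> real"
  assumes "v \<in> tangent_space M q" "F differentiable (at q)" "open U" "q \<in> U"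
    and "\<And>x. x \<in> M \<inter> U \<Longrightarrow> F x = 0"
  shows "dd v F q = 0"
proof -
  obtain \<gamma> \<epsilon> where e: "\<epsilon> > (0::real)" and im: "\<gamma> ` {-\<epsilon><..<\<epsilon>} \<subseteq> M" and q: "\<gamma> 0 = q"
    and v: "(\<gamma> has_vector_derivative v) (at 0)"
    using assms(1) by (auto simp: tangent_space_def)
  have "(F has_derivative frechet_derivative F (at q)) (at (\<gamma> 0))"
    using assms(2) frechet_derivative_works q by metis
  from diff_chain_at[OF v[unfolded has_vector_derivative_def] this]
  have 1: "((F \<circ> \<gamma>) has_derivative (\<lambda>t. frechet_derivative F (at q) (t *\<^sub>R v))) (at 0)"
    by (simp add: o_def)
  have "isCont \<gamma> 0" using v by (rule has_vector_derivative_continuous)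
  then have "(\<gamma> \<longlongrightarrow> q) (nhds 0)"
    by (simp add: isCont_def tendsto_nhds_iff q)
  then have "\<forall>\<^sub>F t in nhds 0. \<gamma> t \<in> U"
    unfolding continuous_within
    by (rule topological_tendstoD[OF _ assms(3)]) (use q assms(4) in auto)
  moreover have "\<forall>\<^sub>F t in nhds 0. t \<in> {-\<epsilon><..<\<epsilon>}"
    by (rule eventually_nhds_in_open) (use e in auto)
  ultimately have "\<forall>\<^sub>F t in nhds 0. (F \<circ> \<gamma>) t = 0"
    by eventually_elim (use im assms(5) in \<open>auto simp: image_subset_iff\<close>)
  then obtain T where T: "open T" "0 \<in> T" "\<And>t. t \<in> T \<Longrightarrow> 0 = (F \<circ> \<gamma>) t"
    unfolding eventually_nhds by metis
  have "((F \<circ> \<gamma>) has_derivative (\<lambda>t. 0)) (at 0)"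
    by (rule has_derivative_transform_within_open[OF has_derivative_const T])
  with 1 have "(\<lambda>t. frechet_derivative F (at q) (t *\<^sub>R v)) = (\<lambda>t. 0)"
    by (rule has_derivative_unique)
  from fun_cong[OF this, of 1] show ?thesis by simp
qed

text \<open>The defining function is a component of a slice chart.  The chart is restricted to the preimage
  of a ball, so that \<open>M\<close> and the side where the function is positive become connected.\<close>

lemma hypersurface_defining_function:
  fixes M :: "'a::euclidean_space set"
  assumes "smooth_embedded_hypersurface M" "p \<in> M"
  obtains U \<rho> where "open U" "p \<in> U" "smooth_on U \<rho>" "M \<inter> U = {x\<in>U. \<rho> x = (0::real)}"
    "\<And>q. q \<in> M \<inter> U \<Longrightarrow> grad \<rho> q \<noteq> 0"
    "\<And>q. q \<in> M \<inter> U \<Longrightarrow> tangent_space M q = {v. v \<bullet> grad \<rho> q = 0}"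
    "connected (M \<inter> U)" "connected {x\<in>U. \<rho> x > 0}"
proof -
  obtain U V \<phi> \<psi> b where chart: "open U \<and> open V \<and> p \<in> U \<and>
        homeomorphism U V \<phi> \<psi> \<and> smooth_on U \<phi> \<and> smooth_on V \<psi> \<and>
        b \<noteq> (0::'a) \<and> \<phi> ` (M \<inter> U) = {y \<in> V. y \<bullet> b = 0}"
    using assms(1)[unfolded smooth_embedded_hypersurface_def, THEN bspec, OF assms(2)]
    by (elim exE) (rule that)
  then have oU: "open U" and oV: "open V" and p: "p \<in> U" and hom: "homeomorphism U V \<phi> \<psi>"
    and s\<phi>: "smooth_on U \<phi>" and s\<psi>: "smooth_on V \<psi>" and b: "b \<noteq> 0"
    and im: "\<phi> ` (M \<inter> U) = {y \<in> V. y \<bullet> b = 0}"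
    by blast+
  have \<phi>V: "\<phi> x \<in> V" if "x \<in> U" for x using homeomorphism_image1[OF hom] that by blast
  have \<psi>U: "\<psi> y \<in> U" if "y \<in> V" for y using homeomorphism_image2[OF hom] that by blast
  have \<psi>\<phi>: "\<psi> (\<phi> x) = x" if "x \<in> U" for x using homeomorphism_apply1[OF hom that] .
  have \<phi>\<psi>: "\<phi> (\<psi> y) = y" if "y \<in> V" for y using homeomorphism_apply2[OF hom that] .
  obtain r where r: "r > 0" "ball (\<phi> p) r \<subseteq> V" using oV \<phi>V[OF p] open_contains_ball by blast
  define B where "B = ball (\<phi> p) r"
  define U' where "U' = U \<inter> \<phi> -` B"
  have oU': "open U'" unfolding U'_def B_def
    by (rule continuous_open_preimage[OF homeomorphism_cont1[OF hom] oU open_ball])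
  have U'U: "U' \<subseteq> U" and BV: "B \<subseteq> V" using r by (auto simp: U'_def B_def)
  have pU': "p \<in> U'" using p r by (simp add: U'_def B_def)
  have U'\<psi>: "{x \<in> U'. P (\<phi> x)} = \<psi> ` {y\<in>B. P y}" for P
  proof
    show "{x \<in> U'. P (\<phi> x)} \<subseteq> \<psi> ` {y\<in>B. P y}"
    proof
      fix x assume "x \<in> {x \<in> U'. P (\<phi> x)}"
      then show "x \<in> \<psi> ` {y\<in>B. P y}" using \<psi>\<phi>[of x] by (intro image_eqI[of _ _ "\<phi> x"]) (auto simp: U'_def)
    qed
    show "\<psi> ` {y\<in>B. P y} \<subseteq> {x \<in> U'. P (\<phi> x)}"
      using BV \<phi>\<psi> \<psi>U by (fastforce simp: U'_def)
  qed
  define \<rho> where "\<rho> x = \<phi> x \<bullet> b" for x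
  have smooth: "smooth_on U' \<rho>"
    unfolding smooth_on_def \<rho>_def
    using s\<phi> by (intro allI k_smooth_on_inner k_smooth_on_const oU' k_smooth_on_subset[OF _ U'U])
      (simp add: smooth_on_def)
  have Mpre: "x \<in> M \<longleftrightarrow> \<phi> x \<bullet> b = 0" if "x \<in> U" for x
  proof
    assume "x \<in> M"
    then show "\<phi> x \<bullet> b = 0" using im that by blast
  next
    assume "\<phi> x \<bullet> b = 0"
    then have "\<phi> x \<in> \<phi> ` (M \<inter> U)" using im \<phi>V[OF that] by auto
    then show "x \<in> M" using \<psi>\<phi> that by (metis Int_iff imageE)
  qed
  have MU': "M \<inter> U' = {x\<in>U'. \<rho> x = 0}" using Mpre U'U by (auto simp: \<rho>_def)
  have con: "connected {x\<in>U'. P (\<phi> x \<bullet> b)}" if "convex {y. P (y \<bullet> b)}" for P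
  proof -
    have e: "{y\<in>B. P (y \<bullet> b)} = B \<inter> {y. P (y \<bullet> b)}" by auto
    have c: "connected {y\<in>B. P (y \<bullet> b)}"
      unfolding e by (intro convex_connected convex_Int that) (simp add: B_def)
    have "continuous_on {y\<in>B. P (y \<bullet> b)} \<psi>"
      by (rule continuous_on_subset[OF homeomorphism_cont2[OF hom]]) (use BV in auto)
    from connected_continuous_image[OF this c] show ?thesis
      unfolding U'\<psi>[of "\<lambda>y. P (y \<bullet> b)"] .
  qed
  have D\<phi>: "(\<phi> has_derivative frechet_derivative \<phi> (at q)) (at q)" if "q \<in> U" for q
    using smooth_on_differentiable[OF s\<phi> that] frechet_derivative_works by blast
  have D\<psi>: "(\<psi> has_derivative frechet_derivative \<psi> (at y)) (at y)" if "y \<in> V" for y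
    using smooth_on_differentiable[OF s\<psi> that] frechet_derivative_works by blast
  have inv1: "frechet_derivative \<phi> (at q) (frechet_derivative \<psi> (at (\<phi> q)) w) = w" if q: "q \<in> U" for q w
  proof -
    have c: "((\<phi> \<circ> \<psi>) has_derivative (frechet_derivative \<phi> (at q) \<circ> frechet_derivative \<psi> (at (\<phi> q)))) (at (\<phi> q))"
      by (rule diff_chain_at[OF D\<psi>[OF \<phi>V[OF q]]]) (use D\<phi>[OF q] \<psi>\<phi>[OF q] in simp)
    have "((\<phi> \<circ> \<psi>) has_derivative (\<lambda>v. v)) (at (\<phi> q))"
      by (rule has_derivative_transform_within_open[OF has_derivative_ident oV \<phi>V[OF q]]) (simp add: \<phi>\<psi>)
    from fun_cong[OF has_derivative_unique[OF c this], of w] show ?thesis by simp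
  qed
  have inv2: "frechet_derivative \<psi> (at (\<phi> q)) (frechet_derivative \<phi> (at q) w) = w" if q: "q \<in> U" for q w
  proof -
    have c: "((\<psi> \<circ> \<phi>) has_derivative (frechet_derivative \<psi> (at (\<phi> q)) \<circ> frechet_derivative \<phi> (at q))) (at q)"
      by (rule diff_chain_at[OF D\<phi>[OF q] D\<psi>[OF \<phi>V[OF q]]])
    have "((\<psi> \<circ> \<phi>) has_derivative (\<lambda>v. v)) (at q)"
      by (rule has_derivative_transform_within_open[OF has_derivative_ident oU q]) (simp add: \<psi>\<phi>)
    from fun_cong[OF has_derivative_unique[OF c this], of w] show ?thesis by simp
  qed
  have dd\<rho>: "dd v \<rho> q = frechet_derivative \<phi> (at q) v \<bullet> b" if "q \<in> U" for q v
  proof -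
    have "(\<rho> has_derivative (\<lambda>v. frechet_derivative \<phi> (at q) v \<bullet> b)) (at q)"
      unfolding \<rho>_def by (intro has_derivative_inner_left D\<phi> that)
    from fun_cong[OF frechet_derivative_at[OF this], of v] show ?thesis by simp
  qed
  have grad0: "grad \<rho> q \<noteq> 0" if "q \<in> M \<inter> U'" for q
  proof
    assume "grad \<rho> q = 0"
    then have "dd v \<rho> q = 0" for v
      using inner_grad[OF smooth_on_differentiable[OF smooth], of q v] that by simp
    from this[of "frechet_derivative \<psi> (at (\<phi> q)) b"] show False
      using dd\<rho>[of q] inv1[of q b] that U'U b by auto
  qed
  have tan: "tangent_space M q = {v. v \<bullet> grad \<rho> q = 0}" if q: "q \<in> M \<inter> U'" for q
  proof (intro equalityI subsetI)
    have dq: "\<rho> differentiable (at q)" using smooth_on_differentiable[OF smooth] q by auto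
    fix v
    {
      assume "v \<in> tangent_space M q"
      then have "dd v \<rho> q = 0"
        by (rule tangent_space_dd_zero[OF _ dq oU']) (use q MU' in auto)
      then show "v \<in> {v. v \<bullet> grad \<rho> q = 0}" using inner_grad[OF dq] by simp
    }
    assume "v \<in> {v. v \<bullet> grad \<rho> q = 0}"
    then have v0: "frechet_derivative \<phi> (at q) v \<bullet> b = 0"
      using inner_grad[OF dq] dd\<rho>[of q v] q U'U by auto
    define w where "w = frechet_derivative \<phi> (at q) v"
    have qU: "q \<in> U" using q U'U by auto
    obtain d where d: "d > 0" "ball (\<phi> q) d \<subseteq> V" using oV \<phi>V[OF qU] open_contains_ball by blast
    define e where "e = d / (norm w + 1)"
    have nw: "norm w + 1 > 0" using norm_ge_zero[of w] by linarith
    have e: "e > 0" using d nw by (simp add: e_def)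
    have inV: "\<phi> q + t *\<^sub>R w \<in> V" if "t \<in> {-e<..<e}" for t
    proof -
      have "norm (t *\<^sub>R w) \<le> \<bar>t\<bar> * (norm w + 1)" by (simp add: algebra_simps)
      also have "\<dots> < e * (norm w + 1)" using that nw by (intro mult_strict_right_mono) auto
      also have "\<dots> = d" using nw by (simp add: e_def)
      finally show ?thesis using d by (auto simp: dist_norm)
    qed
    define \<gamma> where "\<gamma> t = \<psi> (\<phi> q + t *\<^sub>R w)" for t
    have "smooth_on {-e<..<e} \<gamma>"
      unfolding smooth_on_def \<gamma>_def
    proof
      fix k show "k_smooth_on k {-e<..<e} (\<lambda>t. \<psi> (\<phi> q + t *\<^sub>R w))"
      proof (rule k_smooth_on_compose[OF _ smooth_onD[OF s\<psi>]])
        show "k_smooth_on k {-e<..<e} (\<lambda>t. \<phi> q + t *\<^sub>R w)"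
          by (intro k_smooth_on_add k_smooth_on_const
              k_smooth_on_bounded_linear[OF _ bounded_linear_scaleR_left] open_greaterThanLessThan)
      qed (use inV in auto)
    qed
    moreover have "\<gamma> ` {-e<..<e} \<subseteq> M"
    proof safe
      fix t assume "t \<in> {-e<..<e}"
      from inV[OF this] show "\<gamma> t \<in> M"
        using Mpre[OF \<psi>U] \<phi>\<psi> Mpre[OF qU] q v0 by (simp add: \<gamma>_def inner_left_distrib w_def)
    qed
    moreover have "\<gamma> 0 = q" using \<psi>\<phi>[OF qU] by (simp add: \<gamma>_def)
    moreover have "(\<gamma> has_vector_derivative v) (at 0)"
    proof -
      have "((\<lambda>t. \<phi> q + t *\<^sub>R w) has_derivative (\<lambda>s. s *\<^sub>R w)) (at 0)"
        by (auto intro!: derivative_eq_intros)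
      from diff_chain_at[OF this, of \<psi> "frechet_derivative \<psi> (at (\<phi> q))"] D\<psi>[OF \<phi>V[OF qU]]
      have "(\<gamma> has_derivative (\<lambda>s. frechet_derivative \<psi> (at (\<phi> q)) (s *\<^sub>R w))) (at 0)"
        by (simp add: o_def \<gamma>_def[abs_def])
      moreover have "frechet_derivative \<psi> (at (\<phi> q)) (s *\<^sub>R w) = s *\<^sub>R v" for s
        using linear_cmul[OF linear_frechet_derivative[OF smooth_on_differentiable[OF s\<psi> \<phi>V[OF qU]]]]
          inv2[OF qU, of v] by (simp add: w_def)
      ultimately show ?thesis by (simp add: has_vector_derivative_def)
    qed
    ultimately show "v \<in> tangent_space M q"
      unfolding tangent_space_def using e by blast
  qed
  show ?thesis
  proof (rule that[OF oU' pU' smooth MU' grad0 tan])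
    show "connected (M \<inter> U')"
      unfolding MU' \<rho>_def using con[of "\<lambda>s. s = 0"] convex_hyperplane[of b 0]
      by (simp add: inner_commute[of b])
    show "connected {x\<in>U'. \<rho> x > 0}"
      unfolding \<rho>_def using con[of "\<lambda>s. s > 0"] convex_halfspace_gt[of 0 b]
      by (simp add: inner_commute[of b])
  qed auto
qed

text \<open>All local geometry of \<open>M\<close> is expressed through such a function: a smooth equation for \<open>M\<close> whose
  gradient points in the direction of the prescribed normal \<open>n\<close>.\<close>

definition oriented_defining_function ::
    "'a::euclidean_space set \<Rightarrow> ('a \<Rightarrow> 'a) \<Rightarrow> 'a set \<Rightarrow> ('a \<Rightarrow> real) \<Rightarrow> bool" where
  "oriented_defining_function M n U \<rho> \<longleftrightarrow>
     open U \<and> smooth_on U \<rho> \<and> M \<inter> U = {x\<in>U. \<rho> x = 0} \<and>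
     (\<forall>q\<in>M \<inter> U. grad \<rho> q \<noteq> 0 \<and> grad \<rho> q = norm (grad \<rho> q) *\<^sub>R n q \<and>
        tangent_space M q = {v. v \<bullet> n q = 0})"

lemma parallel_of_orthogonal_complement:
  fixes a b :: "'a::euclidean_space"
  assumes "a \<noteq> 0" "\<And>v. v \<bullet> a = 0 \<Longrightarrow> v \<bullet> b = 0"
  shows "b = ((b \<bullet> a) / (a \<bullet> a)) *\<^sub>R a"
proof -
  define w where "w = b - ((b \<bullet> a) / (a \<bullet> a)) *\<^sub>R a"
  have wa: "w \<bullet> a = 0" using assms(1) by (simp add: w_def inner_diff_left)
  then have "w \<bullet> w = 0" using assms(2)[OF wa] by (simp add: w_def inner_diff_right inner_diff_left)
  then show ?thesis by (simp add: w_def)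
qed

lemma connected_subset_outside:
  assumes "connected S" "S \<inter> C = {}" "x \<in> S" "x \<in> outside C"
  shows "S \<subseteq> outside C"
proof
  fix y assume "y \<in> S"
  then have "connected_component (- C) x y"
    unfolding connected_component_def using assms by blast
  then show "y \<in> outside C" using outside_same_component assms(4) by blast
qed

lemma connected_subset_inside:
  assumes "connected S" "S \<inter> C = {}" "x \<in> S" "x \<in> inside C"
  shows "S \<subseteq> inside C"
proof
  fix y assume "y \<in> S"
  then have "connected_component (- C) x y"
    unfolding connected_component_def using assms by blast
  then show "y \<in> inside C" using inside_same_component assms(4) by blast
qed

lemma eventually_sign_along_line:
  fixes \<rho> :: "'a::real_normed_vector \<Rightarrow> real"
  assumes "\<rho> differentiable (at q)" "\<rho> q = 0" "dd v \<rho> q > 0" "open U" "q \<in> U"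
  shows "\<forall>\<^sub>F t in at_right 0. q + t *\<^sub>R v \<in> U \<and> \<rho> (q + t *\<^sub>R v) > 0 \<and>
           q - t *\<^sub>R v \<in> U \<and> \<rho> (q - t *\<^sub>R v) < 0"
proof -
  have D: "((\<lambda>t. \<rho> (q + t *\<^sub>R v)) has_real_derivative dd v \<rho> q) (at 0)"
    using has_real_derivative_along_line[of \<rho> q 0 v] assms(1) by simp
  obtain d1 where d1: "d1 > 0" "\<And>h. 0 < h \<Longrightarrow> h < d1 \<Longrightarrow> 0 < \<rho> (q + h *\<^sub>R v)"
    using DERIV_pos_inc_right[OF D assms(3)] assms(2) by auto
  obtain d2 where d2: "d2 > 0" "\<And>h. 0 < h \<Longrightarrow> h < d2 \<Longrightarrow> \<rho> (q - h *\<^sub>R v) < 0"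
    using DERIV_pos_inc_left[OF D assms(3)] assms(2) by auto
  have t: "((\<lambda>t. q + t *\<^sub>R v) \<longlongrightarrow> q) (at_right 0)" "((\<lambda>t. q - t *\<^sub>R v) \<longlongrightarrow> q) (at_right 0)"
    by (auto intro!: tendsto_eq_intros)
  have "\<forall>\<^sub>F t in at_right 0. t \<in> {0<..<min d1 d2}"
    using d1(1) d2(1) by (intro eventually_at_right_real) auto
  moreover have "\<forall>\<^sub>F t in at_right 0. q + t *\<^sub>R v \<in> U" "\<forall>\<^sub>F t in at_right 0. q - t *\<^sub>R v \<in> U"
    using topological_tendstoD[OF t(1) assms(4,5)] topological_tendstoD[OF t(2) assms(4,5)] .
  ultimately show ?thesis
    by eventually_elim (use d1(2) d2(2) in auto)
qed

text \<open>At each point of \<open>M\<close> the normal is parallel to the gradient, and the question is whether the sign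
  of the factor is locally constant.  If it were positive at one point and negative at another one,
  the connected side \<open>\<rho> > 0\<close> would meet, and hence be contained in, both the outside and the inside of
  the component of \<open>M\<close>.  Thus \<open>\<rho>\<close> or \<open>-\<rho>\<close> has the required orientation.\<close>

lemma oriented_defining_function_exists:
  fixes M :: "'a::euclidean_space set"
  assumes M: "smooth_embedded_hypersurface M" and n: "outer_unit_normal M n" and p: "p \<in> M"
  obtains U \<rho> where "p \<in> U" "oriented_defining_function M n U \<rho>"
proof -
  obtain U \<rho> where oU: "open U" and pU: "p \<in> U" and sm: "smooth_on U \<rho>"
    and MU: "M \<inter> U = {x\<in>U. \<rho> x = (0::real)}"
    and g0: "\<And>q. q \<in> M \<inter> U \<Longrightarrow> grad \<rho> q \<noteq> 0"
    and tan: "\<And>q. q \<in> M \<inter> U \<Longrightarrow> tangent_space M q = {v. v \<bullet> grad \<rho> q = 0}"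
    and cM: "connected (M \<inter> U)" and cp: "connected {x\<in>U. \<rho> x > 0}"
    by (rule hypersurface_defining_function[OF M p]) (erule that, assumption+)
  define C where "C = connected_component_set M p"
  have CM: "C \<subseteq> M" unfolding C_def by (rule connected_component_subset)
  have zero: "\<rho> x = 0" if "x \<in> M" "x \<in> U" for x using MU that by blast
  have disj: "{x\<in>U. \<rho> x > 0} \<inter> C = {}" using CM zero by fastforce
  have comp: "connected_component_set M q = C" if "q \<in> M \<inter> U" for q
  proof -
    have "connected_component M p q"
      unfolding connected_component_def using cM p pU that by blast
    then show ?thesis by (simp add: C_def connected_component_eq)
  qed
  have n1: "norm (n q) = 1" if "q \<in> M" for q using n that by (auto simp: outer_unit_normal_def)
  have n_par: "n q = ((n q \<bullet> grad \<rho> q) / (grad \<rho> q \<bullet> grad \<rho> q)) *\<^sub>R grad \<rho> q" if q: "q \<in> M \<inter> U" for q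
    using n q tan[OF q] by (intro parallel_of_orthogonal_complement g0) (auto simp: outer_unit_normal_def)
  have nz: "n q \<bullet> grad \<rho> q \<noteq> 0" if "q \<in> M \<inter> U" for q
  proof
    assume "n q \<bullet> grad \<rho> q = 0"
    then have "n q = 0" using n_par[OF that] by simp
    then show False using n1[of q] that by simp
  qed
  have out: "\<forall>\<^sub>F t in at_right 0. q + t *\<^sub>R n q \<in> outside C \<and> q - t *\<^sub>R n q \<in> inside C" if "q \<in> M \<inter> U" for q
    using n that comp[OF that] by (auto simp: outer_unit_normal_def)
  have diff: "\<rho> differentiable (at q)" if "q \<in> U" for q by (rule smooth_on_differentiable[OF sm that])
  have pos: "{x\<in>U. \<rho> x > 0} \<subseteq> outside C \<and> {x\<in>U. \<rho> x > 0} \<noteq> {}" if q: "q \<in> M \<inter> U" and s: "n q \<bullet> grad \<rho> q > 0" for q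
  proof -
    have "\<forall>\<^sub>F t in at_right 0. q + t *\<^sub>R n q \<in> U \<and> \<rho> (q + t *\<^sub>R n q) > 0 \<and>
           q - t *\<^sub>R n q \<in> U \<and> \<rho> (q - t *\<^sub>R n q) < 0"
      using q MU s inner_grad[OF diff] by (intro eventually_sign_along_line diff oU) auto
    with out[OF q] have "\<forall>\<^sub>F t in at_right 0. q + t *\<^sub>R n q \<in> {x\<in>U. \<rho> x > 0} \<and> q + t *\<^sub>R n q \<in> outside C"
      by eventually_elim auto
    then obtain t :: real where "q + t *\<^sub>R n q \<in> {x\<in>U. \<rho> x > 0}" "q + t *\<^sub>R n q \<in> outside C"
      using eventually_happens[of _ "at_right (0::real)"] by fastforce
    with connected_subset_outside[OF cp disj] show ?thesis by blast
  qed
  have neg: "{x\<in>U. \<rho> x > 0} \<subseteq> inside C" if q: "q \<in> M \<inter> U" and s: "n q \<bullet> grad \<rho> q < 0" for q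
  proof -
    have "dd (- n q) \<rho> q > 0" using q s inner_grad[OF diff, of q "- n q"] by simp
    then have "\<forall>\<^sub>F t in at_right 0. q + t *\<^sub>R (- n q) \<in> U \<and> \<rho> (q + t *\<^sub>R (- n q)) > 0 \<and>
           q - t *\<^sub>R (- n q) \<in> U \<and> \<rho> (q - t *\<^sub>R (- n q)) < 0"
      using q MU by (intro eventually_sign_along_line diff oU) auto
    with out[OF q] have "\<forall>\<^sub>F t in at_right 0. q - t *\<^sub>R n q \<in> {x\<in>U. \<rho> x > 0} \<and> q - t *\<^sub>R n q \<in> inside C"
      by eventually_elim auto
    then obtain t :: real where "q - t *\<^sub>R n q \<in> {x\<in>U. \<rho> x > 0}" "q - t *\<^sub>R n q \<in> inside C"
      using eventually_happens[of _ "at_right (0::real)"] by fastforce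
    with connected_subset_inside[OF cp disj] show ?thesis by blast
  qed
  have same: "n q \<bullet> grad \<rho> q > 0" if "n p \<bullet> grad \<rho> p > 0" "q \<in> M \<inter> U" for q
  proof (rule ccontr)
    assume "\<not> ?thesis"
    then have "n q \<bullet> grad \<rho> q < 0" using nz[OF that(2)] by linarith
    from neg[OF that(2) this] pos[OF _ that(1)] p pU show False
      using inside_Int_outside[of C] by blast
  qed
  have same': "n q \<bullet> grad \<rho> q < 0" if "n p \<bullet> grad \<rho> p < 0" "q \<in> M \<inter> U" for q
  proof (rule ccontr)
    assume "\<not> ?thesis"
    then have "n q \<bullet> grad \<rho> q > 0" using nz[OF that(2)] by linarith
    from pos[OF that(2) this] neg[OF _ that(1)] p pU show False
      using inside_Int_outside[of C] by blast
  qed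
  have par: "g = norm g *\<^sub>R m" if "m = c *\<^sub>R g" "norm m = 1" "m \<bullet> g > 0" for g m :: 'a and c
  proof -
    have "c * (g \<bullet> g) > 0" using that by simp
    then have "c > 0" using inner_ge_zero[of g] by (auto simp: zero_less_mult_iff)
    moreover have "\<bar>c\<bar> * norm g = 1" using that by simp
    ultimately show ?thesis using that(1) by (simp add: mult.commute)
  qed
  show ?thesis
  proof (cases "n p \<bullet> grad \<rho> p > 0")
    case True
    have "oriented_defining_function M n U \<rho>"
      unfolding oriented_defining_function_def
    proof (intro conjI oU sm MU ballI g0)
      fix q assume q: "q \<in> M \<inter> U"
      show *: "grad \<rho> q = norm (grad \<rho> q) *\<^sub>R n q"
        by (rule par[OF n_par[OF q] _ same[OF True q]]) (use n1 q in auto)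
      show "tangent_space M q = {v. v \<bullet> n q = 0}"
        unfolding tan[OF q] by (subst *) (use g0[OF q] in auto)
    qed
    then show ?thesis using that pU by blast
  next
    case False
    then have neg: "n p \<bullet> grad \<rho> p < 0" using nz p pU by force
    have sm': "smooth_on U (\<lambda>x. - \<rho> x)"
      unfolding smooth_on_def
    proof
      fix k
      have "k_smooth_on k U (\<lambda>x. (-1) * \<rho> x)"
        by (intro k_smooth_on_mult k_smooth_on_const oU smooth_onD sm)
      then show "k_smooth_on k U (\<lambda>x. - \<rho> x)" by simp
    qed
    have g': "grad (\<lambda>x. - \<rho> x) q = - grad \<rho> q" if "q \<in> U" for q
    proof -
      have "(\<rho> has_derivative frechet_derivative \<rho> (at q)) (at q)"
        using diff[OF that] frechet_derivative_works by blast
      from frechet_derivative_at[OF has_derivative_minus[OF this]]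
      have "frechet_derivative (\<lambda>x. - \<rho> x) (at q) = (\<lambda>v. - frechet_derivative \<rho> (at q) v)" by simp
      then show ?thesis by (simp add: grad_def sum_negf)
    qed
    have "oriented_defining_function M n U (\<lambda>x. - \<rho> x)"
      unfolding oriented_defining_function_def
    proof (intro conjI oU sm' ballI)
      show "M \<inter> U = {x \<in> U. - \<rho> x = 0}" using MU by simp
    next
      fix q assume q: "q \<in> M \<inter> U"
      then have qU: "q \<in> U" by simp
      show "grad (\<lambda>x. - \<rho> x) q \<noteq> 0" using g'[OF qU] g0[OF q] by simp
      have "- grad \<rho> q = norm (- grad \<rho> q) *\<^sub>R n q"
        by (rule par[of _ "- ((n q \<bullet> grad \<rho> q) / (grad \<rho> q \<bullet> grad \<rho> q))"])
          (use n_par[OF q] n1 q same'[OF neg q] in auto)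
      then show *: "grad (\<lambda>x. - \<rho> x) q = norm (grad (\<lambda>x. - \<rho> x) q) *\<^sub>R n q"
        by (simp only: g'[OF qU])
      have "v \<bullet> grad \<rho> q = 0 \<longleftrightarrow> v \<bullet> n q = 0" for v
      proof -
        have "v \<bullet> (- grad \<rho> q) = norm (- grad \<rho> q) * (v \<bullet> n q)"
          by (subst \<open>- grad \<rho> q = norm (- grad \<rho> q) *\<^sub>R n q\<close>) simp
        then show ?thesis using g0[OF q] by auto
      qed
      then show "tangent_space M q = {v. v \<bullet> n q = 0}" unfolding tan[OF q] by simp
    qed
    then show ?thesis using that pU by blast
  qed
qed

section \<open>Curvature in terms of a defining function\<close>

lemma oriented_defining_functionD:
  assumes "oriented_defining_function M n U \<rho>"
  shows "open U" "smooth_on U \<rho>" "M \<inter> U = {x\<in>U. \<rho> x = 0}"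
    and "q \<in> M \<inter> U \<Longrightarrow> grad \<rho> q \<noteq> 0"
    and "q \<in> M \<inter> U \<Longrightarrow> grad \<rho> q = norm (grad \<rho> q) *\<^sub>R n q"
    and "q \<in> M \<inter> U \<Longrightarrow> tangent_space M q = {v. v \<bullet> n q = 0}"
  using assms unfolding oriented_defining_function_def by blast+

lemma dd_grad:
  fixes f :: "'a::euclidean_space \<Rightarrow> real"
  assumes S: "open S" "smooth_on S f" "x \<in> S"
  shows "w \<bullet> dd v (grad f) x = dd v (dd w f) x"
proof -
  have "(grad f has_derivative (\<lambda>v. \<Sum>b\<in>Basis. dd v (dd b f) x *\<^sub>R b)) (at x)"
    unfolding grad_def
    by (intro has_derivative_sum has_derivative_scaleR_left)
      (metis frechet_derivative_works smooth_on_dd smooth_on_differentiable S(2,3))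
  from fun_cong[OF frechet_derivative_at[OF this], of v]
  have "dd v (grad f) x = (\<Sum>b\<in>Basis. dd v (dd b f) x *\<^sub>R b)" by simp
  then show ?thesis
    using dd_dd_expand[OF S, where v=v and w=w] by (simp add: inner_sum_right mult.commute)
qed

text \<open>For a field \<open>X\<close> that is tangent along \<open>M\<close>, the function \<open>X \<bullet> grad \<rho>\<close> vanishes on \<open>M\<close>.  Its derivative
  in a tangent direction vanishes too, and the product rule expresses \<open>\<langle>\<nabla>\<^sub>v X, n\<rangle>\<close> by the second
  derivatives of \<open>\<rho>\<close>; in particular it depends on \<open>X\<close> only through its value at \<open>q\<close>.\<close>

lemma second_fundamental_form_eq:
  fixes M :: "'a::euclidean_space set"
  assumes odf: "oriented_defining_function M n U \<rho>" and q: "q \<in> M \<inter> U"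
    and v: "v \<bullet> n q = 0" and w: "w \<bullet> n q = 0"
  shows "second_fundamental_form M n q v w = - dd v (dd w \<rho>) q / norm (grad \<rho> q)"
proof -
  note oU = oriented_defining_functionD(1)[OF odf] and sm = oriented_defining_functionD(2)[OF odf]
    and MU = oriented_defining_functionD(3)[OF odf] and g0 = oriented_defining_functionD(4)[OF odf]
    and par = oriented_defining_functionD(5)[OF odf] and tan = oriented_defining_functionD(6)[OF odf]
  define g where "g = grad \<rho>"
  have smg: "smooth_on U g" unfolding g_def by (rule smooth_on_grad[OF oU sm])
  have qU: "q \<in> U" and qM: "q \<in> M" using q by auto
  have tang: "x \<bullet> g r = 0 \<longleftrightarrow> x \<bullet> n r = 0" if "r \<in> M \<inter> U" for x r
    using par[OF that] g0[OF that] unfolding g_def by (metis inner_scaleR_right mult_eq_0_iff norm_eq_zero)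
  \<comment> \<open>Multiplying the tangential projection of \<open>w\<close> by \<open>g \<bullet> g\<close>, normalised at \<open>q\<close>, gives a tangent
    extension of \<open>w\<close> without any division by functions.\<close>
  define W where "W x = (1 / (g q \<bullet> g q)) *\<^sub>R ((g x \<bullet> g x) *\<^sub>R w + (- (w \<bullet> g x)) *\<^sub>R g x)" for x
  have smW: "smooth_on U W"
    unfolding smooth_on_def W_def
  proof
    fix k
    have "k_smooth_on k U (\<lambda>x. (1 / (g q \<bullet> g q)) *\<^sub>R ((g x \<bullet> g x) *\<^sub>R w + ((- w) \<bullet> g x) *\<^sub>R g x))"
      by (intro k_smooth_on_scaleR k_smooth_on_add k_smooth_on_inner k_smooth_on_const oU smooth_onD smg)
    then show "k_smooth_on k U (\<lambda>x. (1 / (g q \<bullet> g q)) *\<^sub>R ((g x \<bullet> g x) *\<^sub>R w + (- (w \<bullet> g x)) *\<^sub>R g x))"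
      by simp
  qed
  have Wtan: "W r \<in> tangent_space M r" if "r \<in> M \<inter> U" for r
  proof -
    have "W r \<bullet> g r = 0" by (simp add: W_def inner_add_left algebra_simps)
    then show ?thesis using tang[OF that] tan[OF that] by simp
  qed
  have Wq: "W q = w"
    using g0[OF q] tang[OF q, of w] w by (simp add: W_def g_def)
  have key: "frechet_derivative X (at q) v \<bullet> n q = - dd v (dd w \<rho>) q / norm (grad \<rho> q)"
    if X: "open U'" "q \<in> U'" "smooth_on U' X" "\<forall>r\<in>M \<inter> U'. X r \<in> tangent_space M r" "X q = w" for U' X
  proof -
    define F where "F x = X x \<bullet> g x" for x
    have dX: "(X has_derivative frechet_derivative X (at q)) (at q)"
      using smooth_on_differentiable[OF X(3,2)] frechet_derivative_works by blast
    have dg: "(g has_derivative frechet_derivative g (at q)) (at q)"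
      using smooth_on_differentiable[OF smg qU] frechet_derivative_works by blast
    have dF: "(F has_derivative (\<lambda>v. X q \<bullet> dd v g q + dd v X q \<bullet> g q)) (at q)"
      unfolding F_def by (rule has_derivative_inner[OF dX dg])
    have "dd v F q = 0"
    proof (rule tangent_space_dd_zero)
      show "v \<in> tangent_space M q" using tan[OF q] v by simp
      show "F differentiable (at q)" using dF unfolding differentiable_def by blast
      show "open (U \<inter> U')" "q \<in> U \<inter> U'" using oU X qU by auto
      show "F x = 0" if "x \<in> M \<inter> (U \<inter> U')" for x
        using X(4) that tan[of x] tang[of x "X x"] by (auto simp: F_def)
    qed
    moreover have "dd v F q = X q \<bullet> dd v g q + dd v X q \<bullet> g q"
      using fun_cong[OF frechet_derivative_at[OF dF], of v] by simp
    moreover have "X q \<bullet> dd v g q = dd v (dd w \<rho>) q"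
      unfolding X(5) g_def by (rule dd_grad[OF oU sm qU])
    ultimately have "dd v X q \<bullet> g q = - dd v (dd w \<rho>) q" by simp
    moreover have "dd v X q \<bullet> g q = norm (grad \<rho> q) * (dd v X q \<bullet> n q)"
      using par[OF q] unfolding g_def by (metis inner_scaleR_right)
    ultimately show ?thesis using g0[OF q] by (simp add: field_simps)
  qed
  show ?thesis
    unfolding second_fundamental_form_def
  proof (rule the_equality)
    show "\<exists>U' W. open U' \<and> q \<in> U' \<and> smooth_on U' W \<and> (\<forall>r\<in>M \<inter> U'. W r \<in> tangent_space M r) \<and> W q = w \<and>
        - dd v (dd w \<rho>) q / norm (grad \<rho> q) = frechet_derivative W (at q) v \<bullet> n q"
      using key[OF oU qU smW _ Wq] Wtan oU qU smW Wq by (intro exI[of _ U] exI[of _ W]) auto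
  next
    fix a assume "\<exists>U' W. open U' \<and> q \<in> U' \<and> smooth_on U' W \<and> (\<forall>r\<in>M \<inter> U'. W r \<in> tangent_space M r) \<and> W q = w \<and>
        a = frechet_derivative W (at q) v \<bullet> n q"
    then show "a = - dd v (dd w \<rho>) q / norm (grad \<rho> q)" using key by blast
  qed
qed

text \<open>The expansion hypothesis says that \<open>Q\<close> is bilinear; the claim is the invariance of its trace.\<close>

lemma trace_orthonormal:
  fixes Q :: "'a::euclidean_space \<Rightarrow> 'a \<Rightarrow> real"
  assumes B: "pairwise orthogonal B" "\<And>e. e \<in> B \<Longrightarrow> norm e = 1" "span B = UNIV" "finite B"
    and Q: "\<And>v w. Q v w = (\<Sum>b\<in>Basis. \<Sum>c\<in>Basis. (v \<bullet> b) * (w \<bullet> c) * Q b c)"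
  shows "(\<Sum>e\<in>B. Q e e) = (\<Sum>b\<in>Basis. Q b b)"
proof -
  have P: "(\<Sum>e\<in>B. (e \<bullet> b) * (e \<bullet> c)) = b \<bullet> c" for b c
  proof -
    have "b \<bullet> c = (\<Sum>e\<in>B. (b \<bullet> e) *\<^sub>R e) \<bullet> c"
      using orthonormal_basis_expand[OF B(1,2) _ B(4), of b] B(3) by simp
    also have "\<dots> = (\<Sum>e\<in>B. (b \<bullet> e) * (e \<bullet> c))" by (simp add: inner_sum_left)
    finally show ?thesis by (simp add: inner_commute[of b])
  qed
  have "(\<Sum>e\<in>B. Q e e) = (\<Sum>e\<in>B. \<Sum>b\<in>Basis. \<Sum>c\<in>Basis. (e \<bullet> b) * (e \<bullet> c) * Q b c)"
    by (intro sum.cong refl Q)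
  also have "\<dots> = (\<Sum>b\<in>Basis. \<Sum>e\<in>B. \<Sum>c\<in>Basis. (e \<bullet> b) * (e \<bullet> c) * Q b c)"
    by (rule sum.swap)
  also have "\<dots> = (\<Sum>b\<in>Basis. \<Sum>c\<in>Basis. \<Sum>e\<in>B. (e \<bullet> b) * (e \<bullet> c) * Q b c)"
    by (intro sum.cong refl sum.swap)
  also have "\<dots> = (\<Sum>b\<in>Basis. \<Sum>c\<in>Basis. (b \<bullet> c) * Q b c)"
    by (simp add: sum_distrib_right[symmetric] P)
  also have "\<dots> = (\<Sum>b\<in>Basis. \<Sum>c\<in>Basis. if c = b then Q b c else 0)"
    by (intro sum.cong refl) (auto simp: inner_Basis)
  also have "\<dots> = (\<Sum>b\<in>Basis. Q b b)" by simp
  finally show ?thesis .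
qed

lemma dd_dd_bilinear_expand:
  fixes f :: "'a::euclidean_space \<Rightarrow> real"
  assumes S: "open S" "smooth_on S f" "x \<in> S"
  shows "dd v (dd w f) x = (\<Sum>b\<in>Basis. \<Sum>c\<in>Basis. (v \<bullet> b) * (w \<bullet> c) * dd b (dd c f) x)"
proof -
  have "dd v (dd w f) x = (\<Sum>b\<in>Basis. (v \<bullet> b) * dd b (dd w f) x)"
    using frechet_derivative_expand[OF smooth_on_differentiable[OF smooth_on_dd[OF S(2)] S(3)], where v=v] by simp
  also have "\<dots> = (\<Sum>b\<in>Basis. \<Sum>c\<in>Basis. (v \<bullet> b) * (w \<bullet> c) * dd b (dd c f) x)"
    by (intro sum.cong refl, subst dd_dd_expand[OF S]) (simp add: sum_distrib_left mult.assoc)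
  finally show ?thesis .
qed

text \<open>Adding \<open>n q\<close> to an orthonormal basis of the tangent space gives an orthonormal basis of the whole
  space, so the tangential trace is the full trace minus its normal entry.\<close>

lemma mean_curvature_eq:
  fixes M :: "'a::euclidean_space set"
  assumes odf: "oriented_defining_function M n U \<rho>" and q: "q \<in> M \<inter> U" and n1: "norm (n q) = 1"
  shows "mean_curvature M n q =
     ((\<Sum>b\<in>Basis. dd b (dd b \<rho>) q) - dd (n q) (dd (n q) \<rho>) q) / norm (grad \<rho> q)"
proof -
  note D = oriented_defining_functionD[OF odf]
  have T: "tangent_space M q = {v. v \<bullet> n q = 0}" by (rule D(6)[OF q])
  have "subspace (tangent_space M q)" unfolding T by (simp add: subspace_hyperplane2)
  from orthonormal_basis_subspace[OF this] obtain B0 where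
    "pairwise orthogonal B0" "\<And>x. x \<in> B0 \<Longrightarrow> norm x = 1" "span B0 = tangent_space M q" by metis
  then have "orthonormal_basis (tangent_space M q) B0" by (simp add: orthonormal_basis_def)
  define B where "B = (SOME B. orthonormal_basis (tangent_space M q) B)"
  have "orthonormal_basis (tangent_space M q) B"
    unfolding B_def by (rule someI[of _ B0]) fact
  then have B: "pairwise orthogonal B" "\<And>e. e \<in> B \<Longrightarrow> norm e = 1" "span B = tangent_space M q"
    by (auto simp: orthonormal_basis_def)
  have "0 \<notin> B" using B(2) by force
  then have fin: "finite B" using pairwise_orthogonal_independent[OF B(1)] independent_imp_finite by blast
  have BT: "e \<bullet> n q = 0" if "e \<in> B" for e using B(3) T span_base[OF that] by auto
  then have nB: "n q \<notin> B" using n1 by (metis inner_eq_zero_iff norm_zero zero_neq_one)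
  have "span (insert (n q) B) = UNIV"
  proof -
    have "x \<in> span (insert (n q) B)" for x
    proof -
      have "n q \<bullet> n q = 1" using n1 by (simp add: norm_eq_1)
      then have "x - (x \<bullet> n q) *\<^sub>R n q \<in> span B" unfolding B(3) T by (simp add: inner_diff_left)
      then show ?thesis unfolding span_insert by blast
    qed
    then show ?thesis by blast
  qed
  moreover have "pairwise orthogonal (insert (n q) B)"
    using B(1) BT by (auto simp: pairwise_insert orthogonal_def inner_commute)
  ultimately have "(\<Sum>e\<in>insert (n q) B. dd e (dd e \<rho>) q) = (\<Sum>b\<in>Basis. dd b (dd b \<rho>) q)"
  proof (intro trace_orthonormal[where Q="\<lambda>v w. dd v (dd w \<rho>) q"])
    show "norm e = 1" if "e \<in> insert (n q) B" for e using that n1 B(2) by blast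
    show "finite (insert (n q) B)" using fin by simp
    show "dd v (dd w \<rho>) q = (\<Sum>b\<in>Basis. \<Sum>c\<in>Basis. (v \<bullet> b) * (w \<bullet> c) * dd b (dd c \<rho>) q)" for v w
      using q by (intro dd_dd_bilinear_expand[OF D(1,2)]) auto
  qed
  then have tr: "(\<Sum>e\<in>B. dd e (dd e \<rho>) q) = (\<Sum>b\<in>Basis. dd b (dd b \<rho>) q) - dd (n q) (dd (n q) \<rho>) q"
    using fin nB by simp
  have "mean_curvature M n q = - (\<Sum>e\<in>B. - dd e (dd e \<rho>) q / norm (grad \<rho> q))"
    unfolding mean_curvature_def B_def[symmetric]
    by (intro arg_cong[of _ _ uminus] sum.cong refl second_fundamental_form_eq[OF odf q] BT)
  also have "\<dots> = (\<Sum>e\<in>B. dd e (dd e \<rho>) q) / norm (grad \<rho> q)"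
    by (simp add: sum_negf sum_divide_distrib)
  finally show ?thesis unfolding tr .
qed

section \<open>Graphs over a tangent hyperplane\<close>

lemma oriented_defining_function_norm:
  assumes "oriented_defining_function M n U \<rho>" "q \<in> M \<inter> U"
  shows "norm (n q) = 1"
proof -
  have "norm (grad \<rho> q) = norm (grad \<rho> q) * norm (n q)"
    using arg_cong[OF oriented_defining_functionD(5)[OF assms], of norm] by simp
  then show ?thesis using oriented_defining_functionD(4)[OF assms] by simp
qed

text \<open>At a point of \<open>M\<close> the gradients of any two defining functions are both orthogonal to the tangent
  hyperplane and hence parallel, so that only the sign has to be controlled.\<close>

lemma oriented_defining_function_transfer:
  fixes M :: "'a::euclidean_space set"
  assumes odf: "oriented_defining_function M n U \<rho>"
    and U': "open U'" "U' \<subseteq> U" "smooth_on U' \<sigma>" "M \<inter> U' = {x\<in>U'. \<sigma> x = 0}"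
    and pos: "\<And>q. q \<in> M \<inter> U' \<Longrightarrow> dd (n q) \<sigma> q > 0"
  shows "oriented_defining_function M n U' \<sigma>"
  unfolding oriented_defining_function_def
proof (intro conjI U' ballI)
  fix q assume q: "q \<in> M \<inter> U'"
  then have qU: "q \<in> M \<inter> U" using U'(2) by auto
  have d: "\<sigma> differentiable (at q)" using smooth_on_differentiable[OF U'(3)] q by auto
  show T: "tangent_space M q = {v. v \<bullet> n q = 0}" by (rule oriented_defining_functionD(6)[OF odf qU])
  have n1: "norm (n q) = 1" by (rule oriented_defining_function_norm[OF odf qU])
  have p: "n q \<bullet> grad \<sigma> q > 0" using pos[OF q] inner_grad[OF d] by simp
  then show "grad \<sigma> q \<noteq> 0" by auto
  have "grad \<sigma> q = ((grad \<sigma> q \<bullet> n q) / (n q \<bullet> n q)) *\<^sub>R n q"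
  proof (rule parallel_of_orthogonal_complement)
    show "n q \<noteq> 0" using n1 by auto
    fix v assume "v \<bullet> n q = 0"
    then have "v \<in> tangent_space M q" using T by simp
    then have "dd v \<sigma> q = 0"
      by (rule tangent_space_dd_zero[OF _ d U'(1)]) (use q U'(4) in blast)+
    then show "v \<bullet> grad \<sigma> q = 0" using inner_grad[OF d] by simp
  qed
  then have e: "grad \<sigma> q = (grad \<sigma> q \<bullet> n q) *\<^sub>R n q" using n1 by (simp add: norm_eq_1)
  have "norm (grad \<sigma> q) = grad \<sigma> q \<bullet> n q"
    using arg_cong[OF e, of norm] n1 p by (simp add: inner_commute)
  then show "grad \<sigma> q = norm (grad \<sigma> q) *\<^sub>R n q" using e by simp
qed

text \<open>The map \<open>\<Phi>\<close> below keeps the tangential coordinates around \<open>z\<close> and replaces the normal coordinate by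
  \<open>\<rho>\<close>.  It flattens \<open>M\<close> to the tangent plane at \<open>z\<close>, and the normal coordinate of its inverse on
  that plane is the graph function.  The graph function is extended to an open cylinder so as to be
  constant along \<open>n z\<close>: then it is an ordinary function on an open subset of the ambient space.\<close>

lemma smooth_graph_representation:
  fixes M :: "'a::euclidean_space set"
  assumes odf: "oriented_defining_function M n U \<rho>" and z: "z \<in> M \<inter> U"
  obtains S f U' where "open S" "z \<in> S" "smooth_on S f" "f z = (0::real)"
    "\<And>X t. X \<in> S \<Longrightarrow> X + t *\<^sub>R n z \<in> S \<and> f (X + t *\<^sub>R n z) = f X"
    "\<And>X. X \<in> S \<Longrightarrow> X + (f X - (X - z) \<bullet> n z) *\<^sub>R n z \<in> M \<inter> U'" "U' \<subseteq> S"
    "oriented_defining_function M n U' (\<lambda>X. (X - z) \<bullet> n z - f X)"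
proof -
  note D = oriented_defining_functionD[OF odf]
  define \<nu> where "\<nu> = n z"
  have n1: "norm \<nu> = 1" unfolding \<nu>_def by (rule oriented_defining_function_norm[OF odf z])
  then have nn: "\<nu> \<bullet> \<nu> = 1" by (simp add: norm_eq_1)
  have diff: "\<rho> differentiable (at x)" if "x \<in> U" for x by (rule smooth_on_differentiable[OF D(2) that])
  define U0 where "U0 = U \<inter> dd \<nu> \<rho> -` {0<..}"
  have oU0: "open U0"
    unfolding U0_def
    by (rule continuous_open_preimage[OF smooth_on_continuous_on[OF smooth_on_dd[OF D(2)]] D(1) open_greaterThan])
  have U0U: "U0 \<subseteq> U" by (auto simp: U0_def)
  have gz: "dd v \<rho> z = norm (grad \<rho> z) * (v \<bullet> \<nu>)" for v
    using inner_grad[OF diff, of z v] z D(5)[OF z] unfolding \<nu>_def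
    by (metis IntD2 inner_scaleR_right)
  have g0: "norm (grad \<rho> z) > 0" using D(4)[OF z] by simp
  have zU0: "z \<in> U0" using z gz[of \<nu>] g0 nn by (simp add: U0_def)
  define \<Phi> where "\<Phi> x = x + (\<rho> x - (x - z) \<bullet> \<nu>) *\<^sub>R \<nu>" for x
  define F where "F x v = v + (dd v \<rho> x - v \<bullet> \<nu>) *\<^sub>R \<nu>" for x v
  have D\<rho>: "(\<rho> has_derivative frechet_derivative \<rho> (at x)) (at x)" if "x \<in> U" for x
    using diff[OF that] frechet_derivative_works by blast
  have D\<Phi>: "(\<Phi> has_derivative F x) (at x)" if "x \<in> U0" for x
  proof -
    have "(\<rho> has_derivative frechet_derivative \<rho> (at x)) (at x)" using D\<rho> that U0U by auto
    then show ?thesis unfolding \<Phi>_def F_def by (auto intro!: derivative_eq_intros)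
  qed
  define F' where "F' x = Blinfun (F x)" for x
  have F': "blinfun_apply (F' x) = F x" if "x \<in> U0" for x
    unfolding F'_def
    by (rule bounded_linear_Blinfun_apply[OF has_derivative_bounded_linear[OF D\<Phi>[OF that]]])
  \<comment> \<open>\<open>K\<close> is the inverse of the derivative of \<open>\<Phi>\<close> at \<open>z\<close>.\<close>
  define K where "K w = w + (inverse (norm (grad \<rho> z)) * (w \<bullet> \<nu>) - w \<bullet> \<nu>) *\<^sub>R \<nu>" for w
  have blK: "bounded_linear K"
    unfolding K_def by (intro bounded_linear_intros)
  obtain U1 V1 G G' where oU1: "open U1" and U1: "U1 \<subseteq> U0" and zU1: "z \<in> U1"
    and oV1: "open V1" and zV1: "\<Phi> z \<in> V1" and hom: "homeomorphism U1 V1 \<Phi> G"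
    and DG: "\<And>y. y \<in> V1 \<Longrightarrow> (G has_derivative (G' y)) (at y)"
  proof (rule inverse_function_theorem[OF oU0, of \<Phi> F' z "Blinfun K"])
    show "(\<Phi> has_derivative blinfun_apply (F' x)) (at x)" if "x \<in> U0" for x
      using D\<Phi>[OF that] F'[OF that] by simp
    show "continuous_on U0 F'"
    proof (rule continuous_on_blinfun_componentwise)
      fix i :: 'a assume "i \<in> Basis"
      have "continuous_on U0 (\<lambda>x. F x i)"
        unfolding F_def
        by (intro continuous_intros continuous_on_subset[OF smooth_on_continuous_on[OF smooth_on_dd[OF D(2)]] U0U])
      then show "continuous_on U0 (\<lambda>x. blinfun_apply (F' x) i)"
        by (rule continuous_on_eq) (simp add: F')
    qed
    show "z \<in> U0" by (rule zU0)
    show "Blinfun K o\<^sub>L F' z = id_blinfun"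
    proof (rule blinfun_eqI)
      fix v
      have F: "F z v \<bullet> \<nu> = norm (grad \<rho> z) * (v \<bullet> \<nu>)"
        unfolding F_def gz by (simp add: inner_add_left nn)
      then have "K (F z v) = F z v + (v \<bullet> \<nu> - norm (grad \<rho> z) * (v \<bullet> \<nu>)) *\<^sub>R \<nu>"
        unfolding K_def F using g0 by simp
      also have "\<dots> = v" unfolding F_def gz by (simp add: scaleR_diff_left)
      finally have "K (F z v) = v" .
      then show "blinfun_apply (Blinfun K o\<^sub>L F' z) v = blinfun_apply id_blinfun v"
        using F'[OF zU0] by (simp add: bounded_linear_Blinfun_apply[OF blK])
    qed
  qed (rule that)
  have \<rho>z: "\<rho> z = 0" using z D(3) by blast
  have \<Phi>z: "\<Phi> z = z" by (simp add: \<Phi>_def \<rho>z)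
  have zV1: "z \<in> V1" using zV1 \<Phi>z by simp
  have G\<Phi>: "G (\<Phi> x) = x" if "x \<in> U1" for x using homeomorphism_apply1[OF hom that] .
  have \<Phi>G: "\<Phi> (G y) = y" if "y \<in> V1" for y using homeomorphism_apply2[OF hom that] .
  have GU1: "G y \<in> U1" if "y \<in> V1" for y using homeomorphism_image2[OF hom] that by blast
  define pr where "pr X = X - ((X - z) \<bullet> \<nu>) *\<^sub>R \<nu>" for X
  have cpr: "continuous_on UNIV pr" unfolding pr_def by (intro continuous_intros)
  define S where "S = pr -` V1"
  have oS: "open S" unfolding S_def by (rule open_vimage[OF oV1 cpr])
  define f where "f X = (G (pr X) - z) \<bullet> \<nu>" for X
  have pr_line: "pr (X + t *\<^sub>R \<nu>) = pr X" for X t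
    by (simp add: pr_def inner_diff_left inner_add_left nn algebra_simps)
  have prpl: "(pr X - z) \<bullet> \<nu> = 0" for X by (simp add: pr_def inner_diff_left nn)
  have prz: "pr z = z" by (simp add: pr_def)
  define hat where "hat X = X + (f X - (X - z) \<bullet> \<nu>) *\<^sub>R \<nu>" for X
  have hatG: "hat X = G (pr X) \<and> \<rho> (hat X) = 0" if "X \<in> S" for X
  proof -
    have V: "pr X \<in> V1" using that by (simp add: S_def)
    define x where "x = G (pr X)"
    have e: "x + (\<rho> x - (x - z) \<bullet> \<nu>) *\<^sub>R \<nu> = pr X" using \<Phi>G[OF V] by (simp add: \<Phi>_def x_def)
    have "(pr X - z) \<bullet> \<nu> = \<rho> x"
      unfolding e[symmetric] by (simp add: inner_diff_left inner_add_left nn)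
    then have \<rho>x: "\<rho> x = 0" using prpl by simp
    have "x = pr X + ((x - z) \<bullet> \<nu>) *\<^sub>R \<nu>" using e \<rho>x by (simp add: algebra_simps)
    also have "\<dots> = hat X" by (simp add: hat_def f_def x_def pr_def algebra_simps)
    finally show ?thesis using \<rho>x by (simp add: x_def)
  qed
  have hatU1: "hat X \<in> U1" if "X \<in> S" for X using hatG[OF that] GU1 that by (simp add: S_def)
  \<comment> \<open>Implicit differentiation of \<open>\<rho> (hat X) = 0\<close>: the derivative of \<open>f\<close> at \<open>X\<close> is \<open>R v (hat X)\<close>, and
    \<open>hat X\<close> depends on \<open>X\<close> only through \<open>X\<close> and \<open>f X\<close>.  So \<open>f\<close> has one derivative more than it is already
    known to have, which gives its smoothness by induction.\<close>
  define R where "R v x = v \<bullet> \<nu> + (-1) * (dd v \<rho> x * inverse (dd \<nu> \<rho> x))" for v x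
  have Df: "(f has_derivative (\<lambda>v. R v (hat X))) (at X)" if X: "X \<in> S" for X
  proof -
    have V: "pr X \<in> V1" using that by (simp add: S_def)
    have Dpr: "(pr has_derivative (\<lambda>v. v - (v \<bullet> \<nu>) *\<^sub>R \<nu>)) (at X)"
      unfolding pr_def by (auto intro!: derivative_eq_intros)
    from diff_chain_at[OF Dpr DG[OF V]]
    have "((\<lambda>X. G (pr X)) has_derivative (\<lambda>v. G' (pr X) (v - (v \<bullet> \<nu>) *\<^sub>R \<nu>))) (at X)"
      by (simp add: o_def)
    from has_derivative_inner_left[OF has_derivative_diff[OF this has_derivative_const]]
    obtain f' where f': "(f has_derivative f') (at X)"
      unfolding f_def[abs_def] by blast
    have Dhat: "(hat has_derivative (\<lambda>v. v + (f' v - v \<bullet> \<nu>) *\<^sub>R \<nu>)) (at X)"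
      unfolding hat_def by (auto intro!: derivative_eq_intros f')
    have xU: "hat X \<in> U0" using hatU1[OF X] U1 by auto
    then have xU': "hat X \<in> U" using U0U by auto
    from diff_chain_at[OF Dhat D\<rho>[OF xU']]
    have 1: "((\<lambda>X. \<rho> (hat X)) has_derivative
        (\<lambda>v. frechet_derivative \<rho> (at (hat X)) (v + (f' v - v \<bullet> \<nu>) *\<^sub>R \<nu>))) (at X)"
      by (simp add: o_def)
    have 2: "((\<lambda>X. \<rho> (hat X)) has_derivative (\<lambda>v. 0)) (at X)"
      by (rule has_derivative_transform_within_open[OF has_derivative_const[where c="0::real"] oS X])
        (simp only: hatG[THEN conjunct2])
    have "f' v = R v (hat X)" for v
    proof -
      have "dd (v + (f' v - v \<bullet> \<nu>) *\<^sub>R \<nu>) \<rho> (hat X) = 0"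
        using fun_cong[OF has_derivative_unique[OF 1 2], of v] .
      then have "dd v \<rho> (hat X) + (f' v - v \<bullet> \<nu>) * dd \<nu> \<rho> (hat X) = 0"
        by (simp add: dd_add[OF diff[OF xU']] dd_scaleR[OF diff[OF xU']])
      moreover have "dd \<nu> \<rho> (hat X) > 0" using xU by (simp add: U0_def)
      ultimately show ?thesis by (simp add: R_def field_simps)
    qed
    then have "f' = (\<lambda>v. R v (hat X))" by auto
    with f' show ?thesis by simp
  qed
  have smf: "smooth_on S f"
    unfolding smooth_on_def
  proof
    fix k show "k_smooth_on k S f"
    proof (induction k)
      case 0
      have "\<forall>X\<in>S. isCont f X" using Df has_derivative_continuous by blast
      then show ?case by (simp add: continuous_at_imp_continuous_on)
    next
      case (Suc k)
      show ?case
      proof (rule k_smooth_on_SucI[OF oS Df])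
        fix v
        have "k_smooth_on k S (\<lambda>X. X + (f X + ((-1) * ((X + (- z)) \<bullet> \<nu>))) *\<^sub>R \<nu>)"
          by (intro k_smooth_on_add k_smooth_on_scaleR k_smooth_on_mult k_smooth_on_inner k_smooth_on_const
              k_smooth_on_bounded_linear[OF _ bounded_linear_ident] oS Suc.IH)
        then have hat: "k_smooth_on k S hat" by (simp add: hat_def[abs_def])
        have "k_smooth_on k U0 (R v)"
          unfolding R_def[abs_def]
          by (intro k_smooth_on_add k_smooth_on_mult k_smooth_on_const k_smooth_on_inverse oU0
              k_smooth_on_subset[OF smooth_onD[OF smooth_on_dd[OF D(2)]] U0U]) (simp add: U0_def)
        from k_smooth_on_compose[OF oS this hat] show "k_smooth_on k S (\<lambda>X. R v (hat X))"
          using hatU1 U1 by blast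
      qed
    qed
  qed
  define U' where "U' = U1 \<inter> S"
  have oU': "open U'" using oU1 oS by (auto simp: U'_def)
  have inM: "x \<in> M \<longleftrightarrow> \<rho> x = 0" if "x \<in> U" for x using D(3) that by blast
  have hatM: "hat X \<in> M \<inter> U'" if "X \<in> S" for X
  proof -
    have "hat X \<in> S" using pr_line that by (simp add: S_def hat_def)
    then show ?thesis using hatU1[OF that] hatG[OF that] inM[of "hat X"] U1 U0U by (auto simp: U'_def)
  qed
  have level: "M \<inter> U' = {X\<in>U'. (X - z) \<bullet> \<nu> - f X = 0}"
  proof (intro set_eqI iffI)
    fix X assume "X \<in> M \<inter> U'"
    then have X: "X \<in> U1" "X \<in> S" "X \<in> M" by (auto simp: U'_def)
    then have "\<rho> X = 0" using inM U1 U0U by blast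
    then have "\<Phi> X = pr X" by (simp add: \<Phi>_def pr_def algebra_simps)
    then have "G (pr X) = X" using G\<Phi>[OF X(1)] by simp
    then show "X \<in> {X\<in>U'. (X - z) \<bullet> \<nu> - f X = 0}" using X by (simp add: f_def U'_def)
  next
    fix X assume "X \<in> {X\<in>U'. (X - z) \<bullet> \<nu> - f X = 0}"
    then have "X \<in> U'" "hat X = X" by (auto simp: hat_def)
    then show "X \<in> M \<inter> U'" using hatM[of X] by (auto simp: U'_def)
  qed
  have D\<sigma>: "((\<lambda>X. (X - z) \<bullet> \<nu> - f X) has_derivative (\<lambda>v. v \<bullet> \<nu> - R v (hat X))) (at X)" if "X \<in> S" for X
    by (auto intro!: derivative_eq_intros Df[OF that])
  have smg: "smooth_on U' (\<lambda>X. (X - z) \<bullet> \<nu> - f X)"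
    unfolding smooth_on_def
  proof
    fix k
    have "k_smooth_on k U' f" by (rule k_smooth_on_subset[OF smooth_onD[OF smf]]) (auto simp: U'_def)
    then have "k_smooth_on k U' (\<lambda>X. (X + (- z)) \<bullet> \<nu> + (-1) * f X)"
      by (intro k_smooth_on_add k_smooth_on_mult k_smooth_on_inner k_smooth_on_const
              k_smooth_on_bounded_linear[OF _ bounded_linear_ident] oU')
    then show "k_smooth_on k U' (\<lambda>X. (X - z) \<bullet> \<nu> - f X)" by simp
  qed
  have "oriented_defining_function M n U' (\<lambda>X. (X - z) \<bullet> \<nu> - f X)"
  proof (rule oriented_defining_function_transfer[OF odf oU' _ smg level])
    show "U' \<subseteq> U" using U1 U0U by (auto simp: U'_def)
    fix q assume q: "q \<in> M \<inter> U'"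
    then have qS: "q \<in> S" and qU0: "q \<in> U0" and qMU: "q \<in> M \<inter> U" using U1 U0U by (auto simp: U'_def)
    have hq: "hat q = q" using q level by (auto simp: hat_def)
    have nz: "dd \<nu> \<rho> q > 0" using qU0 by (simp add: U0_def)
    have g: "norm (grad \<rho> q) > 0" using D(4)[OF qMU] by simp
    have "n q \<bullet> n q = 1" using oriented_defining_function_norm[OF odf qMU] by (simp add: norm_eq_1)
    then have "dd (n q) \<rho> q = norm (grad \<rho> q)"
      using inner_grad[OF diff, of q "n q"] qMU D(5)[OF qMU]
      by (metis IntD2 inner_scaleR_right mult.right_neutral)
    moreover have "dd (n q) (\<lambda>X. (X - z) \<bullet> \<nu> - f X) q = dd (n q) \<rho> q * inverse (dd \<nu> \<rho> q)"
      using fun_cong[OF frechet_derivative_at[OF D\<sigma>[OF qS]], of "n q"] by (simp add: R_def hq)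
    ultimately show "dd (n q) (\<lambda>X. (X - z) \<bullet> \<nu> - f X) q > 0" using g nz by simp
  qed
  moreover have "z \<in> S" using prz zV1 by (simp add: S_def)
  moreover have "f z = 0" using prz G\<Phi>[OF zU1] \<Phi>z by (simp add: f_def)
  ultimately show ?thesis
    using that[of S f U'] oS smf pr_line hatM unfolding \<nu>_def[symmetric]
    by (simp add: S_def f_def hat_def U'_def)
qed

section \<open>Two-jets of functions on the line\<close>

text \<open>The numbers \<open>a, b, c\<close> are the value and the first two derivatives of \<open>g\<close> at \<open>0\<close>.  As a relation with
  closure rules this computes second derivatives of compound expressions without ever writing down
  their first derivatives away from \<open>0\<close>.\<close>

definition has_jet2 :: "(real \<Rightarrow> real) \<Rightarrow> real \<Rightarrow> real \<Rightarrow> real \<Rightarrow> bool" where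
  "has_jet2 g a b c \<longleftrightarrow> g 0 = a \<and>
     (\<exists>g'. (\<forall>\<^sub>F t in nhds 0. (g has_real_derivative g' t) (at t)) \<and> g' 0 = b \<and>
        (g' has_real_derivative c) (at 0))"

lemma has_jet2I:
  assumes "\<forall>\<^sub>F t in nhds 0. (g has_real_derivative g' t) (at t)" "(g' has_real_derivative c) (at 0)"
    "g 0 = a" "g' 0 = b"
  shows "has_jet2 g a b c"
  using assms unfolding has_jet2_def by blast

lemma has_jet2E:
  assumes "has_jet2 g a b c"
  obtains g' where "\<forall>\<^sub>F t in nhds 0. (g has_real_derivative g' t) (at t)"
    "(g' has_real_derivative c) (at 0)" "g 0 = a" "g' 0 = b"
  using assms unfolding has_jet2_def by blast

lemma has_jet2_const: "has_jet2 (\<lambda>t. k) k 0 0"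
  by (rule has_jet2I[where g'="\<lambda>t. 0"]) auto

lemma has_jet2_affine: "has_jet2 (\<lambda>t. a + t * b) a b 0"
  by (rule has_jet2I[where g'="\<lambda>t. b"])
    (auto intro!: derivative_eq_intros always_eventually)

lemma has_jet2_add:
  assumes "has_jet2 f a b c" "has_jet2 g a' b' c'"
  shows "has_jet2 (\<lambda>t. f t + g t) (a + a') (b + b') (c + c')"
proof -
  obtain f' where f: "\<forall>\<^sub>F t in nhds 0. (f has_real_derivative f' t) (at t)"
    "(f' has_real_derivative c) (at 0)" "f 0 = a" "f' 0 = b" by (rule has_jet2E[OF assms(1)])
  obtain g' where g: "\<forall>\<^sub>F t in nhds 0. (g has_real_derivative g' t) (at t)"
    "(g' has_real_derivative c') (at 0)" "g 0 = a'" "g' 0 = b'" by (rule has_jet2E[OF assms(2)])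
  show ?thesis
  proof (rule has_jet2I[where g'="\<lambda>t. f' t + g' t"])
    show "\<forall>\<^sub>F t in nhds 0. ((\<lambda>t. f t + g t) has_real_derivative f' t + g' t) (at t)"
      using f(1) g(1) by eventually_elim (rule DERIV_add)
  qed (use f g in \<open>auto intro: DERIV_add\<close>)
qed

lemma has_jet2_mult:
  assumes "has_jet2 f a b c" "has_jet2 g a' b' c'"
  shows "has_jet2 (\<lambda>t. f t * g t) (a * a') (b * a' + a * b') (c * a' + 2 * b * b' + a * c')"
proof -
  obtain f' where f: "\<forall>\<^sub>F t in nhds 0. (f has_real_derivative f' t) (at t)"
    "(f' has_real_derivative c) (at 0)" "f 0 = a" "f' 0 = b" by (rule has_jet2E[OF assms(1)])
  obtain g' where g: "\<forall>\<^sub>F t in nhds 0. (g has_real_derivative g' t) (at t)"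
    "(g' has_real_derivative c') (at 0)" "g 0 = a'" "g' 0 = b'" by (rule has_jet2E[OF assms(2)])
  have f0: "(f has_real_derivative b) (at 0)" and g0: "(g has_real_derivative b') (at 0)"
    using eventually_nhds_x_imp_x[OF f(1)] eventually_nhds_x_imp_x[OF g(1)] f g by auto
  show ?thesis
  proof (rule has_jet2I[where g'="\<lambda>t. f' t * g t + f t * g' t"])
    show "\<forall>\<^sub>F t in nhds 0. ((\<lambda>t. f t * g t) has_real_derivative f' t * g t + f t * g' t) (at t)"
      using f(1) g(1) by eventually_elim (auto intro!: derivative_eq_intros)
    show "((\<lambda>t. f' t * g t + f t * g' t) has_real_derivative c * a' + 2 * b * b' + a * c') (at 0)"
      using f g by (auto intro!: derivative_eq_intros f(2) g(2) f0 g0)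
  qed (use f g in auto)
qed

lemma has_jet2_cmult:
  assumes "has_jet2 f a b c"
  shows "has_jet2 (\<lambda>t. k * f t) (k * a) (k * b) (k * c)"
  using has_jet2_mult[OF has_jet2_const[of k] assms] by simp

lemma has_jet2_sum:
  assumes "\<And>i. i \<in> I \<Longrightarrow> has_jet2 (f i) (a i) (b i) (c i)"
  shows "has_jet2 (\<lambda>t. \<Sum>i\<in>I. f i t) (\<Sum>i\<in>I. a i) (\<Sum>i\<in>I. b i) (\<Sum>i\<in>I. c i)"
  using assms
  by (induction I rule: infinite_finite_induct) (auto intro: has_jet2_const has_jet2_add)

lemma has_jet2_compose:
  assumes g: "has_jet2 g a b c"
    and \<phi>: "\<forall>\<^sub>F y in nhds a. (\<phi> has_real_derivative \<phi>' y) (at y)" "(\<phi>' has_real_derivative d) (at a)"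
  shows "has_jet2 (\<lambda>t. \<phi> (g t)) (\<phi> a) (\<phi>' a * b) (d * b\<^sup>2 + \<phi>' a * c)"
proof -
  obtain g' where g': "\<forall>\<^sub>F t in nhds 0. (g has_real_derivative g' t) (at t)"
    "(g' has_real_derivative c) (at 0)" "g 0 = a" "g' 0 = b" by (rule has_jet2E[OF g])
  have g0: "(g has_real_derivative b) (at 0)"
    using eventually_nhds_x_imp_x[OF g'(1)] g' by auto
  have "(g \<longlongrightarrow> a) (nhds 0)"
    using DERIV_isCont[OF g0] g'(3) by (simp add: isCont_def tendsto_nhds_iff)
  then have "\<forall>\<^sub>F t in nhds 0. (\<phi> has_real_derivative \<phi>' (g t)) (at (g t))"
    using \<phi>(1) by (rule eventually_compose_filterlim[rotated])
  then have 1: "\<forall>\<^sub>F t in nhds 0. ((\<lambda>t. \<phi> (g t)) has_real_derivative \<phi>' (g t) * g' t) (at t)"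
    using g'(1) by eventually_elim (rule DERIV_chain2)
  have 2: "((\<lambda>t. \<phi>' (g t)) has_real_derivative d * b) (at 0)"
    by (rule DERIV_chain2[OF _ g0]) (use \<phi>(2) g'(3) in simp)
  show ?thesis
    by (rule has_jet2I[OF 1])
      (use g' in \<open>auto intro!: derivative_eq_intros 2 g'(2) simp: power2_eq_square\<close>)
qed

text \<open>This is stated for the value \<open>1\<close> because every function that gets inverted later is
  normalised to \<open>1\<close> at the base point.\<close>

lemma has_jet2_inverse:
  assumes "has_jet2 g 1 b c"
  shows "has_jet2 (\<lambda>t. inverse (g t)) 1 (- b) (2 * b\<^sup>2 - c)"
proof -
  have "\<forall>\<^sub>F y in nhds (1::real). (inverse has_real_derivative - inverse (y ^ 2)) (at y)"
  proof -
    have "\<forall>\<^sub>F y in nhds (1::real). y \<in> {0<..}" by (rule eventually_nhds_in_open) auto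
    then show ?thesis
      by eventually_elim (rule DERIV_cong[OF DERIV_inverse], auto simp: power2_eq_square)
  qed
  moreover have "((\<lambda>y::real. - inverse (y ^ 2)) has_real_derivative 2) (at 1)"
    by (auto intro!: derivative_eq_intros)
  ultimately show ?thesis using has_jet2_compose[OF assms] by fastforce
qed

lemma has_jet2_sqrt:
  assumes "has_jet2 g 1 b c"
  shows "has_jet2 (\<lambda>t. sqrt (g t)) 1 (b / 2) (c / 2 - b\<^sup>2 / 4)"
proof -
  have "\<forall>\<^sub>F y in nhds (1::real). (sqrt has_real_derivative inverse (sqrt y) / 2) (at y)"
  proof -
    have "\<forall>\<^sub>F y in nhds (1::real). y \<in> {0<..}" by (rule eventually_nhds_in_open) auto
    then show ?thesis by eventually_elim (auto intro: DERIV_real_sqrt)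
  qed
  moreover have "((\<lambda>y::real. inverse (sqrt y) / 2) has_real_derivative - (1/4)) (at 1)"
    by (auto intro!: derivative_eq_intros)
  ultimately show ?thesis using has_jet2_compose[OF assms, of sqrt "\<lambda>y. inverse (sqrt y) / 2" "-(1/4)"]
    by (simp add: algebra_simps)
qed

lemma has_jet2_exp:
  assumes "has_jet2 g a b c"
  shows "has_jet2 (\<lambda>t. exp (g t)) (exp a) (exp a * b) (exp a * (b\<^sup>2 + c))"
  using has_jet2_compose[OF assms, of exp exp "exp a"]
  by (simp add: algebra_simps)

lemma has_jet2_along_line:
  fixes f :: "'a::euclidean_space \<Rightarrow> real"
  assumes "open S" "smooth_on S f" "x \<in> S"
  shows "has_jet2 (\<lambda>t. f (x + t *\<^sub>R v)) (f x) (dd v f x) (dd v (dd v f) x)"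
proof (rule has_jet2I[where g'="\<lambda>t. dd v f (x + t *\<^sub>R v)"])
  have "((\<lambda>t. x + t *\<^sub>R v) \<longlongrightarrow> x) (nhds 0)"
    by (auto intro!: tendsto_eq_intros simp: filterlim_ident)
  then have "\<forall>\<^sub>F t in nhds 0. x + t *\<^sub>R v \<in> S"
    using assms(1,3) by (rule topological_tendstoD)
  then show "\<forall>\<^sub>F t in nhds 0. ((\<lambda>t. f (x + t *\<^sub>R v)) has_real_derivative dd v f (x + t *\<^sub>R v)) (at t)"
    by eventually_elim (intro has_real_derivative_along_line smooth_on_differentiable[OF assms(2)])
  show "((\<lambda>t. dd v f (x + t *\<^sub>R v)) has_real_derivative dd v (dd v f) x) (at 0)"
    using has_real_derivative_along_line[of "dd v f" x 0 v]
      smooth_on_differentiable[OF smooth_on_dd[OF assms(2)] assms(3)] by simp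
qed auto

lemma has_jet2_unique:
  assumes f: "has_jet2 f a b c" and g: "has_jet2 g a' b' c'" and e: "\<forall>\<^sub>F t in nhds 0. f t = g t"
  shows "a = a'" "b = b'" "c = c'"
proof -
  obtain f' where f: "\<forall>\<^sub>F t in nhds 0. (f has_real_derivative f' t) (at t)"
    "(f' has_real_derivative c) (at 0)" "f 0 = a" "f' 0 = b" by (rule has_jet2E[OF f])
  obtain g' where g: "\<forall>\<^sub>F t in nhds 0. (g has_real_derivative g' t) (at t)"
    "(g' has_real_derivative c') (at 0)" "g 0 = a'" "g' 0 = b'" by (rule has_jet2E[OF g])
  have "\<forall>\<^sub>F t in nhds 0. \<forall>\<^sub>F s in nhds t. f s = g s" using e by (simp add: eventually_eventually)
  then have e': "\<forall>\<^sub>F t in nhds 0. f' t = g' t"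
    using f(1) g(1)
  proof eventually_elim
    case (elim t)
    then show ?case using DERIV_cong_ev[OF refl elim(1) refl] DERIV_unique by blast
  qed
  show "a = a'" using eventually_nhds_x_imp_x[OF e] f g by simp
  show "b = b'" using eventually_nhds_x_imp_x[OF e'] f g by simp
  show "c = c'" using DERIV_cong_ev[OF refl e' refl] f(2) g(2) DERIV_unique by blast
qed

lemma has_jet2_local_min:
  assumes g: "has_jet2 g a b c" and min: "\<forall>\<^sub>F t in nhds 0. a \<le> g t"
  shows "b = 0" "0 \<le> c"
proof -
  obtain g' where g': "\<forall>\<^sub>F t in nhds 0. (g has_real_derivative g' t) (at t)"
    "(g' has_real_derivative c) (at 0)" "g 0 = a" "g' 0 = b" by (rule has_jet2E[OF g])
  have g0: "(g has_real_derivative b) (at 0)"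
    using eventually_nhds_x_imp_x[OF g'(1)] g' by auto
  obtain d where d: "d > 0" "\<And>t. dist t 0 < d \<Longrightarrow> (g has_real_derivative g' t) (at t) \<and> a \<le> g t"
    using eventually_conj[OF g'(1) min] unfolding eventually_nhds_metric by blast
  show b: "b = 0"
    by (rule DERIV_local_min[OF g0 d(1)]) (use d(2) g'(3) in \<open>auto simp: dist_real_def\<close>)
  show "0 \<le> c"
  proof (rule ccontr)
    assume "\<not> 0 \<le> c"
    then obtain d' where d': "d' > 0" "\<And>h. 0 < h \<Longrightarrow> h < d' \<Longrightarrow> g' h < 0"
      using DERIV_neg_dec_right[OF g'(2)] g'(4) b by auto
    define s where "s = min d d' / 2"
    have s: "0 < s" "s < d" "s < d'" using d(1) d'(1) by (auto simp: s_def min_def field_simps)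
    obtain t where t: "0 < t" "t < s" "g s - g 0 = (s - 0) * g' t"
      using MVT2[of 0 s g g'] s d(2) by (auto simp: dist_real_def)
    have "s * g' t < 0" using s t d'(2)[of t] by (intro mult_pos_neg) auto
    then have "g s < a" using t g'(3) by simp
    then show False using d(2)[of s] s by (auto simp: dist_real_def)
  qed
qed

section \<open>The equation of a \<open>\<lambda>\<close>-hypersurface as a graph\<close>

lemma has_jet2_eq:
  "has_jet2 g a b c \<Longrightarrow> a = a' \<Longrightarrow> b = b' \<Longrightarrow> c = c' \<Longrightarrow> has_jet2 g a' b' c'"
  by simp

text \<open>Invariance under translation along \<open>\<nu>\<close> passes to directional derivatives, hence to derivatives of
  any order.\<close>

lemma dd_const_along:
  fixes h :: "'a::euclidean_space \<Rightarrow> real"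
  assumes "open S" "smooth_on S h" "X \<in> S" "\<And>X t. X \<in> S \<Longrightarrow> X + t *\<^sub>R \<nu> \<in> S \<and> h (X + t *\<^sub>R \<nu>) = h X"
  shows "dd \<nu> h X = 0" "dd v h (X + t *\<^sub>R \<nu>) = dd v h X"
proof -
  have d: "h differentiable (at Y)" if "Y \<in> S" for Y by (rule smooth_on_differentiable[OF assms(2) that])
  have D: "((\<lambda>t. h (X + t *\<^sub>R \<nu>)) has_real_derivative dd \<nu> h (X + 0 *\<^sub>R \<nu>)) (at 0)"
    by (rule has_real_derivative_along_line) (use d assms(3) in simp)
  moreover have "(\<lambda>t. h (X + t *\<^sub>R \<nu>)) = (\<lambda>t. h X)" using assms(3,4) by simp
  ultimately have D0: "((\<lambda>t::real. h X) has_real_derivative dd \<nu> h X) (at 0)" by simp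
  show "dd \<nu> h X = 0" using DERIV_unique[OF D0 DERIV_const] .
  have Xt: "X + t *\<^sub>R \<nu> \<in> S" using assms(3,4) by blast
  have 1: "((\<lambda>Y. Y + t *\<^sub>R \<nu>) has_derivative (\<lambda>v. v)) (at X)"
    by (auto intro!: derivative_eq_intros)
  have "(h has_derivative frechet_derivative h (at (X + t *\<^sub>R \<nu>))) (at (X + t *\<^sub>R \<nu>))"
    using d[OF Xt] frechet_derivative_works by blast
  from diff_chain_at[OF 1 this]
  have "((\<lambda>Y. h (Y + t *\<^sub>R \<nu>)) has_derivative (\<lambda>v. dd v h (X + t *\<^sub>R \<nu>))) (at X)"
    by (simp add: o_def)
  then have "(h has_derivative (\<lambda>v. dd v h (X + t *\<^sub>R \<nu>))) (at X)"
    by (rule has_derivative_transform_within_open[OF _ assms(1,3)]) (use assms(4) in blast)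
  from fun_cong[OF frechet_derivative_at[OF this], of v] show "dd v h (X + t *\<^sub>R \<nu>) = dd v h X" .
qed

text \<open>The function \<open>f\<close> represents a hypersurface near \<open>z\<close> as a graph over its tangent plane
  \<open>{X. (X - z) \<bullet> \<nu> = 0}\<close>, so that \<open>f\<close> and its gradient vanish at \<open>z\<close>.  It is constant along \<open>\<nu>\<close>.\<close>

locale lambda_graph =
  fixes S :: "'a::euclidean_space set" and f :: "'a \<Rightarrow> real" and z \<nu> :: 'a and l :: real
  assumes open_S: "open S" and z_S: "z \<in> S" and smooth: "smooth_on S f"
    and f_z: "f z = 0" and norm_\<nu>: "norm \<nu> = 1"
    and vertical: "\<And>X t. X \<in> S \<Longrightarrow> X + t *\<^sub>R \<nu> \<in> S \<and> f (X + t *\<^sub>R \<nu>) = f X"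
    and crit: "\<And>v. dd v f z = 0"
begin

text \<open>The vector \<open>\<nu> - grad f X\<close> is normal to the graph; \<open>slope X\<close> is its length, and \<open>height X\<close> is its inner
  product with the position vector of the point over \<open>X\<close>.\<close>

definition slope :: "'a \<Rightarrow> real" where
  "slope X = sqrt (1 + (\<Sum>b\<in>Basis. dd b f X * dd b f X))"

definition height :: "'a \<Rightarrow> real" where
  "height X = z \<bullet> \<nu> + f X + (-1) * (\<Sum>b\<in>Basis. (X \<bullet> b) * dd b f X)"

text \<open>\<open>lift X\<close> is the point of the graph on the line through \<open>X\<close> in direction \<open>\<nu>\<close>.\<close>

definition lift :: "'a \<Rightarrow> 'a" where
  "lift X = X + (f X - (X - z) \<bullet> \<nu>) *\<^sub>R \<nu>"

abbreviation hess :: "'a \<Rightarrow> 'a \<Rightarrow> real" where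
  "hess v w \<equiv> dd v (dd w f) z"

lemma smooth_dd: "smooth_on S (dd v f)"
  by (rule smooth_on_dd[OF smooth])

lemma smooth_dd2: "smooth_on S (dd v (dd w f))"
  by (intro smooth_on_dd smooth)

lemma smooth_dd3: "smooth_on S (dd u (dd v (dd w f)))"
  by (intro smooth_on_dd smooth)

lemma hess_commute: "hess v w = hess w v"
  by (rule dd_dd_commute[OF open_S smooth z_S])

lemma hess_expand: "(\<Sum>b\<in>Basis. (w \<bullet> b) * hess v b) = hess v w"
  using dd_dd_expand[OF open_S smooth z_S, where v=v and w=w] by simp

lemma dd_cong_S: "(\<And>y. y \<in> S \<Longrightarrow> g y = h y) \<Longrightarrow> smooth_on S g \<Longrightarrow> X \<in> S \<Longrightarrow> dd v g X = dd v h X"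
  using dd_cong[OF open_S] smooth_on_differentiable by blast

lemma dd3_commute:
  assumes "X \<in> S"
  shows "dd u (dd v (dd w f)) X = dd w (dd u (dd v f)) X"
proof -
  have "dd u (dd v (dd w f)) X = dd u (dd w (dd v f)) X"
    by (rule dd_cong_S[OF _ smooth_dd2 assms]) (rule dd_dd_commute[OF open_S smooth])
  also have "\<dots> = dd w (dd u (dd v f)) X"
    by (rule dd_dd_commute[OF open_S smooth_dd assms])
  finally show ?thesis .
qed

lemma dd4_commute: "dd e (dd e (dd b (dd b f))) z = dd b (dd b (dd e (dd e f))) z"
proof -
  have "dd e (dd e (dd b (dd b f))) z = dd e (dd b (dd e (dd b f))) z"
    by (rule dd_cong_S[OF _ smooth_dd3 z_S]) (rule dd_dd_commute[OF open_S smooth_dd])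
  also have "\<dots> = dd b (dd e (dd e (dd b f))) z"
    by (rule dd_dd_commute[OF open_S smooth_dd2 z_S])
  also have "\<dots> = dd b (dd b (dd e (dd e f))) z"
    by (rule dd_cong_S[OF _ smooth_dd3 z_S]) (rule dd3_commute)
  finally show ?thesis .
qed

lemma jet_dd: "has_jet2 (\<lambda>t. dd b f (z + t *\<^sub>R v)) 0 (hess v b) (dd v (dd v (dd b f)) z)"
  using has_jet2_along_line[OF open_S smooth_dd[of b] z_S, where v=v] crit by simp

lemma jet_dd2: "has_jet2 (\<lambda>t. dd b (dd c f) (z + t *\<^sub>R v)) (hess b c) (dd v (dd b (dd c f)) z)
    (dd v (dd v (dd b (dd c f))) z)"
  by (rule has_jet2_along_line[OF open_S smooth_dd2 z_S])

lemma jet_slope: "has_jet2 (\<lambda>t. slope (z + t *\<^sub>R v)) 1 0 (\<Sum>c\<in>Basis. (hess v c)\<^sup>2)"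
proof -
  have "has_jet2 (\<lambda>t. \<Sum>b\<in>Basis. dd b f (z + t *\<^sub>R v) * dd b f (z + t *\<^sub>R v)) 0 0 (\<Sum>b\<in>Basis. 2 * (hess v b)\<^sup>2)"
    by (rule has_jet2_eq[OF has_jet2_sum[OF has_jet2_mult[OF jet_dd jet_dd]]])
      (auto simp: power2_eq_square mult.assoc)
  from has_jet2_sqrt[OF has_jet2_eq[OF has_jet2_add[OF has_jet2_const[of 1] this] _ refl refl]]
  have "has_jet2 (\<lambda>t. slope (z + t *\<^sub>R v)) 1 ((0 + 0) / 2)
      ((0 + (\<Sum>b\<in>Basis. 2 * (hess v b)\<^sup>2)) / 2 - (0 + 0)\<^sup>2 / 4)"
    unfolding slope_def by simp
  then show ?thesis
    by (rule has_jet2_eq) (auto simp: sum_distrib_left[symmetric])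
qed

lemma jet_inverse_slope:
  "has_jet2 (\<lambda>t. inverse (slope (z + t *\<^sub>R v))) 1 0 (- (\<Sum>c\<in>Basis. (hess v c)\<^sup>2))"
  by (rule has_jet2_eq[OF has_jet2_inverse[OF jet_slope]]) auto

lemma jet_height:
  "has_jet2 (\<lambda>t. height (z + t *\<^sub>R v)) (z \<bullet> \<nu>) (- hess v z)
     (- hess v v - (\<Sum>c\<in>Basis. (z \<bullet> c) * dd v (dd v (dd c f)) z))"
proof -
  have 1: "has_jet2 (\<lambda>t. (z + t *\<^sub>R v) \<bullet> c) (z \<bullet> c) (v \<bullet> c) 0" for c
    using has_jet2_affine[of "z \<bullet> c" "v \<bullet> c"] by (simp add: inner_add_left)
  have 2: "has_jet2 (\<lambda>t. f (z + t *\<^sub>R v)) 0 0 (hess v v)"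
    using has_jet2_along_line[OF open_S smooth z_S, where v=v] f_z crit by simp
  have 3: "has_jet2 (\<lambda>t. \<Sum>b\<in>Basis. ((z + t *\<^sub>R v) \<bullet> b) * dd b f (z + t *\<^sub>R v))
      0 (hess v z) (2 * hess v v + (\<Sum>c\<in>Basis. (z \<bullet> c) * dd v (dd v (dd c f)) z))"
    by (rule has_jet2_eq[OF has_jet2_sum[OF has_jet2_mult[OF 1 jet_dd]]])
      (auto simp: hess_expand sum.distrib mult.assoc sum_distrib_left[symmetric])
  show ?thesis
    unfolding height_def
    by (rule has_jet2_eq[OF has_jet2_add[OF has_jet2_add[OF has_jet2_const 2] has_jet2_cmult[OF 3]]]) auto
qed

lemma jet_cubic:
  "has_jet2 (\<lambda>t. \<Sum>b\<in>Basis. \<Sum>c\<in>Basis. dd b f (z + t *\<^sub>R v) * dd c f (z + t *\<^sub>R v) * dd b (dd c f) (z + t *\<^sub>R v))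
     0 0 (2 * (\<Sum>b\<in>Basis. \<Sum>c\<in>Basis. hess v b * hess v c * hess b c))"
  by (rule has_jet2_eq[OF has_jet2_sum[OF has_jet2_sum[OF has_jet2_mult[OF has_jet2_mult[OF jet_dd jet_dd] jet_dd2]]]])
    (auto simp: sum_distrib_left mult.assoc intro!: sum.cong)

text \<open>This is the equation \<open>H - \<langle>x, n\<rangle>/2 = l\<close> for the graph, multiplied by \<open>- slope\<close>.\<close>

definition graph_equation :: bool where
  "graph_equation \<longleftrightarrow> (\<forall>X\<in>S.
     (\<Sum>b\<in>Basis. dd b (dd b f) X)
     + (-1) * ((\<Sum>b\<in>Basis. \<Sum>c\<in>Basis. dd b f X * dd c f X * dd b (dd c f) X)
              * (inverse (slope X) * inverse (slope X)))
     + (1/2) * height X + l * slope X = 0)"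

text \<open>The equation holds on all of \<open>S\<close>, so its 2-jet along every line through \<open>z\<close> vanishes.  The cubic
  term contains two factors that vanish at \<open>z\<close> and contributes only to the second derivative.\<close>

lemma graph_equation_derivatives:
  assumes graph_equation
  shows "(\<Sum>b\<in>Basis. hess b b) = - (z \<bullet> \<nu>) / 2 - l"
    and "(\<Sum>b\<in>Basis. dd v (dd b (dd b f)) z) = hess v z / 2"
    and "(\<Sum>b\<in>Basis. dd v (dd v (dd b (dd b f))) z) =
        2 * (\<Sum>b\<in>Basis. \<Sum>c\<in>Basis. hess v b * hess v c * hess b c)
        + hess v v / 2 + (\<Sum>c\<in>Basis. (z \<bullet> c) * dd v (dd v (dd c f)) z) / 2
        - l * (\<Sum>c\<in>Basis. (hess v c)\<^sup>2)"
proof -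
  let ?E = "\<lambda>X. (\<Sum>b\<in>Basis. dd b (dd b f) X)
     + (-1) * ((\<Sum>b\<in>Basis. \<Sum>c\<in>Basis. dd b f X * dd c f X * dd b (dd c f) X)
              * (inverse (slope X) * inverse (slope X)))
     + (1/2) * height X + l * slope X"
  note J = has_jet2_add[OF has_jet2_add[OF has_jet2_add[OF has_jet2_sum[OF jet_dd2]
      has_jet2_cmult[OF has_jet2_mult[OF jet_cubic has_jet2_mult[OF jet_inverse_slope jet_inverse_slope]]]]
      has_jet2_cmult[OF jet_height]] has_jet2_cmult[OF jet_slope]]
  have "((\<lambda>t. z + t *\<^sub>R v) \<longlongrightarrow> z) (nhds 0)"
    by (auto intro!: tendsto_eq_intros simp: filterlim_ident)
  then have "\<forall>\<^sub>F t in nhds 0. z + t *\<^sub>R v \<in> S"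
    using open_S z_S by (rule topological_tendstoD)
  then have ev: "\<forall>\<^sub>F t in nhds 0. ?E (z + t *\<^sub>R v) = 0"
    by eventually_elim (use assms in \<open>simp only: graph_equation_def\<close>)
  note U = has_jet2_unique[OF J has_jet2_const ev]
  show "(\<Sum>b\<in>Basis. hess b b) = - (z \<bullet> \<nu>) / 2 - l" using U(1) by simp
  show "(\<Sum>b\<in>Basis. dd v (dd b (dd b f)) z) = hess v z / 2" using U(2) by simp
  show "(\<Sum>b\<in>Basis. dd v (dd v (dd b (dd b f))) z) =
        2 * (\<Sum>b\<in>Basis. \<Sum>c\<in>Basis. hess v b * hess v c * hess b c)
        + hess v v / 2 + (\<Sum>c\<in>Basis. (z \<bullet> c) * dd v (dd v (dd c f)) z) / 2
        - l * (\<Sum>c\<in>Basis. (hess v c)\<^sup>2)" using U(3) by (simp add: algebra_simps)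
qed

definition half_support :: "'a \<Rightarrow> real" where
  "half_support X = (1/2) * (height X * inverse (slope X))"

text \<open>A direction \<open>e\<close> in the tangent plane at \<open>z\<close> lifts to a tangent direction of the graph over \<open>X\<close>;
  \<open>lifted_curvature e X\<close> is the normal curvature of the graph in that direction.  For \<open>e\<close> a direction of
  smallest curvature at \<open>z\<close> it is a smooth upper barrier of the smallest principal curvature.\<close>

definition lifted_curvature :: "'a \<Rightarrow> 'a \<Rightarrow> real" where
  "lifted_curvature e X = (-1) * (dd e (dd e f) X * inverse (slope X) * inverse (1 + dd e f X * dd e f X))"

definition gaussian :: "real \<Rightarrow> 'a \<Rightarrow> 'a \<Rightarrow> real" where
  "gaussian \<alpha> y X = exp (- \<alpha> * (norm (X - y))\<^sup>2)"

lemma jet_half_support: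
  "has_jet2 (\<lambda>t. half_support (z + t *\<^sub>R v)) (z \<bullet> \<nu> / 2) (- hess v z / 2)
     ((- hess v v - (\<Sum>c\<in>Basis. (z \<bullet> c) * dd v (dd v (dd c f)) z)
        - (z \<bullet> \<nu>) * (\<Sum>c\<in>Basis. (hess v c)\<^sup>2)) / 2)"
  unfolding half_support_def
  by (rule has_jet2_eq[OF has_jet2_cmult[OF has_jet2_mult[OF jet_height jet_inverse_slope]]])
    (auto simp: algebra_simps)

lemma jet_lifted_curvature:
  "has_jet2 (\<lambda>t. lifted_curvature e (z + t *\<^sub>R v)) (- hess e e) (- dd v (dd e (dd e f)) z)
     (- dd v (dd v (dd e (dd e f))) z
        + hess e e * (\<Sum>c\<in>Basis. (hess v c)\<^sup>2) + 2 * hess e e * (hess v e)\<^sup>2)"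
proof -
  have "has_jet2 (\<lambda>t. inverse (1 + dd e f (z + t *\<^sub>R v) * dd e f (z + t *\<^sub>R v))) 1 0 (- 2 * (hess v e)\<^sup>2)"
    by (rule has_jet2_eq[OF has_jet2_inverse[OF has_jet2_eq[OF
            has_jet2_add[OF has_jet2_const[of 1] has_jet2_mult[OF jet_dd jet_dd]] _ refl refl]]])
      (auto simp: power2_eq_square)
  note J = has_jet2_cmult[OF has_jet2_mult[OF has_jet2_mult[OF jet_dd2 jet_inverse_slope] this]]
  show ?thesis
    unfolding lifted_curvature_def by (rule has_jet2_eq[OF J]) (auto simp: algebra_simps)
qed

lemma \<nu>_\<nu>: "\<nu> \<bullet> \<nu> = 1" using norm_\<nu> by (simp add: norm_eq_1)

text \<open>Along \<open>z + t v\<close> the squared distance of the lifted point to \<open>y\<close> is a polynomial in \<open>t\<close> and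
  \<open>f (z + t v)\<close>.  Its first derivative at \<open>0\<close> sees only the tangential part of \<open>d\<close>, and the second
  derivative of \<open>f\<close> enters through the normal part.\<close>

lemma jet_gaussian:
  fixes y defines "d \<equiv> z - y"
  defines "s1 \<equiv> \<lambda>v. 2 * (d \<bullet> v - (d \<bullet> \<nu>) * (v \<bullet> \<nu>))"
  shows "has_jet2 (\<lambda>t. gaussian \<alpha> y (lift (z + t *\<^sub>R v))) (gaussian \<alpha> y z)
     (gaussian \<alpha> y z * (- \<alpha> * s1 v))
     (gaussian \<alpha> y z * (\<alpha>\<^sup>2 * (s1 v)\<^sup>2 - \<alpha> * (2 * (v \<bullet> v) - 2 * (v \<bullet> \<nu>)\<^sup>2 + 2 * hess v v * (d \<bullet> \<nu>))))"
proof -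
  have 2: "has_jet2 (\<lambda>t. f (z + t *\<^sub>R v)) 0 0 (hess v v)"
    using has_jet2_along_line[OF open_S smooth z_S, where v=v] f_z crit by simp
  have 3: "has_jet2 (\<lambda>t. f (z + t *\<^sub>R v) + (-1) * (0 + t * (v \<bullet> \<nu>))) 0 (- (v \<bullet> \<nu>)) (hess v v)"
    by (rule has_jet2_eq[OF has_jet2_add[OF 2 has_jet2_cmult[OF has_jet2_affine]]]) auto
  have 4: "has_jet2 (\<lambda>t. (d \<bullet> d + t * (2 * (d \<bullet> v))) + (0 + t * (v \<bullet> v)) * (0 + t * 1)) (d \<bullet> d) (2 * (d \<bullet> v)) (2 * (v \<bullet> v))"
    by (rule has_jet2_eq[OF has_jet2_add[OF has_jet2_affine has_jet2_mult[OF has_jet2_affine has_jet2_affine]]]) auto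
  have 5: "has_jet2 (\<lambda>t. (d \<bullet> d + t * (2 * (d \<bullet> v))) + (0 + t * (v \<bullet> v)) * (0 + t * 1)
      + 2 * ((f (z + t *\<^sub>R v) + (-1) * (0 + t * (v \<bullet> \<nu>))) * (d \<bullet> \<nu> + t * (v \<bullet> \<nu>)))
      + (f (z + t *\<^sub>R v) + (-1) * (0 + t * (v \<bullet> \<nu>))) * (f (z + t *\<^sub>R v) + (-1) * (0 + t * (v \<bullet> \<nu>))))
      (d \<bullet> d) (s1 v) (2 * (v \<bullet> v) - 2 * (v \<bullet> \<nu>)\<^sup>2 + 2 * hess v v * (d \<bullet> \<nu>))"
    by (rule has_jet2_eq[OF has_jet2_add[OF has_jet2_add[OF 4 has_jet2_cmult[OF has_jet2_mult[OF 3 has_jet2_affine]]]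
            has_jet2_mult[OF 3 3]]])
      (auto simp: s1_def power2_eq_square algebra_simps)
  have gen: "(d + t *\<^sub>R v + a *\<^sub>R \<nu>) \<bullet> (d + t *\<^sub>R v + a *\<^sub>R \<nu>) =
      (d \<bullet> d + t * (2 * (d \<bullet> v))) + (0 + t * (v \<bullet> v)) * (0 + t * 1)
      + 2 * (a * (d \<bullet> \<nu> + t * (v \<bullet> \<nu>))) + a * a" for a t :: real
  proof -
    have "(d + t *\<^sub>R v + a *\<^sub>R \<nu>) \<bullet> (d + t *\<^sub>R v + a *\<^sub>R \<nu>) =
        d \<bullet> d + t * (d \<bullet> v) + a * (d \<bullet> \<nu>) + (t * (d \<bullet> v) + t * t * (v \<bullet> v) + t * a * (v \<bullet> \<nu>))
        + (a * (d \<bullet> \<nu>) + a * t * (v \<bullet> \<nu>) + a * a * (\<nu> \<bullet> \<nu>))"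
      unfolding inner_add_left inner_add_right inner_scaleR_left inner_scaleR_right
        inner_commute[of v d] inner_commute[of \<nu> d] inner_commute[of \<nu> v]
      by (simp only: mult.assoc distrib_left add_ac mult.left_commute)
    then show ?thesis unfolding \<nu>_\<nu> by (simp add: algebra_simps)
  qed
  have "(norm (lift (z + t *\<^sub>R v) - y))\<^sup>2 =
      (d \<bullet> d + t * (2 * (d \<bullet> v))) + (0 + t * (v \<bullet> v)) * (0 + t * 1)
      + 2 * ((f (z + t *\<^sub>R v) + (-1) * (0 + t * (v \<bullet> \<nu>))) * (d \<bullet> \<nu> + t * (v \<bullet> \<nu>)))
      + (f (z + t *\<^sub>R v) + (-1) * (0 + t * (v \<bullet> \<nu>))) * (f (z + t *\<^sub>R v) + (-1) * (0 + t * (v \<bullet> \<nu>)))" for t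
  proof -
    have e: "lift (z + t *\<^sub>R v) - y = d + t *\<^sub>R v + (f (z + t *\<^sub>R v) + (-1) * (0 + t * (v \<bullet> \<nu>))) *\<^sub>R \<nu>"
      by (simp add: lift_def d_def)
    show ?thesis
      unfolding e power2_norm_eq_inner by (rule gen)
  qed
  with 5 have "has_jet2 (\<lambda>t. (norm (lift (z + t *\<^sub>R v) - y))\<^sup>2)
      (d \<bullet> d) (s1 v) (2 * (v \<bullet> v) - 2 * (v \<bullet> \<nu>)\<^sup>2 + 2 * hess v v * (d \<bullet> \<nu>))"
    by (simp only:)
  note J = has_jet2_exp[OF has_jet2_cmult[OF this, of "- \<alpha>"]]
  have g: "gaussian \<alpha> y z = exp (- \<alpha> * (d \<bullet> d))"
    by (simp add: gaussian_def d_def power2_norm_eq_inner)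
  have e: "(\<lambda>t. gaussian \<alpha> y (lift (z + t *\<^sub>R v))) = (\<lambda>t. exp (- \<alpha> * (norm (lift (z + t *\<^sub>R v) - y))\<^sup>2))"
    by (simp add: gaussian_def)
  show ?thesis unfolding e g
    by (rule has_jet2_eq[OF J]) (simp_all add: algebra_simps power2_eq_square)
qed

section \<open>Comparison with a Gaussian at a point of the graph\<close>

lemma sum_z_dd3: "(\<Sum>c\<in>Basis. (z \<bullet> c) * dd u (dd v (dd c f)) z) = dd z (dd u (dd v f)) z"
proof -
  have "(\<Sum>c\<in>Basis. (z \<bullet> c) * dd u (dd v (dd c f)) z) = (\<Sum>c\<in>Basis. (z \<bullet> c) * dd c (dd u (dd v f)) z)"
    by (simp only: dd3_commute[OF z_S, symmetric])
  also have "\<dots> = dd z (dd u (dd v f)) z"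
    using frechet_derivative_expand[OF smooth_on_differentiable[OF smooth_dd2[of v u] z_S], of z] by simp
  finally show ?thesis .
qed

lemma sum_inner_Basis_squared: "(\<Sum>b\<in>Basis. (w \<bullet> b)\<^sup>2) = w \<bullet> (w::'a)"
  by (simp add: euclidean_inner[of w w] power2_eq_square)

text \<open>At a local minimum all first derivatives vanish and all second derivatives are nonnegative.  Hence
  the operator \<open>L w = \<Delta> w - \<langle>z, \<nabla> w\<rangle>/2\<close> is nonnegative there.  Evaluated with the derivatives of the
  graph equation, it takes the value

    \<open>G/2 - |A|\<^sup>2 G + l (\<sigma> k\<^sup>2 + c/2) - \<epsilon> L \<beta>\<close>

  where \<open>G = \<sigma> k + c \<langle>z, \<nu>\<rangle>/2\<close>, \<open>k = - hess e e\<close> is a principal curvature by \<open>eigen\<close> unless \<open>\<sigma> = 0\<close>, and \<open>\<beta>\<close> is the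
  Gaussian.  The third derivatives of \<open>f\<close> cancel between the second-order and the first-order part
  of \<open>L\<close>.  The second and third terms have a sign because \<open>G \<ge> 0\<close> and \<open>l \<le> 0\<close>, so \<open>\<epsilon> L \<beta> \<le> G/2\<close>, which
  is the claim.\<close>

lemma touching_inequality:
  fixes y e :: 'a and \<sigma> c \<epsilon> \<alpha> :: real
  defines "d \<equiv> z - y"
  assumes graph_equation: graph_equation and l: "l \<le> 0" and \<sigma>: "\<sigma> \<ge> 0" and c: "c \<ge> 0" and e1: "norm e = 1"
    and eigen: "\<sigma> \<noteq> 0 \<Longrightarrow> \<forall>v. hess e v = hess e e * (e \<bullet> v)"
    and min: "\<forall>\<^sub>F X in nhds z.
        \<sigma> * lifted_curvature e z + c * half_support z - \<epsilon> * gaussian \<alpha> y (lift z)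
        \<le> \<sigma> * lifted_curvature e X + c * half_support X - \<epsilon> * gaussian \<alpha> y (lift X)"
    and nonneg: "0 \<le> \<sigma> * (- hess e e) + c * (z \<bullet> \<nu> / 2)"
  shows "\<epsilon> * gaussian \<alpha> y z * (4 * \<alpha>\<^sup>2 * (d \<bullet> d - (d \<bullet> \<nu>)\<^sup>2)
           - \<alpha> * (2 * real DIM('a) - 2 - (z \<bullet> \<nu> + 2 * l) * (d \<bullet> \<nu>) - (z \<bullet> d - (z \<bullet> \<nu>) * (d \<bullet> \<nu>))))
         \<le> (\<sigma> * (- hess e e) + c * (z \<bullet> \<nu> / 2)) / 2"
proof -
  define \<Gamma> where "\<Gamma> X = \<sigma> * lifted_curvature e X + (c * half_support X + (- \<epsilon>) * gaussian \<alpha> y (lift X))" for X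
  define g where "g = gaussian \<alpha> y z"
  define s1 where "s1 v = 2 * (d \<bullet> v - (d \<bullet> \<nu>) * (v \<bullet> \<nu>))" for v
  define b1 where "b1 v = \<sigma> * (- dd v (dd e (dd e f)) z) + (c * (- hess v z / 2)
      + (- \<epsilon>) * (g * (- \<alpha> * s1 v)))" for v
  define b2 where "b2 v = \<sigma> * (- dd v (dd v (dd e (dd e f))) z
        + hess e e * (\<Sum>c\<in>Basis. (hess v c)\<^sup>2) + 2 * hess e e * (hess v e)\<^sup>2)
      + (c * ((- hess v v - (\<Sum>c\<in>Basis. (z \<bullet> c) * dd v (dd v (dd c f)) z)
        - (z \<bullet> \<nu>) * (\<Sum>c\<in>Basis. (hess v c)\<^sup>2)) / 2)
      + (- \<epsilon>) * (g * (\<alpha>\<^sup>2 * (s1 v)\<^sup>2 - \<alpha> * (2 * (v \<bullet> v) - 2 * (v \<bullet> \<nu>)\<^sup>2 + 2 * hess v v * (d \<bullet> \<nu>)))))" for v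
  have jet: "has_jet2 (\<lambda>t. \<Gamma> (z + t *\<^sub>R v))
      (\<sigma> * (- hess e e) + (c * (z \<bullet> \<nu> / 2) + (- \<epsilon>) * g)) (b1 v) (b2 v)" for v
    unfolding \<Gamma>_def b1_def b2_def g_def s1_def d_def
    by (intro has_jet2_add has_jet2_cmult jet_lifted_curvature jet_half_support jet_gaussian)
  have ge: "\<forall>\<^sub>F t in nhds 0. \<sigma> * (- hess e e) + (c * (z \<bullet> \<nu> / 2) + (- \<epsilon>) * g) \<le> \<Gamma> (z + t *\<^sub>R v)" for v
  proof -
    have "\<Gamma> z = \<sigma> * (- hess e e) + (c * (z \<bullet> \<nu> / 2) + (- \<epsilon>) * g)"
      using jet[of v] by (simp add: has_jet2_def)
    moreover have "\<forall>\<^sub>F X in nhds z. \<Gamma> z \<le> \<Gamma> X" using min by (simp add: \<Gamma>_def add_diff_eq)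
    moreover have "((\<lambda>t. z + t *\<^sub>R v) \<longlongrightarrow> z) (nhds 0)"
      by (auto intro!: tendsto_eq_intros simp: filterlim_ident)
    ultimately show ?thesis using eventually_compose_filterlim by fastforce
  qed
  have b1z: "b1 z = 0" by (rule has_jet2_local_min(1)[OF jet ge])
  have b2b: "0 \<le> (\<Sum>b\<in>Basis. b2 b)" by (intro sum_nonneg has_jet2_local_min(2)[OF jet ge])
  define F where "F = hess e e"
  define A where "A = (\<Sum>b\<in>Basis. \<Sum>c\<in>Basis. (hess b c)\<^sup>2)"
  define \<Delta> where "\<Delta> = (\<Sum>b\<in>Basis. hess b b)"
  define Z where "Z = dd z (dd e (dd e f)) z"
  define Q where "Q = (\<Sum>c\<in>Basis. (hess e c)\<^sup>2)"
  define T where "T = (\<Sum>b\<in>Basis. \<Sum>c\<in>Basis. hess e b * hess e c * hess b c)"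
  have A0: "A \<ge> 0" unfolding A_def by (intro sum_nonneg) auto
  have \<Delta>: "\<Delta> = - (z \<bullet> \<nu>) / 2 - l" unfolding \<Delta>_def by (rule graph_equation_derivatives(1)[OF graph_equation])
  have s4: "(\<Sum>b\<in>Basis. dd b (dd b (dd e (dd e f))) z) = 2 * T + F / 2 + Z / 2 - l * Q"
    unfolding dd4_commute[symmetric, of e] graph_equation_derivatives(3)[OF graph_equation] sum_z_dd3
    by (simp add: T_def F_def Z_def Q_def)
  have sQ: "(\<Sum>b\<in>Basis. (hess b e)\<^sup>2) = Q" unfolding Q_def by (simp only: hess_commute[of _ e])
  have sY: "(\<Sum>b\<in>Basis. \<Sum>c\<in>Basis. (z \<bullet> c) * dd b (dd b (dd c f)) z) = hess z z / 2"
    unfolding sum_z_dd3 by (rule graph_equation_derivatives(2)[OF graph_equation])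
  have ss: "(\<Sum>b\<in>Basis. (s1 b)\<^sup>2) = 4 * (d \<bullet> d - (d \<bullet> \<nu>)\<^sup>2)"
  proof -
    have "s1 b = 2 * ((d - (d \<bullet> \<nu>) *\<^sub>R \<nu>) \<bullet> b)" for b
      by (simp add: s1_def inner_diff_left inner_commute[of \<nu> b])
    then have "(\<Sum>b\<in>Basis. (s1 b)\<^sup>2) = 4 * (\<Sum>b\<in>Basis. ((d - (d \<bullet> \<nu>) *\<^sub>R \<nu>) \<bullet> b)\<^sup>2)"
      by (simp add: power_mult_distrib sum_distrib_left)
    also have "\<dots> = 4 * (d \<bullet> d - (d \<bullet> \<nu>)\<^sup>2)"
      unfolding sum_inner_Basis_squared
      by (simp add: inner_diff_left inner_diff_right \<nu>_\<nu> inner_commute[of \<nu> d] power2_eq_square)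
    finally show ?thesis .
  qed
  have sb: "(\<Sum>b\<in>(Basis::'a set). b \<bullet> b) = real DIM('a)" by (simp add: inner_same_Basis)
  have sn: "(\<Sum>b\<in>Basis. (b \<bullet> \<nu>)\<^sup>2) = 1"
    using sum_inner_Basis_squared[of \<nu>] \<nu>_\<nu> by (simp add: inner_commute)
  have E1: "(\<Sum>b\<in>Basis. b2 b) = \<sigma> * (- (2 * T + F / 2 + Z / 2 - l * Q) + F * A + 2 * F * Q)
      + (c * ((- \<Delta> - hess z z / 2 - (z \<bullet> \<nu>) * A) / 2)
      + (- \<epsilon>) * (g * (\<alpha>\<^sup>2 * (4 * (d \<bullet> d - (d \<bullet> \<nu>)\<^sup>2)) - \<alpha> * (2 * real DIM('a) - 2 * 1 + 2 * \<Delta> * (d \<bullet> \<nu>)))))"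
    unfolding b2_def sum.distrib sum_distrib_left[symmetric] sum_subtractf sum_negf sum_divide_distrib[symmetric]
      sum_distrib_right[symmetric] s4 sQ sY ss sb sn F_def[symmetric] A_def[symmetric] \<Delta>_def[symmetric] ..
  have E2: "b1 z = \<sigma> * (- Z) + (c * (- hess z z / 2) + \<epsilon> * g * \<alpha> * (2 * (z \<bullet> d - (z \<bullet> \<nu>) * (d \<bullet> \<nu>))))"
    unfolding b1_def Z_def s1_def inner_commute[of d z]
    by (simp only: mult_minus_left mult_minus_right minus_minus mult.assoc mult.commute mult.left_commute)
  \<comment> \<open>If \<open>e\<close> is principal, \<open>Q = F\<^sup>2\<close> and \<open>T = F\<^sup>3\<close>: the cubic terms cancel and \<open>l * F\<^sup>2\<close> remains.\<close>
  have cancel: "\<sigma> * (- 2 * T + l * Q + 2 * F * Q) \<le> 0"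
  proof (cases "\<sigma> = 0")
    case False
    have he: "hess e v = F * (e \<bullet> v)" for v using eigen[OF False] unfolding F_def by blast
    have ee: "e \<bullet> e = 1" using e1 by (simp add: norm_eq_1)
    have Q: "Q = F\<^sup>2"
      unfolding Q_def he power_mult_distrib sum_distrib_left[symmetric] sum_inner_Basis_squared ee by simp
    have "T = F\<^sup>2 * (\<Sum>b\<in>Basis. \<Sum>c\<in>Basis. (e \<bullet> b) * (e \<bullet> c) * hess b c)"
      unfolding T_def he sum_distrib_left by (simp add: power2_eq_square mult_ac)
    also have "\<dots> = F\<^sup>2 * F"
      using dd_dd_bilinear_expand[OF open_S smooth z_S, where v=e and w=e] by (simp add: F_def)
    finally have "- 2 * T + l * Q + 2 * F * Q = l * F\<^sup>2" using Q by simp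
    then show ?thesis using l \<sigma> by (simp add: mult_nonneg_nonpos mult_nonpos_nonneg)
  qed simp
  have AG: "A * (\<sigma> * (- F) + c * (z \<bullet> \<nu> / 2)) \<ge> 0" using A0 nonneg by (simp add: F_def)
  have cl: "c * l \<le> 0" using c l by (simp add: mult_nonneg_nonpos)
  \<comment> \<open>This combination is \<open>L\<close>; the sum over the ambient basis may replace the one over the tangent
    plane because everything is constant along \<open>\<nu>\<close>.\<close>
  have "0 \<le> (\<Sum>b\<in>Basis. b2 b) - b1 z / 2" using b1z b2b by simp
  then have "0 \<le> \<sigma> * (- 2 * T + l * Q + 2 * F * Q) + (\<sigma> * (- F) + c * (z \<bullet> \<nu> / 2)) / 2 + c * l / 2
      - A * (\<sigma> * (- F) + c * (z \<bullet> \<nu> / 2))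
      - \<epsilon> * g * (4 * \<alpha>\<^sup>2 * (d \<bullet> d - (d \<bullet> \<nu>)\<^sup>2)
           - \<alpha> * (2 * real DIM('a) - 2 - (z \<bullet> \<nu> + 2 * l) * (d \<bullet> \<nu>) - (z \<bullet> d - (z \<bullet> \<nu>) * (d \<bullet> \<nu>))))"
    unfolding E1 E2 \<Delta> by (simp add: field_simps)
  then show ?thesis using cancel AG cl unfolding g_def F_def by linarith
qed

end

section \<open>Geometry of the hypersurface in graph coordinates\<close>

locale hypersurface_graph = lambda_graph S f z "n z" l
  for S :: "'a::euclidean_space set" and f :: "'a \<Rightarrow> real" and z :: 'a and n :: "'a \<Rightarrow> 'a" and l :: real +
  fixes M U' :: "'a set"
  assumes odf: "oriented_defining_function M n U' (\<lambda>X. (X - z) \<bullet> n z - f X)"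
    and lift_M: "\<And>X. X \<in> S \<Longrightarrow> lift X \<in> M \<inter> U'" and U'_S: "U' \<subseteq> S"
begin

lemma dd_vertical: "X \<in> S \<Longrightarrow> dd (n z) f X = 0" "X \<in> S \<Longrightarrow> dd v f (lift X) = dd v f X"
  unfolding lift_def by (rule dd_const_along[OF open_S smooth _ vertical]; assumption)+

lemma dd2_vertical:
  "X \<in> S \<Longrightarrow> dd (n z) (dd w f) X = 0"
  "X \<in> S \<Longrightarrow> dd v (dd w f) (lift X) = dd v (dd w f) X"
proof -
  assume X: "X \<in> S"
  have inv: "Y + t *\<^sub>R n z \<in> S \<and> dd w f (Y + t *\<^sub>R n z) = dd w f Y" if "Y \<in> S" for Y t
    using vertical[OF that] dd_const_along(2)[OF open_S smooth that vertical] by blast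
  show "dd (n z) (dd w f) X = 0" by (rule dd_const_along(1)[OF open_S smooth_dd X inv])
  show "dd v (dd w f) (lift X) = dd v (dd w f) X"
    unfolding lift_def by (rule dd_const_along(2)[OF open_S smooth_dd X inv])
qed

lemma dd_defining:
  assumes "X \<in> U'"
  shows "dd v (\<lambda>X. (X - z) \<bullet> n z - f X) X = v \<bullet> n z - dd v f X"
proof -
  have "(f has_derivative frechet_derivative f (at X)) (at X)"
    using smooth_on_differentiable[OF smooth] assms U'_S frechet_derivative_works by blast
  then have "((\<lambda>X. (X - z) \<bullet> n z - f X) has_derivative (\<lambda>v. v \<bullet> n z - dd v f X)) (at X)"
    by (auto intro!: derivative_eq_intros)
  from fun_cong[OF frechet_derivative_at[OF this], of v] show ?thesis by simp
qed

lemma dd2_defining: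
  assumes "X \<in> U'"
  shows "dd v (dd w (\<lambda>X. (X - z) \<bullet> n z - f X)) X = - dd v (dd w f) X"
proof -
  have d: "(dd w f has_derivative frechet_derivative (dd w f) (at X)) (at X)"
    using smooth_on_differentiable[OF smooth_dd] assms U'_S frechet_derivative_works by blast
  have "dd v (dd w (\<lambda>X. (X - z) \<bullet> n z - f X)) X = dd v (\<lambda>X. w \<bullet> n z - dd w f X) X"
    by (rule dd_cong[OF oriented_defining_functionD(1)[OF odf] assms
          smooth_on_differentiable[OF smooth_on_dd[OF oriented_defining_functionD(2)[OF odf]] assms] dd_defining])
  also have "\<dots> = - dd v (dd w f) X"
  proof -
    have "((\<lambda>X. w \<bullet> n z - dd w f X) has_derivative (\<lambda>v. - dd v (dd w f) X)) (at X)"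
      using d by (auto intro!: derivative_eq_intros)
    from fun_cong[OF frechet_derivative_at[OF this], of v] show ?thesis by simp
  qed
  finally show ?thesis .
qed

lemma slope_pos: "slope X > 0"
  unfolding slope_def by (simp add: add_pos_nonneg sum_nonneg)

lemma slope_squared: "slope X * slope X = 1 + (\<Sum>b\<in>Basis. dd b f X * dd b f X)"
  unfolding slope_def by (simp add: add_nonneg_nonneg sum_nonneg)

lemma inner_grad_defining:
  assumes "X \<in> S"
  shows "v \<bullet> grad (\<lambda>X. (X - z) \<bullet> n z - f X) (lift X) = v \<bullet> n z - dd v f X"
proof -
  have U: "lift X \<in> U'" using lift_M[OF assms] by simp
  show ?thesis
    unfolding inner_grad[OF smooth_on_differentiable[OF oriented_defining_functionD(2)[OF odf] U]]
      dd_defining[OF U] dd_vertical(2)[OF assms] ..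
qed

text \<open>In the expansion of the square of \<open>n z - grad f X\<close> the mixed term is the derivative of \<open>f\<close> along
  \<open>n z\<close>, which is zero.\<close>

lemma norm_grad_defining:
  assumes X: "X \<in> S"
  shows "norm (grad (\<lambda>X. (X - z) \<bullet> n z - f X) (lift X)) = slope X"
proof -
  let ?g = "grad (\<lambda>X. (X - z) \<bullet> n z - f X) (lift X)"
  have "?g \<bullet> ?g = (\<Sum>b\<in>Basis. (b \<bullet> ?g) * (b \<bullet> ?g))"
    using euclidean_inner[of ?g ?g] by (simp add: inner_commute)
  also have "\<dots> = (\<Sum>b\<in>Basis. (n z \<bullet> b) * (n z \<bullet> b) - 2 * ((n z \<bullet> b) * dd b f X) + dd b f X * dd b f X)"
    unfolding inner_grad_defining[OF X] by (intro sum.cong refl) (simp add: algebra_simps inner_commute)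
  also have "\<dots> = n z \<bullet> n z - 2 * (\<Sum>b\<in>Basis. (n z \<bullet> b) * dd b f X) + (\<Sum>b\<in>Basis. dd b f X * dd b f X)"
    unfolding sum.distrib sum_subtractf sum_distrib_left[symmetric] euclidean_inner[of "n z" "n z"] ..
  also have "(\<Sum>b\<in>Basis. (n z \<bullet> b) * dd b f X) = 0"
    using frechet_derivative_expand[OF smooth_on_differentiable[OF smooth X], of "n z"] dd_vertical(1)[OF X] by simp
  finally have "?g \<bullet> ?g = slope X * slope X" using \<nu>_\<nu> slope_squared[of X] by simp
  then have "(norm ?g)\<^sup>2 = (slope X)\<^sup>2"
    by (simp only: power2_norm_eq_inner power2_eq_square[of "slope X"])
  then show ?thesis using slope_pos[of X] by (simp add: power2_eq_iff_nonneg)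
qed

lemma inner_normal_lift:
  assumes X: "X \<in> S"
  shows "v \<bullet> n (lift X) = (v \<bullet> n z - dd v f X) * inverse (slope X)"
proof -
  have "v \<bullet> n z - dd v f X = slope X * (v \<bullet> n (lift X))"
    using arg_cong[OF oriented_defining_functionD(5)[OF odf lift_M[OF X]], of "(\<bullet>) v"]
    unfolding inner_grad_defining[OF X] norm_grad_defining[OF X] by simp
  then show ?thesis using slope_pos[of X] by (simp add: field_simps)
qed

lemma support_lift:
  assumes X: "X \<in> S"
  shows "lift X \<bullet> n (lift X) / 2 = half_support X"
proof -
  have d: "f differentiable (at X)" by (rule smooth_on_differentiable[OF smooth X])
  have 1: "dd (lift X) f X = (\<Sum>b\<in>Basis. (X \<bullet> b) * dd b f X)"
    unfolding lift_def dd_add[OF d] dd_scaleR[OF d] dd_vertical(1)[OF X]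
    using frechet_derivative_expand[OF d, of X] by simp
  have 2: "lift X \<bullet> n z = z \<bullet> n z + f X"
    using \<nu>_\<nu> by (simp add: lift_def inner_add_left inner_diff_left)
  show ?thesis
    unfolding inner_normal_lift[OF X] half_support_def height_def 1 2 by simp
qed

text \<open>The normal at \<open>lift X\<close> is \<open>(n z - grad f X) / slope X\<close>, and derivatives along \<open>n z\<close> vanish.  So the
  normal entry of the second derivatives is the one along \<open>grad f X\<close>.\<close>

lemma mean_curvature_lift:
  assumes X: "X \<in> S"
  shows "mean_curvature M n (lift X) =
    (- (\<Sum>b\<in>Basis. dd b (dd b f) X)
     + (\<Sum>b\<in>Basis. \<Sum>c\<in>Basis. dd b f X * dd c f X * dd b (dd c f) X) * (inverse (slope X) * inverse (slope X)))
    * inverse (slope X)"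
proof -
  have U: "lift X \<in> U'" using lift_M[OF X] by simp
  define g where "g = grad f X"
  define s where "s = inverse (slope X)"
  have d: "f differentiable (at X)" by (rule smooth_on_differentiable[OF smooth X])
  have dw: "dd w f differentiable (at X)" for w by (rule smooth_on_differentiable[OF smooth_dd X])
  have ng: "n (lift X) = s *\<^sub>R (n z + (-1) *\<^sub>R g)"
  proof (rule vector_eq_ldot[THEN iffD1], rule allI)
    fix v show "v \<bullet> n (lift X) = v \<bullet> (s *\<^sub>R (n z + (-1) *\<^sub>R g))"
      unfolding inner_normal_lift[OF X] using inner_grad[OF d, of v]
      by (simp add: s_def g_def inner_add_right inner_diff_right mult.commute)
  qed
  have lin1: "dd (n (lift X)) (dd w f) X = - s * dd g (dd w f) X" for w
    unfolding ng dd_scaleR[OF dw] dd_add[OF dw] dd2_vertical(1)[OF X] by simp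
  have "dd (n (lift X)) (dd (n (lift X)) f) X = - s * dd g (dd (n (lift X)) f) X" by (rule lin1)
  also have "dd g (dd (n (lift X)) f) X = dd (n (lift X)) (dd g f) X"
    by (rule dd_dd_commute[OF open_S smooth X])
  also have "\<dots> = - s * dd g (dd g f) X" by (rule lin1)
  also have "dd g (dd g f) X = (\<Sum>b\<in>Basis. \<Sum>c\<in>Basis. dd b f X * dd c f X * dd b (dd c f) X)"
    unfolding dd_dd_bilinear_expand[OF open_S smooth X, where v=g and w=g]
    using inner_grad[OF d] by (simp add: g_def inner_commute)
  finally have nn: "dd (n (lift X)) (dd (n (lift X)) f) X =
      (\<Sum>b\<in>Basis. \<Sum>c\<in>Basis. dd b f X * dd c f X * dd b (dd c f) X) * (s * s)" by simp
  show ?thesis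
    unfolding mean_curvature_eq[OF odf lift_M[OF X] oriented_defining_function_norm[OF odf lift_M[OF X]]]
      dd2_defining[OF U] dd2_vertical(2)[OF X] norm_grad_defining[OF X] nn s_def
    by (simp add: sum_negf divide_inverse)
qed

lemma graph_equationI:
  assumes "lambda_hypersurface l M n"
  shows graph_equation
  unfolding graph_equation_def
proof
  fix X assume X: "X \<in> S"
  let ?D = "\<Sum>b\<in>Basis. dd b (dd b f) X"
  let ?T = "(\<Sum>b\<in>Basis. \<Sum>c\<in>Basis. dd b f X * dd c f X * dd b (dd c f) X) * (inverse (slope X) * inverse (slope X))"
  have "mean_curvature M n (lift X) - (lift X \<bullet> n (lift X)) / 2 = l"
    using assms lift_M[OF X] by (auto simp: lambda_hypersurface_def)
  then have "(- ?D + ?T) * inverse (slope X) - 1/2 * (height X * inverse (slope X)) = l"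
    unfolding support_lift[OF X] mean_curvature_lift[OF X] half_support_def .
  moreover have "a - 1/2 * h = l * w" if "a * inverse w - 1/2 * (h * inverse w) = l" "w > 0" for a h w :: real
    using that by (simp add: field_simps)
  ultimately have "(- ?D + ?T) - 1/2 * height X = l * slope X"
    using slope_pos[of X] by blast
  then show "?D + (-1) * ?T + (1/2) * height X + l * slope X = 0" by simp
qed

lemma second_fundamental_form_lift:
  assumes X: "X \<in> S" and v: "v \<bullet> n (lift X) = 0"
  shows "- second_fundamental_form M n (lift X) v v = - dd v (dd v f) X * inverse (slope X)"
proof -
  have U: "lift X \<in> U'" using lift_M[OF X] by simp
  show ?thesis
    unfolding second_fundamental_form_eq[OF odf lift_M[OF X] v v] dd2_defining[OF U]
      dd2_vertical(2)[OF X] norm_grad_defining[OF X] by (simp add: divide_inverse)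
qed

text \<open>The direction is the normalised lift \<open>e + dd e f X *\<^sub>R n z\<close> of \<open>e\<close>.  Its vertical part does not
  contribute to second derivatives, and its squared length \<open>1 + (dd e f X)\<^sup>2\<close> is the factor in
  \<^const>\<open>lifted_curvature\<close>.\<close>

lemma normal_curvature_at_lift:
  assumes X: "X \<in> S" and e: "norm e = 1" "e \<bullet> n z = 0"
  obtains v where "norm v = 1" "v \<bullet> n (lift X) = 0" "- second_fundamental_form M n (lift X) v v = lifted_curvature e X"
proof -
  define v0 where "v0 = e + dd e f X *\<^sub>R n z"
  define r where "r = inverse (norm v0)"
  have d: "f differentiable (at X)" by (rule smooth_on_differentiable[OF smooth X])
  have dw: "dd w f differentiable (at X)" for w by (rule smooth_on_differentiable[OF smooth_dd X])
  have v0: "v0 \<bullet> n (lift X) = 0"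
    unfolding inner_normal_lift[OF X] v0_def dd_add[OF d] dd_scaleR[OF d] dd_vertical(1)[OF X]
    using e \<nu>_\<nu> by (simp add: inner_add_left)
  have "v0 \<bullet> v0 = 1 + dd e f X * dd e f X"
    using e \<nu>_\<nu> by (simp add: v0_def inner_add_left inner_add_right norm_eq_1 inner_commute)
  then have r2: "r * r = inverse (1 + dd e f X * dd e f X)"
    by (simp add: r_def inverse_mult_distrib[symmetric] power2_norm_eq_inner[symmetric] power2_eq_square)
  have v0nz: "v0 \<noteq> 0"
  proof
    assume "v0 = 0"
    then have "0 = 1 + dd e f X * dd e f X" using \<open>v0 \<bullet> v0 = _\<close> by simp
    then show False by (metis add_pos_nonneg less_irrefl zero_le_square zero_less_one)
  qed
  have lin: "dd v0 (dd w f) X = dd e (dd w f) X" for w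
    unfolding v0_def dd_add[OF dw] dd_scaleR[OF dw] dd2_vertical(1)[OF X] by simp
  have "dd v0 (dd v0 f) X = dd e (dd e f) X"
    using lin[of v0] dd_dd_commute[OF open_S smooth X, of e v0] lin[of e] by simp
  then have "dd (r *\<^sub>R v0) (dd v0 f) X = r * dd e (dd e f) X"
    unfolding dd_scaleR[OF dw] by simp
  then have "dd v0 (dd (r *\<^sub>R v0) f) X = r * dd e (dd e f) X"
    using dd_dd_commute[OF open_S smooth X, of v0 "r *\<^sub>R v0"] by simp
  then have h: "dd (r *\<^sub>R v0) (dd (r *\<^sub>R v0) f) X = r * r * dd e (dd e f) X"
    unfolding dd_scaleR[OF dw] by simp
  show ?thesis
  proof
    show "norm (r *\<^sub>R v0) = 1" using v0nz by (simp add: r_def)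
    show t: "(r *\<^sub>R v0) \<bullet> n (lift X) = 0" using v0 by simp
    show "- second_fundamental_form M n (lift X) (r *\<^sub>R v0) (r *\<^sub>R v0) = lifted_curvature e X"
      unfolding second_fundamental_form_lift[OF X t] h r2 lifted_curvature_def by simp
  qed
qed

lemma lift_z: "lift z = z" by (simp add: lift_def f_z)

lemma slope_z: "slope z = 1" by (simp add: slope_def crit)

lemma lifted_curvature_z: "lifted_curvature e z = - hess e e"
  by (simp add: lifted_curvature_def slope_z crit)

lemma half_support_z: "half_support z = z \<bullet> n z / 2"
  using support_lift[OF z_S] lift_z by simp

lemma second_fundamental_form_z: "v \<bullet> n z = 0 \<Longrightarrow> - second_fundamental_form M n z v v = - hess v v"
  using second_fundamental_form_lift[OF z_S, of v] by (simp add: lift_z slope_z)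

lemma continuous_lift: "continuous_on S lift"
  unfolding lift_def by (intro continuous_intros smooth_on_continuous_on[OF smooth])

end

lemma hypersurface_graph_exists:
  fixes M :: "'a::euclidean_space set"
  assumes odf: "oriented_defining_function M n U \<rho>" and z: "z \<in> M \<inter> U"
  obtains S f U' where "hypersurface_graph S f z n M U'"
proof -
  obtain S f U' where S: "open S" "z \<in> S" "smooth_on S f" "f z = (0::real)"
    and vert: "\<And>X t. X \<in> S \<Longrightarrow> X + t *\<^sub>R n z \<in> S \<and> f (X + t *\<^sub>R n z) = f X"
    and lift: "\<And>X. X \<in> S \<Longrightarrow> X + (f X - (X - z) \<bullet> n z) *\<^sub>R n z \<in> M \<inter> U'" and U': "U' \<subseteq> S"
    and odf': "oriented_defining_function M n U' (\<lambda>X. (X - z) \<bullet> n z - f X)"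
    by (rule smooth_graph_representation[OF odf z]) (erule that, assumption+)
  have n1: "norm (n z) = 1" by (rule oriented_defining_function_norm[OF odf z])
  have d: "f differentiable (at z)" by (rule smooth_on_differentiable[OF S(3,2)])
  have zU': "z \<in> M \<inter> U'" using lift[OF S(2)] S(4) by simp
  let ?\<sigma> = "\<lambda>X. (X - z) \<bullet> n z - f X"
  have D: "v \<bullet> grad ?\<sigma> z = v \<bullet> n z - dd v f z" for v
  proof -
    have "(?\<sigma> has_derivative (\<lambda>v. v \<bullet> n z - dd v f z)) (at z)"
      using d unfolding frechet_derivative_works by (auto intro!: derivative_eq_intros)
    from fun_cong[OF frechet_derivative_at[OF this], of v]
    show ?thesis
      using inner_grad[OF smooth_on_differentiable[OF oriented_defining_functionD(2)[OF odf']]] zU' by simp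
  qed
  have k: "v \<bullet> grad ?\<sigma> z = norm (grad ?\<sigma> z) * (v \<bullet> n z)" for v
    using arg_cong[OF oriented_defining_functionD(5)[OF odf' zU'], of "(\<bullet>) v"] by simp
  have "dd (n z) f z = 0" using dd_const_along(1)[OF S(1,3,2) vert] .
  moreover have "n z \<bullet> n z = 1" using n1 by (simp add: norm_eq_1)
  ultimately have "norm (grad ?\<sigma> z) = 1" using D[of "n z"] k[of "n z"] by simp
  then have crit: "dd v f z = 0" for v using D[of v] k[of v] by simp
  interpret lambda_graph S f z "n z"
    by unfold_locales (use S n1 vert crit in blast)+
  have "hypersurface_graph S f z n M U'"
    by unfold_locales (use odf' lift U' in \<open>simp_all add: lift_def\<close>)
  then show ?thesis by (rule that)
qed

section \<open>Test functions on the unit tangent bundle\<close>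

lemma linear_coefficient_zero:
  fixes a b :: real
  assumes "\<And>t. a * t + b * t\<^sup>2 \<ge> 0"
  shows "a = 0"
proof -
  have "((\<lambda>t. a * t + b * t\<^sup>2) has_real_derivative a) (at 0)"
    by (auto intro!: derivative_eq_intros)
  then show ?thesis
    by (rule DERIV_local_min[where d=1]) (use assms in auto)
qed

lemma dd_dd_scaleR:
  fixes f :: "'a::euclidean_space \<Rightarrow> real"
  assumes S: "open S" "smooth_on S f" "x \<in> S"
  shows "dd (r *\<^sub>R v) (dd (r *\<^sub>R v) f) x = r * r * dd v (dd v f) x"
  unfolding dd_dd_bilinear_expand[OF S, of "r *\<^sub>R v"] dd_dd_bilinear_expand[OF S, of v]
  by (simp add: sum_distrib_left mult_ac)

lemma continuous_on_locally:
  fixes f :: "'a::metric_space \<Rightarrow> 'b::metric_space"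
  assumes "\<And>x. x \<in> S \<Longrightarrow> \<exists>U. open U \<and> x \<in> U \<and> continuous_on (S \<inter> U) f"
  shows "continuous_on S f"
  unfolding continuous_on_eq_continuous_within
proof
  fix x assume x: "x \<in> S"
  then obtain U where U: "open U" "x \<in> U" "continuous_on (S \<inter> U) f" using assms by blast
  have "at x within (S \<inter> U) = at x within S" by (rule at_within_nhd[OF U(2,1)]) auto
  then show "continuous (at x within S) f"
    using U x unfolding continuous_on_eq_continuous_within by (metis IntI)
qed

locale closed_lambda_hypersurface =
  fixes M :: "'a::euclidean_space set" and n :: "'a \<Rightarrow> 'a" and l :: real
  assumes dim2: "DIM('a) \<ge> 2" and l_nonpos: "l \<le> 0" and compact_M: "compact M"
    and embedded: "smooth_embedded_hypersurface M" and outer: "outer_unit_normal M n"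
    and lambda: "lambda_hypersurface l M n"
begin

definition normal_curvature :: "'a \<Rightarrow> 'a \<Rightarrow> real" where
  "normal_curvature q v = - second_fundamental_form M n q v v"

definition unit_tangent_bundle :: "('a \<times> 'a) set" where
  "unit_tangent_bundle = {(q, v). q \<in> M \<and> norm v = 1 \<and> v \<bullet> n q = 0}"

lemma defining_function_at:
  assumes "p \<in> M"
  obtains U \<rho> where "p \<in> M \<inter> U" "oriented_defining_function M n U \<rho>"
  using oriented_defining_function_exists[OF embedded outer assms] assms by blast

lemma norm_n: "q \<in> M \<Longrightarrow> norm (n q) = 1"
  using outer by (auto simp: outer_unit_normal_def)

lemma continuous_on_n: "continuous_on M n"
proof (rule continuous_on_locally)
  fix p assume "p \<in> M"
  then obtain U \<rho> where p: "p \<in> M \<inter> U" and odf: "oriented_defining_function M n U \<rho>" by (rule defining_function_at)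
  note D = oriented_defining_functionD[OF odf]
  have "continuous_on (M \<inter> U) (grad \<rho>)"
    by (rule continuous_on_subset[OF smooth_on_continuous_on[OF smooth_on_grad[OF D(1,2)]]]) auto
  then have "continuous_on (M \<inter> U) (\<lambda>q. inverse (norm (grad \<rho> q)) *\<^sub>R grad \<rho> q)"
    using D(4) by (intro continuous_intros) auto
  moreover have "inverse (norm (grad \<rho> q)) *\<^sub>R grad \<rho> q = n q" if "q \<in> M \<inter> U" for q
    using arg_cong[OF D(5)[OF that], of "\<lambda>x. inverse (norm (grad \<rho> q)) *\<^sub>R x"] D(4)[OF that] by simp
  ultimately have "continuous_on (M \<inter> U) n" by (rule continuous_on_eq)
  then show "\<exists>U. open U \<and> p \<in> U \<and> continuous_on (M \<inter> U) n" using D(1) p by blast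
qed

lemma normal_curvature_eq:
  assumes "oriented_defining_function M n U \<rho>" "q \<in> M \<inter> U" "v \<bullet> n q = 0"
  shows "normal_curvature q v = dd v (dd v \<rho>) q / norm (grad \<rho> q)"
  using second_fundamental_form_eq[OF assms assms(3)] by (simp add: normal_curvature_def)

text \<open>Locally the normal curvature is a quadratic polynomial in \<open>v\<close> whose coefficients are second
  derivatives of a defining function, divided by the length of its gradient.\<close>

lemma continuous_on_normal_curvature:
  "continuous_on unit_tangent_bundle (\<lambda>x. normal_curvature (fst x) (snd x))"
proof (rule continuous_on_locally)
  fix x assume x: "x \<in> unit_tangent_bundle"
  then have "fst x \<in> M" by (auto simp: unit_tangent_bundle_def)
  then obtain U \<rho> where p: "fst x \<in> M \<inter> U" and odf: "oriented_defining_function M n U \<rho>" by (rule defining_function_at)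
  note D = oriented_defining_functionD[OF odf]
  let ?T = "unit_tangent_bundle \<inter> (U \<times> UNIV)"
  have T: "fst y \<in> M \<inter> U" "fst y \<in> U" "snd y \<bullet> n (fst y) = 0" if "y \<in> ?T" for y
    using that by (auto simp: unit_tangent_bundle_def)
  have c: "continuous_on ?T (\<lambda>y. h (fst y))" if "continuous_on U h" for h :: "'a \<Rightarrow> 'c::real_normed_vector"
    by (rule continuous_on_compose2[OF that continuous_on_fst[OF continuous_on_id]]) (use T in blast)
  have "continuous_on ?T (\<lambda>y. (\<Sum>b\<in>Basis. \<Sum>c\<in>Basis. (snd y \<bullet> b) * (snd y \<bullet> c) * dd b (dd c \<rho>) (fst y))
      / norm (grad \<rho> (fst y)))"
  proof (intro continuous_intros c)
    show "continuous_on U (dd b (dd c \<rho>))" for b c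
      by (intro smooth_on_continuous_on smooth_on_dd D(2))
    show "continuous_on U (grad \<rho>)" by (intro smooth_on_continuous_on smooth_on_grad D(1,2))
    show "\<forall>y\<in>?T. norm (grad \<rho> (fst y)) \<noteq> 0" using D(4) T(1) by simp
  qed
  then have "continuous_on ?T (\<lambda>x. normal_curvature (fst x) (snd x))"
    by (rule continuous_on_eq)
      (simp only: normal_curvature_eq[OF odf T(1,3)] dd_dd_bilinear_expand[OF D(1,2) T(2), symmetric])
  then show "\<exists>V. open V \<and> x \<in> V \<and> continuous_on (unit_tangent_bundle \<inter> V) (\<lambda>x. normal_curvature (fst x) (snd x))"
    using D(1) p by (intro exI[of _ "U \<times> UNIV"]) (auto simp: open_Times mem_Times_iff)
qed

lemma compact_unit_tangent_bundle: "compact unit_tangent_bundle"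
proof -
  let ?K = "M \<times> sphere (0::'a) 1"
  have c: "compact ?K" by (intro compact_Times compact_M) simp
  have "continuous_on ?K (\<lambda>x. snd x \<bullet> n (fst x))"
    by (intro continuous_intros continuous_on_compose2[OF continuous_on_n continuous_on_fst[OF continuous_on_id]]) auto
  from continuous_closedin_preimage_constant[OF this, of 0]
  have "closedin (top_of_set ?K) {x \<in> ?K. snd x \<bullet> n (fst x) = 0}" .
  then have "compact {x \<in> ?K. snd x \<bullet> n (fst x) = 0}" by (rule closedin_compact[OF c])
  moreover have "{x \<in> ?K. snd x \<bullet> n (fst x) = 0} = unit_tangent_bundle"
    by (auto simp: unit_tangent_bundle_def)
  ultimately show ?thesis by simp
qed

lemma unit_tangent_exists:
  assumes "q \<in> M"
  obtains v where "(q, v) \<in> unit_tangent_bundle"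
proof -
  obtain y where y: "y \<noteq> 0" "orthogonal (n q) y" using orthogonal_to_vector_exists[OF dim2] by metis
  then have "(q, (1 / norm y) *\<^sub>R y) \<in> unit_tangent_bundle"
    using assms by (simp add: unit_tangent_bundle_def orthogonal_def inner_commute)
  then show ?thesis by (rule that)
qed

text \<open>The two cases of interest are \<open>\<sigma> = 0, c = 1\<close>, half the support function, and \<open>\<sigma> = 1\<close>, whose minimum
  over \<open>v\<close> is the smallest principal curvature plus \<open>c\<close> times half the support function.\<close>

definition test_function :: "real \<Rightarrow> real \<Rightarrow> 'a \<Rightarrow> 'a \<Rightarrow> real" where
  "test_function \<sigma> c q v = \<sigma> * normal_curvature q v + c * (q \<bullet> n q / 2)"

lemma continuous_on_test_function:
  "continuous_on unit_tangent_bundle (\<lambda>x. test_function \<sigma> c (fst x) (snd x))"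
  unfolding test_function_def
  by (intro continuous_intros continuous_on_normal_curvature
      continuous_on_compose2[OF continuous_on_n continuous_on_fst[OF continuous_on_id]])
    (auto simp: unit_tangent_bundle_def)

text \<open>The minimum over the bundle is taken over positions and directions.  Varying the direction alone
  shows that \<open>e\<close> is principal, unless curvature does not enter the test function.  Varying the position,
  with \<open>e\<close> replaced by its lift, is the situation of \<open>touching_inequality\<close> in the graph over the tangent
  plane at \<open>z\<close>.\<close>

lemma test_function_touching:
  fixes y :: 'a
  assumes ze: "(z, e) \<in> unit_tangent_bundle" and \<sigma>: "\<sigma> \<ge> 0" and c: "c \<ge> 0"
    and V: "open V" "z \<in> V"
    and min: "\<And>q v. (q, v) \<in> unit_tangent_bundle \<Longrightarrow> q \<in> V \<Longrightarrow>
        test_function \<sigma> c z e - \<epsilon> * exp (- \<alpha> * (norm (z - y))\<^sup>2)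
        \<le> test_function \<sigma> c q v - \<epsilon> * exp (- \<alpha> * (norm (q - y))\<^sup>2)"
    and nonneg: "0 \<le> test_function \<sigma> c z e"
  shows "\<epsilon> * exp (- \<alpha> * (norm (z - y))\<^sup>2) *
      (4 * \<alpha>\<^sup>2 * ((z - y) \<bullet> (z - y) - ((z - y) \<bullet> n z)\<^sup>2)
       - \<alpha> * (2 * real DIM('a) - 2 - (z \<bullet> n z + 2 * l) * ((z - y) \<bullet> n z)
              - (z \<bullet> (z - y) - (z \<bullet> n z) * ((z - y) \<bullet> n z))))
    \<le> test_function \<sigma> c z e / 2"
proof -
  have zM: "z \<in> M" and e1: "norm e = 1" and en: "e \<bullet> n z = 0"
    using ze by (auto simp: unit_tangent_bundle_def)
  obtain U \<rho> where zU: "z \<in> M \<inter> U" and odf: "oriented_defining_function M n U \<rho>" using zM by (rule defining_function_at)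
  obtain S f U' where "hypersurface_graph S f z n M U'" by (rule hypersurface_graph_exists[OF odf zU])
  then interpret hypersurface_graph S f z n l M U' .
  have graph_equation: graph_equation by (rule graph_equationI[OF lambda])
  have nc: "normal_curvature z v = - hess v v" if "v \<bullet> n z = 0" for v
    using second_fundamental_form_z[OF that] by (simp add: normal_curvature_def)
  have G: "test_function \<sigma> c z e = \<sigma> * (- hess e e) + c * (z \<bullet> n z / 2)"
    by (simp add: test_function_def nc[OF en])
  have dw: "dd w f differentiable (at z)" for w by (rule smooth_on_differentiable[OF smooth_dd z_S])
  have eigen: "\<forall>v. hess e v = hess e e * (e \<bullet> v)" if "\<sigma> \<noteq> 0"
  proof
    have unit: "hess w w \<le> hess e e" if "norm w = 1" "w \<bullet> n z = 0" for w
    proof -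
      have "(z, w) \<in> unit_tangent_bundle" using zM that by (simp add: unit_tangent_bundle_def)
      from min[OF this V(2)] have "\<sigma> * (- hess e e) \<le> \<sigma> * (- hess w w)"
        by (simp add: test_function_def nc[OF en] nc[OF that(2)])
      then show ?thesis using \<open>\<sigma> \<noteq> 0\<close> \<sigma> by simp
    qed
    \<comment> \<open>By homogeneity the comparison extends from unit vectors to all tangent vectors; applied to
      \<open>e + t w\<close> it is a quadratic inequality in \<open>t\<close> with equality at \<open>t = 0\<close>.\<close>
    have le: "hess w w \<le> hess e e * (w \<bullet> w)" if "w \<bullet> n z = 0" for w
    proof (cases "w = 0")
      case True
      then show ?thesis using linear_0[OF linear_frechet_derivative[OF dw]] by simp
    next
      case False
      have "hess ((1 / norm w) *\<^sub>R w) ((1 / norm w) *\<^sub>R w) \<le> hess e e"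
        by (rule unit) (use False that in auto)
      then have "1 / norm w * (1 / norm w) * hess w w \<le> hess e e"
        unfolding dd_dd_scaleR[OF open_S smooth z_S] .
      then show ?thesis using False
        by (simp add: power2_norm_eq_inner[symmetric] power2_eq_square field_simps)
    qed
    fix v
    define w where "w = v - (v \<bullet> n z) *\<^sub>R n z"
    have wn: "w \<bullet> n z = 0" using \<nu>_\<nu> by (simp add: w_def inner_diff_left)
    have quad: "hess (e + t *\<^sub>R w) (e + t *\<^sub>R w) = hess e e + 2 * t * hess e w + t\<^sup>2 * hess w w" for t
    proof -
      have 1: "hess (e + t *\<^sub>R w) x = hess e x + t * hess w x" for x
        by (simp add: dd_add[OF dw] dd_scaleR[OF dw])
      show ?thesis
        unfolding 1 hess_commute[where v=e and w="e + t *\<^sub>R w"] hess_commute[where v=w and w="e + t *\<^sub>R w"]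
        unfolding 1 hess_commute[where v=w and w=e] by (simp add: power2_eq_square algebra_simps)
    qed
    have "(2 * (hess e e * (e \<bullet> w) - hess e w)) * t + (hess e e * (w \<bullet> w) - hess w w) * t\<^sup>2 \<ge> 0" for t
    proof -
      have "(e + t *\<^sub>R w) \<bullet> n z = 0" using en wn by (simp add: inner_add_left)
      from le[OF this] have "hess e e + 2 * t * hess e w + t\<^sup>2 * hess w w
          \<le> hess e e * (1 + 2 * t * (e \<bullet> w) + t\<^sup>2 * (w \<bullet> w))"
        unfolding quad using e1
        by (simp add: inner_add_left inner_add_right norm_eq_1 inner_commute[of w e] power2_eq_square algebra_simps)
      then show ?thesis by (simp add: algebra_simps)
    qed
    from linear_coefficient_zero[OF this] have ew: "hess e w = hess e e * (e \<bullet> w)" by simp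
    have "hess (w + (v \<bullet> n z) *\<^sub>R n z) e = hess w e + (v \<bullet> n z) * hess (n z) e"
      by (simp add: dd_add[OF dw] dd_scaleR[OF dw])
    moreover have "w + (v \<bullet> n z) *\<^sub>R n z = v" by (simp add: w_def)
    ultimately have "hess v e = hess w e + (v \<bullet> n z) * hess (n z) e" by simp
    then have "hess e v = hess e w"
      using dd2_vertical(1)[OF z_S, of e] by (simp add: hess_commute[where v=e])
    moreover have "e \<bullet> w = e \<bullet> v" using en by (simp add: w_def inner_diff_right)
    ultimately show "hess e v = hess e e * (e \<bullet> v)" using ew by simp
  qed
  have "\<forall>\<^sub>F X in nhds z. X \<in> S \<and> lift X \<in> V"
  proof (rule eventually_conj)
    show "\<forall>\<^sub>F X in nhds z. X \<in> S" by (rule eventually_nhds_in_open[OF open_S z_S])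
    have "isCont lift z" using continuous_lift continuous_on_eq_continuous_at[OF open_S] z_S by blast
    then have "(lift \<longlongrightarrow> lift z) (nhds z)" by (simp add: isCont_def tendsto_nhds_iff)
    then show "\<forall>\<^sub>F X in nhds z. lift X \<in> V"
      by (rule topological_tendstoD) (use V lift_z in auto)
  qed
  then have ev: "\<forall>\<^sub>F X in nhds z.
        \<sigma> * lifted_curvature e z + c * half_support z - \<epsilon> * gaussian \<alpha> y (lift z)
        \<le> \<sigma> * lifted_curvature e X + c * half_support X - \<epsilon> * gaussian \<alpha> y (lift X)"
  proof eventually_elim
    case (elim X)
    then obtain v where v: "norm v = 1" "v \<bullet> n (lift X) = 0"
      "- second_fundamental_form M n (lift X) v v = lifted_curvature e X"
      using normal_curvature_at_lift[OF _ e1 en] by blast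
    have "(lift X, v) \<in> unit_tangent_bundle" using v lift_M elim by (simp add: unit_tangent_bundle_def)
    from min[OF this] elim have "test_function \<sigma> c z e - \<epsilon> * gaussian \<alpha> y z
        \<le> test_function \<sigma> c (lift X) v - \<epsilon> * gaussian \<alpha> y (lift X)"
      unfolding gaussian_def by blast
    moreover have "test_function \<sigma> c (lift X) v = \<sigma> * lifted_curvature e X + c * half_support X"
      using elim by (simp only: test_function_def normal_curvature_def v(3) support_lift)
    moreover have "test_function \<sigma> c z e = \<sigma> * lifted_curvature e z + c * half_support z"
      by (simp only: G lifted_curvature_z half_support_z)
    ultimately show ?case by (simp only: lift_z)
  qed
  show ?thesis
    using touching_inequality[OF graph_equation l_nonpos \<sigma> c e1 eigen ev] nonneg
    unfolding G gaussian_def by simp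
qed

section \<open>The strong maximum principle\<close>

text \<open>Short chords of \<open>M\<close> are nearly tangent: by the mean value theorem a chord is orthogonal to the
  gradient of a defining function at an intermediate point, and that gradient is nearly the one at
  the endpoint.  This makes the barrier below have a nonzero tangential gradient.\<close>

lemma nearly_tangent_chords:
  assumes "z1 \<in> M"
  obtains r where "r > 0"
    "\<And>x y. x \<in> M \<Longrightarrow> y \<in> M \<Longrightarrow> x \<in> ball z1 r \<Longrightarrow> y \<in> ball z1 r \<Longrightarrow> x \<noteq> y \<Longrightarrow>
       ((x - y) \<bullet> n x)\<^sup>2 < (x - y) \<bullet> (x - y)"
proof -
  obtain U \<rho> where zU: "z1 \<in> M \<inter> U" and odf: "oriented_defining_function M n U \<rho>" using assms by (rule defining_function_at)
  note D = oriented_defining_functionD[OF odf]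
  define \<eta> where "\<eta> = norm (grad \<rho> z1) / 4"
  have \<eta>: "\<eta> > 0" using D(4)[OF zU] by (simp add: \<eta>_def)
  have "continuous_on U (grad \<rho>)" by (intro smooth_on_continuous_on smooth_on_grad D(1,2))
  then have "isCont (grad \<rho>) z1" using continuous_on_eq_continuous_at[OF D(1)] zU by blast
  then obtain r1 where r1: "r1 > 0" "\<And>x. dist x z1 < r1 \<Longrightarrow> dist (grad \<rho> x) (grad \<rho> z1) < \<eta>"
    using \<eta> unfolding continuous_at_eps_delta by blast
  obtain r2 where r2: "r2 > 0" "ball z1 r2 \<subseteq> U" using D(1) zU open_contains_ball by blast
  define r where "r = min r1 r2"
  have r: "r > 0" using r1 r2 by (simp add: r_def)
  show ?thesis
  proof (rule that[OF r])
    fix x y assume x: "x \<in> M" "x \<in> ball z1 r" and y: "y \<in> M" "y \<in> ball z1 r" and xy: "x \<noteq> y"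
    have bU: "w \<in> U" if "w \<in> ball z1 r" for w using that r2 by (auto simp: r_def)
    have diff: "\<rho> differentiable (at w)" if "w \<in> ball z1 r" for w
      by (rule smooth_on_differentiable[OF D(2) bU[OF that]])
    have zero: "\<rho> w = 0" if "w \<in> M" "w \<in> ball z1 r" for w using D(3) bU[OF that(2)] that(1) by blast
    have seg: "y + t *\<^sub>R (x - y) \<in> ball z1 r" if "0 \<le> t" "t \<le> 1" for t
    proof -
      have "y + t *\<^sub>R (x - y) = (1 - t) *\<^sub>R y + t *\<^sub>R x" by (simp add: algebra_simps)
      then show ?thesis using convexD_alt[OF convex_ball y(2) x(2) that] by simp
    qed
    obtain t where t: "0 < t" "t < 1"
      "\<rho> (y + 1 *\<^sub>R (x - y)) - \<rho> (y + 0 *\<^sub>R (x - y)) = (1 - 0) * dd (x - y) \<rho> (y + t *\<^sub>R (x - y))"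
      using MVT2[of 0 1 "\<lambda>t. \<rho> (y + t *\<^sub>R (x - y))" "\<lambda>t. dd (x - y) \<rho> (y + t *\<^sub>R (x - y))"]
        has_real_derivative_along_line[OF diff[OF seg]] by auto
    define w where "w = y + t *\<^sub>R (x - y)"
    have w: "w \<in> ball z1 r" using seg t by (simp add: w_def)
    have "(x - y) \<bullet> grad \<rho> w = 0"
      using t(3) zero[OF x] zero[OF y] inner_grad[OF diff[OF w]] by (simp add: w_def)
    then have "(x - y) \<bullet> grad \<rho> x = (x - y) \<bullet> (grad \<rho> x - grad \<rho> w)" by (simp add: inner_diff_right)
    then have "\<bar>(x - y) \<bullet> grad \<rho> x\<bar> \<le> norm (x - y) * norm (grad \<rho> x - grad \<rho> w)"
      using Cauchy_Schwarz_ineq2 by metis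
    also have "\<dots> < norm (x - y) * (2 * \<eta>)"
    proof (rule mult_strict_left_mono)
      have "dist (grad \<rho> x) (grad \<rho> z1) < \<eta>" "dist (grad \<rho> w) (grad \<rho> z1) < \<eta>"
        using r1(2) x(2) w by (auto simp: r_def dist_commute)
      then show "norm (grad \<rho> x - grad \<rho> w) < 2 * \<eta>"
        using dist_triangle_half_l[of "grad \<rho> x" "grad \<rho> z1" "2 * \<eta>" "grad \<rho> w"]
        by (simp add: dist_norm norm_minus_commute)
    qed (use xy in simp)
    also have "\<dots> \<le> norm (x - y) * norm (grad \<rho> x)"
    proof (rule mult_left_mono)
      have "dist (grad \<rho> x) (grad \<rho> z1) < \<eta>" using r1(2) x(2) by (auto simp: r_def dist_commute)
      then show "2 * \<eta> \<le> norm (grad \<rho> x)"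
        using norm_triangle_ineq3[of "grad \<rho> x" "grad \<rho> z1"] by (simp add: \<eta>_def dist_norm)
    qed simp
    also have "(x - y) \<bullet> grad \<rho> x = norm (grad \<rho> x) * ((x - y) \<bullet> n x)"
      using arg_cong[OF D(5)[of x], of "(\<bullet>) (x - y)"] x bU by simp
    finally have "norm (grad \<rho> x) * \<bar>(x - y) \<bullet> n x\<bar> < norm (grad \<rho> x) * norm (x - y)"
      by (simp add: abs_mult mult.commute)
    then have "\<bar>(x - y) \<bullet> n x\<bar> < norm (x - y)" by (simp add: mult_less_cancel_left_disj)
    then have "\<bar>(x - y) \<bullet> n x\<bar>\<^sup>2 < (norm (x - y))\<^sup>2" by (intro power_strict_mono) auto
    then show "((x - y) \<bullet> n x)\<^sup>2 < (x - y) \<bullet> (x - y)" by (simp add: power2_norm_eq_inner)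
  qed
qed

definition zero_set :: "real \<Rightarrow> real \<Rightarrow> 'a set" where
  "zero_set \<sigma> c = {q. \<exists>v. (q, v) \<in> unit_tangent_bundle \<and> test_function \<sigma> c q v = 0}"

lemma zero_set_subset: "zero_set \<sigma> c \<subseteq> M"
  by (auto simp: zero_set_def unit_tangent_bundle_def)

lemma compact_zero_set: "compact (zero_set \<sigma> c)"
proof -
  have "closedin (top_of_set unit_tangent_bundle) {x \<in> unit_tangent_bundle. test_function \<sigma> c (fst x) (snd x) = 0}"
    by (rule continuous_closedin_preimage_constant[OF continuous_on_test_function])
  then have "compact {x \<in> unit_tangent_bundle. test_function \<sigma> c (fst x) (snd x) = 0}"
    by (rule closedin_compact[OF compact_unit_tangent_bundle])
  then have "compact (fst ` {x \<in> unit_tangent_bundle. test_function \<sigma> c (fst x) (snd x) = 0})"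
    by (intro compact_continuous_image continuous_intros)
  moreover have "fst ` {x \<in> unit_tangent_bundle. test_function \<sigma> c (fst x) (snd x) = 0} = zero_set \<sigma> c"
    by (force simp: zero_set_def)
  ultimately show ?thesis by simp
qed

text \<open>Hopf's argument.  The function \<open>b\<close> vanishes on the sphere of radius \<open>R\<close> about \<open>y\<close>, is positive inside
  and negative outside; for large \<open>\<alpha>\<close> it is a strict subsolution near \<open>z0\<close>, since its gradient is not
  normal to \<open>M\<close> there.  In a small ball about \<open>z0\<close> the difference \<open>G - \<epsilon> b\<close> is positive on the boundary:
  where \<open>b\<close> is not negative there are no zeros of \<open>G\<close>, and \<open>\<epsilon>\<close> can be taken small.  As the difference is
  zero over \<open>z0\<close>, it attains its minimum over the ball at an interior point, and there
  \<open>test_function_touching\<close> contradicts strictness.\<close>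

lemma hopf_barrier:
  assumes \<sigma>: "\<sigma> \<ge> 0" and c: "c \<ge> 0"
    and nonneg: "\<And>q v. (q, v) \<in> unit_tangent_bundle \<Longrightarrow> 0 \<le> test_function \<sigma> c q v"
    and z0: "z0 \<in> zero_set \<sigma> c" and R: "R > 0" "norm (z0 - y) = R"
    and outside: "\<And>q. q \<in> zero_set \<sigma> c \<Longrightarrow> q \<noteq> z0 \<Longrightarrow> R < norm (q - y)"
    and trans: "((z0 - y) \<bullet> n z0)\<^sup>2 < (z0 - y) \<bullet> (z0 - y)"
  shows False
proof -
  define T where "T = unit_tangent_bundle"
  define G where "G x = test_function \<sigma> c (fst x) (snd x)" for x
  have contG: "continuous_on T G" unfolding T_def G_def by (rule continuous_on_test_function)
  have contn: "continuous_on M n" by (rule continuous_on_n)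
  have TM: "fst x \<in> M" if "x \<in> T" for x using that by (auto simp: T_def unit_tangent_bundle_def)
  have z0M: "z0 \<in> M" using z0 zero_set_subset by blast
  obtain e0 where e0: "(z0, e0) \<in> T" "G (z0, e0) = 0" using z0 by (auto simp: zero_set_def T_def G_def)
  define \<tau> where "\<tau> z = (z - y) \<bullet> (z - y) - ((z - y) \<bullet> n z)\<^sup>2" for z
  define \<kappa> where "\<kappa> z = 2 * real DIM('a) - 2 - (z \<bullet> n z + 2 * l) * ((z - y) \<bullet> n z)
              - (z \<bullet> (z - y) - (z \<bullet> n z) * ((z - y) \<bullet> n z))" for z
  have c\<tau>: "continuous_on M \<tau>" unfolding \<tau>_def by (intro continuous_intros contn)
  have c\<kappa>: "continuous_on M \<kappa>" unfolding \<kappa>_def by (intro continuous_intros contn)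
  define \<delta> where "\<delta> = \<tau> z0 / 2"
  have \<delta>: "\<delta> > 0" using trans by (simp add: \<delta>_def \<tau>_def)
  obtain \<rho>' where \<rho>': "\<rho>' > 0" "\<And>z. z \<in> M \<Longrightarrow> dist z z0 < \<rho>' \<Longrightarrow> dist (\<tau> z) (\<tau> z0) < \<delta>"
    using c\<tau> z0M \<delta> unfolding continuous_on_iff by meson
  define \<rho> where "\<rho> = \<rho>' / 2"
  have \<rho>: "\<rho> > 0" using \<rho>' by (simp add: \<rho>_def)
  have \<tau>\<delta>: "\<tau> z > \<delta>" if "z \<in> M" "dist z z0 \<le> \<rho>" for z
    using \<rho>'(2)[OF that(1)] that(2) \<rho>'(1) by (simp add: \<rho>_def \<delta>_def dist_real_def abs_if split: if_splits)
  have "bounded (\<kappa> ` M)" by (intro compact_imp_bounded compact_continuous_image c\<kappa> compact_M)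
  then obtain K where K: "\<And>z. z \<in> M \<Longrightarrow> \<bar>\<kappa> z\<bar> \<le> K" unfolding bounded_iff by auto
  have K0: "K \<ge> 0" using K[OF z0M] by linarith
  \<comment> \<open>The radius \<open>\<rho>\<close> was fixed before \<open>\<alpha>\<close>; the choice of \<open>\<alpha>\<close> lets the quadratic term \<open>4 \<alpha>\<^sup>2 \<tau>\<close> dominate
    \<open>\<alpha> \<kappa>\<close> on the whole ball.\<close>
  define \<alpha> where "\<alpha> = max 1 ((K + 1) / (4 * \<delta>))"
  have \<alpha>1: "\<alpha> \<ge> 1" by (simp add: \<alpha>_def)
  have "(K + 1) / (4 * \<delta>) \<le> \<alpha>" by (simp add: \<alpha>_def)
  then have \<alpha>K: "K + 1 \<le> 4 * \<alpha> * \<delta>" using \<delta> by (simp add: field_simps)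
  have strict: "1 \<le> 4 * \<alpha>\<^sup>2 * \<tau> z - \<alpha> * \<kappa> z" if "z \<in> M" "dist z z0 \<le> \<rho>" for z
  proof -
    have "1 \<le> \<alpha> * 1" using \<alpha>1 by simp
    also have "\<dots> \<le> \<alpha> * (4 * \<alpha> * \<tau> z - \<kappa> z)"
    proof (rule mult_left_mono)
      have "4 * \<alpha> * \<delta> \<le> 4 * \<alpha> * \<tau> z" using \<tau>\<delta>[OF that] \<alpha>1 by (intro mult_left_mono) auto
      then show "1 \<le> 4 * \<alpha> * \<tau> z - \<kappa> z" using \<alpha>K K[OF that(1)] by linarith
    qed (use \<alpha>1 in simp)
    finally show ?thesis by (simp add: power2_eq_square algebra_simps)
  qed
  define \<beta> where "\<beta> q = exp (- \<alpha> * (norm (q - y))\<^sup>2)" for q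
  define b where "b q = \<beta> q - exp (- \<alpha> * R\<^sup>2)" for q
  have b0: "b z0 = 0" by (simp add: b_def \<beta>_def R(2))
  have b_neg: "b q < 0" if "norm (q - y) > R" for q
  proof -
    have "R\<^sup>2 < (norm (q - y))\<^sup>2" using that R by (intro power_strict_mono) auto
    then show ?thesis using \<alpha>1 by (simp add: b_def \<beta>_def)
  qed
  have b_le1: "b q < 1" for q
  proof -
    have "\<beta> q \<le> 1" using \<alpha>1 by (simp add: \<beta>_def)
    moreover have "exp (- \<alpha> * R\<^sup>2) > 0" by simp
    ultimately show ?thesis unfolding b_def by linarith
  qed
  have contb: "continuous_on A (\<lambda>x. b (fst x))" for A :: "('a \<times> 'a) set"
    unfolding b_def \<beta>_def by (intro continuous_intros)
  define S where "S = {x \<in> T. dist (fst x) z0 = \<rho> \<and> norm (fst x - y) \<le> R}"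
  have compS: "compact S"
  proof -
    have "S = T \<inter> ({x. dist (fst x) z0 = \<rho>} \<inter> {x. norm (fst x - y) \<le> R})" by (auto simp: S_def)
    moreover have "closed ({x::'a \<times> 'a. dist (fst x) z0 = \<rho>} \<inter> {x. norm (fst x - y) \<le> R})"
      by (intro closed_Int closed_Collect_eq closed_Collect_le continuous_intros)
    ultimately show ?thesis using compact_unit_tangent_bundle by (simp add: T_def compact_Int_closed)
  qed
  have Gpos: "G x > 0" if "x \<in> S" for x
  proof -
    have xT: "x \<in> T" using that by (simp add: S_def)
    have "fst x \<noteq> z0" using that \<rho> by (auto simp: S_def)
    then have "fst x \<notin> zero_set \<sigma> c" using outside[of "fst x"] that by (auto simp: S_def)
    then have "G x \<noteq> 0" using xT unfolding zero_set_def G_def T_def by (metis (mono_tags, lifting) mem_Collect_eq prod.collapse)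
    moreover have "G x \<ge> 0" using nonneg[of "fst x" "snd x"] xT by (simp add: G_def T_def)
    ultimately show ?thesis by simp
  qed
  obtain \<epsilon> where \<epsilon>: "\<epsilon> > 0" "\<And>x. x \<in> S \<Longrightarrow> \<epsilon> \<le> G x"
  proof (cases "S = {}")
    case True
    then show ?thesis using that[of 1] by auto
  next
    case False
    have "continuous_on S G" by (rule continuous_on_subset[OF contG]) (auto simp: S_def)
    from continuous_attains_inf[OF compS False this] obtain x0 where "x0 \<in> S" "\<forall>x\<in>S. G x0 \<le> G x" by blast
    then show ?thesis using that[of "G x0"] Gpos by blast
  qed
  define D where "D = {x \<in> T. dist (fst x) z0 \<le> \<rho>}"
  have compD: "compact D"
  proof -
    have "D = T \<inter> {x. dist (fst x) z0 \<le> \<rho>}" by (auto simp: D_def)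
    moreover have "closed {x::'a \<times> 'a. dist (fst x) z0 \<le> \<rho>}"
      by (intro closed_Collect_le continuous_intros)
    ultimately show ?thesis using compact_unit_tangent_bundle by (simp add: T_def compact_Int_closed)
  qed
  have e0D: "(z0, e0) \<in> D" using e0 \<rho> by (simp add: D_def)
  have "continuous_on D (\<lambda>x. G x - \<epsilon> * b (fst x))"
    by (intro continuous_intros contb continuous_on_subset[OF contG]) (auto simp: D_def)
  from continuous_attains_inf[OF compD _ this] e0D
  obtain x where x: "x \<in> D" "\<And>x'. x' \<in> D \<Longrightarrow> G x - \<epsilon> * b (fst x) \<le> G x' - \<epsilon> * b (fst x')" by blast
  obtain z e where xze: "x = (z, e)" by (cases x)
  have ze: "(z, e) \<in> T" "dist z z0 \<le> \<rho>" using x(1) by (auto simp: D_def xze)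
  then have zM: "z \<in> M" using TM by force
  have le0: "G (z, e) - \<epsilon> * b z \<le> 0" using x(2)[OF e0D] e0(2) b0 by (simp add: xze)
  have Gze: "G (z, e) \<ge> 0" using nonneg ze(1) by (simp add: G_def T_def)
  have inner: "dist z z0 < \<rho>"
  proof (rule ccontr)
    assume "\<not> dist z z0 < \<rho>"
    then have d: "dist z z0 = \<rho>" using ze(2) by simp
    show False
    proof (cases "norm (z - y) \<le> R")
      case True
      then have "\<epsilon> \<le> G (z, e)" using \<epsilon>(2)[of "(z, e)"] ze d by (simp add: S_def)
      moreover have "\<epsilon> * b z < \<epsilon> * 1" using b_le1 \<epsilon>(1) by (intro mult_strict_left_mono)
      ultimately show False using le0 by linarith
    next
      case False
      then have "\<epsilon> * b z < 0" using b_neg[of z] \<epsilon>(1) by (simp add: mult_pos_neg)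
      then show False using le0 Gze by linarith
    qed
  qed
  have "\<epsilon> * exp (- \<alpha> * (norm (z - y))\<^sup>2) *
      (4 * \<alpha>\<^sup>2 * ((z - y) \<bullet> (z - y) - ((z - y) \<bullet> n z)\<^sup>2)
       - \<alpha> * (2 * real DIM('a) - 2 - (z \<bullet> n z + 2 * l) * ((z - y) \<bullet> n z)
              - (z \<bullet> (z - y) - (z \<bullet> n z) * ((z - y) \<bullet> n z))))
    \<le> test_function \<sigma> c z e / 2"
  proof (rule test_function_touching[OF _ \<sigma> c, where V = "ball z0 \<rho>"])
    show "(z, e) \<in> unit_tangent_bundle" using ze(1) by (simp add: T_def)
    show "z \<in> ball z0 \<rho>" using inner by (simp add: dist_commute)
    show "0 \<le> test_function \<sigma> c z e" using Gze by (simp add: G_def)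
    fix q v assume "(q, v) \<in> unit_tangent_bundle" "q \<in> ball z0 \<rho>"
    then have "(q, v) \<in> D" by (simp add: D_def T_def dist_commute)
    from x(2)[OF this] show "test_function \<sigma> c z e - \<epsilon> * exp (- \<alpha> * (norm (z - y))\<^sup>2)
        \<le> test_function \<sigma> c q v - \<epsilon> * exp (- \<alpha> * (norm (q - y))\<^sup>2)"
      by (simp add: xze G_def b_def \<beta>_def algebra_simps)
  qed simp
  then have "\<epsilon> * \<beta> z * (4 * \<alpha>\<^sup>2 * \<tau> z - \<alpha> * \<kappa> z) \<le> G (z, e) / 2"
    by (simp only: \<beta>_def \<tau>_def \<kappa>_def G_def fst_conv snd_conv)
  moreover have "\<epsilon> * \<beta> z * 1 \<le> \<epsilon> * \<beta> z * (4 * \<alpha>\<^sup>2 * \<tau> z - \<alpha> * \<kappa> z)"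
    using \<epsilon>(1) by (intro mult_left_mono strict zM ze(2)) (simp add: \<beta>_def)
  moreover have "\<epsilon> * b z < \<epsilon> * \<beta> z"
    using \<epsilon>(1) by (intro mult_strict_left_mono) (simp_all add: b_def)
  moreover have "\<epsilon> * \<beta> z > 0" using \<epsilon>(1) by (simp add: \<beta>_def)
  ultimately show False using le0 by linarith
qed

text \<open>Otherwise some point \<open>y\<close> of \<open>M\<close> near \<open>z1\<close> is not a zero; let \<open>z0\<close> be a zero nearest to \<open>y\<close>.  The ball with
  diameter from \<open>y\<close> to \<open>z0\<close> lies in the ball about \<open>y\<close> through \<open>z0\<close> and touches its boundary only at
  \<open>z0\<close>.  So \<open>z0\<close> is the only zero in the smaller closed ball, and \<open>hopf_barrier\<close> applies.\<close>

lemma zero_set_open: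
  assumes \<sigma>: "\<sigma> \<ge> 0" and c: "c \<ge> 0"
    and nonneg: "\<And>q v. (q, v) \<in> unit_tangent_bundle \<Longrightarrow> 0 \<le> test_function \<sigma> c q v"
    and z1: "z1 \<in> zero_set \<sigma> c"
  shows "\<exists>r>0. M \<inter> ball z1 r \<subseteq> zero_set \<sigma> c"
proof -
  have z1M: "z1 \<in> M" using z1 zero_set_subset by blast
  obtain r where r: "r > 0" and chord: "\<And>x y. x \<in> M \<Longrightarrow> y \<in> M \<Longrightarrow> x \<in> ball z1 r \<Longrightarrow> y \<in> ball z1 r \<Longrightarrow> x \<noteq> y \<Longrightarrow>
       ((x - y) \<bullet> n x)\<^sup>2 < (x - y) \<bullet> (x - y)"
    by (rule nearly_tangent_chords[OF z1M]) (erule that, blast)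
  have "M \<inter> ball z1 (r / 4) \<subseteq> zero_set \<sigma> c"
  proof (rule ccontr)
    assume "\<not> ?thesis"
    then obtain y where "y \<in> M \<inter> ball z1 (r / 4)" "y \<notin> zero_set \<sigma> c" by blast
    then have y: "y \<in> M" "dist z1 y < r / 4" "y \<notin> zero_set \<sigma> c" by auto
    obtain z0 where z0: "z0 \<in> zero_set \<sigma> c" and near: "\<And>q. q \<in> zero_set \<sigma> c \<Longrightarrow> dist y z0 \<le> dist y q"
      using distance_attains_inf[OF compact_imp_closed[OF compact_zero_set], of \<sigma> c y] z1 by blast
    have z0M: "z0 \<in> M" using z0 zero_set_subset by blast
    have ne: "z0 \<noteq> y" using z0 y(3) by auto
    have d1: "dist y z0 < r / 4" using near[OF z1] y(2) by (simp add: dist_commute)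
    have "dist z1 z0 < r" using d1 y(2) dist_triangle[of z1 z0 y] r by simp
    then have ch: "((z0 - y) \<bullet> n z0)\<^sup>2 < (z0 - y) \<bullet> (z0 - y)"
      using chord[OF z0M y(1)] ne y(2) r by simp
    define y' where "y' = (1/2) *\<^sub>R (y + z0)"
    have d: "z0 - y' = (1/2) *\<^sub>R (z0 - y)" by (simp add: y'_def algebra_simps scaleR_add_left[symmetric])
    define R where "R = norm (z0 - y')"
    have R: "R > 0" using ne by (simp add: R_def d)
    show False
    proof (rule hopf_barrier[OF \<sigma> c nonneg z0 R, of y'])
      show "norm (z0 - y') = R" by (simp add: R_def)
      show "((z0 - y') \<bullet> n z0)\<^sup>2 < (z0 - y') \<bullet> (z0 - y')"
        unfolding d using ch by (simp add: power2_eq_square)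
      fix q assume q: "q \<in> zero_set \<sigma> c" "q \<noteq> z0"
      \<comment> \<open>The parallelogram law for \<open>q - y\<close> and \<open>q - z0\<close>.\<close>
      have "4 * (norm (q - y'))\<^sup>2 = 2 * (norm (q - y))\<^sup>2 + 2 * (norm (q - z0))\<^sup>2 - (norm (z0 - y))\<^sup>2"
        unfolding y'_def power2_norm_eq_inner
        by (simp add: inner_diff_left inner_diff_right inner_add_left inner_add_right inner_commute algebra_simps)
      moreover have "(norm (z0 - y))\<^sup>2 \<le> (norm (q - y))\<^sup>2"
        using near[OF q(1)] by (intro power_mono) (simp_all add: dist_norm norm_minus_commute)
      moreover have "(norm (q - z0))\<^sup>2 > 0" using q(2) by simp
      moreover have "4 * R\<^sup>2 = (norm (z0 - y))\<^sup>2" by (simp add: R_def d power_mult_distrib power2_eq_square)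
      ultimately have "R\<^sup>2 < (norm (q - y'))\<^sup>2" by linarith
      then show "R < norm (q - y')" by (rule power2_less_imp_less) simp
    qed
  qed
  then show ?thesis using r by (intro exI[of _ "r / 4"]) auto
qed

lemma strong_maximum_principle:
  assumes \<sigma>: "\<sigma> \<ge> 0" and c: "c \<ge> 0"
    and nonneg: "\<And>q v. (q, v) \<in> unit_tangent_bundle \<Longrightarrow> 0 \<le> test_function \<sigma> c q v"
    and z1: "z1 \<in> zero_set \<sigma> c"
  shows "connected_component_set M z1 \<subseteq> zero_set \<sigma> c"
proof -
  let ?C = "connected_component_set M z1"
  have z1M: "z1 \<in> M" using z1 zero_set_subset by blast
  have CM: "?C \<subseteq> M" by (rule connected_component_subset)
  have cl: "closedin (top_of_set ?C) (?C \<inter> zero_set \<sigma> c)"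
    by (intro closedin_closed_Int compact_imp_closed compact_zero_set)
  have op: "openin (top_of_set ?C) (?C \<inter> zero_set \<sigma> c)"
    unfolding openin_contains_ball
  proof (intro conjI ballI)
    fix x assume "x \<in> ?C \<inter> zero_set \<sigma> c"
    then obtain r where "r > 0" "M \<inter> ball x r \<subseteq> zero_set \<sigma> c"
      using zero_set_open[OF \<sigma> c nonneg, of x] by blast
    then show "\<exists>r>0. ball x r \<inter> ?C \<subseteq> ?C \<inter> zero_set \<sigma> c" using CM by blast
  qed auto
  have "connected ?C" by (rule connected_connected_component)
  then have "?C \<inter> zero_set \<sigma> c = {} \<or> ?C \<inter> zero_set \<sigma> c = ?C"
    using op cl unfolding connected_clopen by blast
  moreover have "z1 \<in> ?C" using z1M by simp
  ultimately show ?thesis using z1 by blast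
qed

section \<open>Convexity\<close>

text \<open>The component lies in a ball about the origin and touches its boundary sphere at \<open>z\<close>.  The inside
  of the component lies in the same ball, so the inner normal \<open>- n z\<close> points into the ball.  The second
  derivative test for the distance from the origin shows that \<open>M\<close> is curved at least as much as the
  sphere.  The distance is tested through the Gaussian about the origin, which has a minimum at \<open>z\<close>.\<close>

lemma farthest_point:
  assumes "p \<in> M"
  obtains z where "z \<in> connected_component_set M p" "z \<bullet> n z > 0"
    "\<And>v. norm v = 1 \<Longrightarrow> v \<bullet> n z = 0 \<Longrightarrow> normal_curvature z v > 0"
proof -
  let ?C = "connected_component_set M p"
  have CM: "?C \<subseteq> M" by (rule connected_component_subset)
  have compC: "compact ?C"
    using closed_connected_component[OF compact_imp_closed[OF compact_M]] CM
      bounded_subset[OF compact_imp_bounded[OF compact_M] CM] by (simp add: compact_eq_bounded_closed)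
  have "p \<in> ?C" using assms by simp
  then obtain z where z: "z \<in> ?C" and far: "\<And>q. q \<in> ?C \<Longrightarrow> dist 0 q \<le> dist 0 z"
    using distance_attains_sup[OF compC, of 0] by blast
  have zM: "z \<in> M" using z CM by blast
  have Cz: "connected_component_set M z = ?C"
    using z by (simp add: connected_component_eq)
  have n1: "n z \<bullet> n z = 1" using norm_n[OF zM] by (simp add: norm_eq_1)
  have inside: "norm x \<le> norm z" if "x \<in> inside ?C" for x
  proof (rule ccontr)
    assume "\<not> ?thesis"
    moreover have "?C \<subseteq> cball 0 (norm z)" using far by auto
    ultimately have "x \<in> outside ?C"
      using outside_subset_convex[of "cball 0 (norm z)" ?C] by auto
    then show False using that inside_Int_outside[of ?C] by blast
  qed
  have pos: "z \<bullet> n z > 0"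
  proof -
    have "\<forall>\<^sub>F t in at_right 0. z - t *\<^sub>R n z \<in> inside ?C"
      using outer[unfolded outer_unit_normal_def, THEN bspec, OF zM] unfolding Cz
      by (auto elim!: eventually_mono)
    moreover have "\<forall>\<^sub>F t in at_right (0::real). t > 0" by (simp add: eventually_at_right_less)
    ultimately have "\<forall>\<^sub>F t in at_right (0::real). z - t *\<^sub>R n z \<in> inside ?C \<and> t > 0" by (rule eventually_conj)
    then obtain t :: real where t: "z - t *\<^sub>R n z \<in> inside ?C" "t > 0"
      using eventually_happens[of _ "at_right (0::real)"] by fastforce
    have "(norm (z - t *\<^sub>R n z))\<^sup>2 \<le> (norm z)\<^sup>2" using inside[OF t(1)] by (intro power_mono) auto
    then have "t * t \<le> 2 * t * (z \<bullet> n z)"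
      unfolding power2_norm_eq_inner
      by (simp add: inner_diff_left inner_diff_right n1 inner_commute algebra_simps)
    then have "t \<le> 2 * (z \<bullet> n z)" using t(2) by (simp add: mult.assoc mult.left_commute)
    then show ?thesis using t(2) by linarith
  qed
  obtain U \<rho> where zU: "z \<in> M \<inter> U" and odf: "oriented_defining_function M n U \<rho>" using zM by (rule defining_function_at)
  obtain S f U' where "hypersurface_graph S f z n M U'" by (rule hypersurface_graph_exists[OF odf zU])
  then interpret hypersurface_graph S f z n l M U' .
  obtain r where r: "r > 0" "ball z r \<subseteq> S" using open_S z_S open_contains_ball by blast
  \<comment> \<open>The maximum of the distance is over the component only, but a connected piece of the graph
    through \<open>z\<close> stays in it.\<close>
  have liftC: "lift X \<in> ?C" if "X \<in> ball z r" for X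
  proof -
    have "connected (lift ` ball z r)"
      by (intro connected_continuous_image continuous_on_subset[OF continuous_lift] r connected_ball)
    moreover have "lift ` ball z r \<subseteq> M" using lift_M r(2) by blast
    moreover have "z \<in> lift ` ball z r" using r(1) lift_z by (metis centre_in_ball image_eqI)
    ultimately have "lift ` ball z r \<subseteq> connected_component_set M z"
      by (intro connected_component_maximal)
    then show ?thesis using that Cz by blast
  qed
  show ?thesis
  proof (rule that[OF z pos])
    fix v assume v: "norm v = 1" "v \<bullet> n z = 0"
    have "((\<lambda>t. z + t *\<^sub>R v) \<longlongrightarrow> z) (nhds 0)"
      by (auto intro!: tendsto_eq_intros simp: filterlim_ident)
    then have "\<forall>\<^sub>F t in nhds 0. z + t *\<^sub>R v \<in> ball z r"
      by (rule topological_tendstoD) (use r in auto)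
    then have "\<forall>\<^sub>F t in nhds 0. gaussian 1 0 z \<le> gaussian 1 0 (lift (z + t *\<^sub>R v))"
    proof eventually_elim
      case (elim t)
      have "norm (lift (z + t *\<^sub>R v)) \<le> norm z" using far[OF liftC[OF elim]] by simp
      then show ?case by (simp add: gaussian_def power_mono)
    qed
    note min = has_jet2_local_min[OF jet_gaussian this]
    have g: "gaussian 1 0 z > 0" by (simp add: gaussian_def)
    from min(1) g have s: "2 * ((z - 0) \<bullet> v - ((z - 0) \<bullet> n z) * (v \<bullet> n z)) = 0" by simp
    from min(2) g have "0 \<le> - 2 - 2 * (hess v v * (z \<bullet> n z))"
      unfolding s using v by (simp add: norm_eq_1 zero_le_mult_iff)
    then have "hess v v * (z \<bullet> n z) < 0" by linarith
    then have "hess v v < 0" using pos by (simp add: mult_less_0_iff)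
    then show "normal_curvature z v > 0"
      using second_fundamental_form_z[OF v(2)] by (simp add: normal_curvature_def)
  qed
qed

text \<open>Two applications of the strong maximum principle, each contradicted at a farthest point of the
  component: first to half the support function \<open>u = H - l\<close>, which is therefore positive, and then to
  the normal curvature plus \<open>c u\<close>, where \<open>-c\<close> is the minimum of their quotient.\<close>

lemma mean_convex_imp_convex:
  assumes mc: "mean_convex M n"
  shows "convex_hypersurface M n"
proof -
  have u0: "q \<bullet> n q \<ge> 0" if "q \<in> M" for q
  proof -
    have "mean_curvature M n q - (q \<bullet> n q) / 2 = l" "mean_curvature M n q \<ge> 0"
      using lambda mc that by (auto simp: lambda_hypersurface_def mean_convex_def)
    then show ?thesis using l_nonpos by linarith
  qed
  have u: "q \<bullet> n q > 0" if q: "q \<in> M" for q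
  proof (rule ccontr)
    assume "\<not> ?thesis"
    then have "q \<bullet> n q = 0" using u0[OF q] by simp
    moreover obtain v where "(q, v) \<in> unit_tangent_bundle" using q by (rule unit_tangent_exists)
    ultimately have "q \<in> zero_set 0 1" by (auto simp: zero_set_def test_function_def)
    moreover have "0 \<le> test_function 0 1 q' v" if "(q', v) \<in> unit_tangent_bundle" for q' v
      using u0[of q'] that by (simp add: test_function_def unit_tangent_bundle_def)
    ultimately have sub: "connected_component_set M q \<subseteq> zero_set 0 1"
      by (intro strong_maximum_principle) auto
    obtain z where "z \<in> connected_component_set M q" "z \<bullet> n z > 0" using farthest_point[OF q] by blast
    with sub show False by (auto simp: zero_set_def test_function_def)
  qed
  have nc: "normal_curvature q v \<ge> 0" if qv: "(q, v) \<in> unit_tangent_bundle" for q v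
  proof (rule ccontr)
    assume neg: "\<not> ?thesis"
    define h where "h x = normal_curvature (fst x) (snd x) / (fst x \<bullet> n (fst x) / 2)" for x
    have upos: "fst x \<bullet> n (fst x) / 2 > 0" if "x \<in> unit_tangent_bundle" for x
      using u[of "fst x"] that by (auto simp: unit_tangent_bundle_def)
    have "continuous_on unit_tangent_bundle h"
      unfolding h_def
    proof (rule continuous_on_divide[OF continuous_on_normal_curvature])
      show "continuous_on unit_tangent_bundle (\<lambda>x. fst x \<bullet> n (fst x) / 2)"
        by (intro continuous_intros continuous_on_compose2[OF continuous_on_n continuous_on_fst[OF continuous_on_id]])
          (auto simp: unit_tangent_bundle_def)
      show "\<forall>x\<in>unit_tangent_bundle. fst x \<bullet> n (fst x) / 2 \<noteq> 0" using upos by fastforce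
    qed
    from continuous_attains_inf[OF compact_unit_tangent_bundle _ this] qv
    obtain x where x: "x \<in> unit_tangent_bundle" "\<And>x'. x' \<in> unit_tangent_bundle \<Longrightarrow> h x \<le> h x'" by blast
    define c where "c = - h x"
    have "h (q, v) < 0" using neg upos[OF qv] by (simp add: h_def divide_less_0_iff)
    then have c: "c > 0" using x(2)[OF qv] by (simp add: c_def)
    have tf: "test_function 1 c (fst x') (snd x') = (h x' - h x) * (fst x' \<bullet> n (fst x') / 2)"
      if "x' \<in> unit_tangent_bundle" for x'
      using upos[OF that] by (simp add: test_function_def h_def c_def field_simps)
    have nonneg: "0 \<le> test_function 1 c q' v'" if "(q', v') \<in> unit_tangent_bundle" for q' v'
    proof -
      have "0 \<le> (h (q', v') - h x) * (fst (q', v') \<bullet> n (fst (q', v')) / 2)"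
        using x(2)[OF that] upos[OF that] by (intro mult_nonneg_nonneg) auto
      then show ?thesis using tf[OF that] by simp
    qed
    have "fst x \<in> zero_set 1 c"
      using tf[OF x(1)] x(1) unfolding zero_set_def by (intro CollectI exI[of _ "snd x"]) simp
    then have sub: "connected_component_set M (fst x) \<subseteq> zero_set 1 c"
      using c nonneg by (intro strong_maximum_principle) auto
    have "fst x \<in> M" using x(1) by (auto simp: unit_tangent_bundle_def)
    then obtain z where z: "z \<in> connected_component_set M (fst x)" "z \<bullet> n z > 0"
      and k: "\<And>v. norm v = 1 \<Longrightarrow> v \<bullet> n z = 0 \<Longrightarrow> normal_curvature z v > 0"
      using farthest_point by blast
    obtain w where w: "(z, w) \<in> unit_tangent_bundle" "test_function 1 c z w = 0"
      using z(1) sub by (auto simp: zero_set_def)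
    then have "normal_curvature z w > 0" using k by (simp add: unit_tangent_bundle_def)
    then have "test_function 1 c z w > 0" using c z(2) by (simp add: test_function_def add_pos_pos)
    then show False using w(2) by simp
  qed
  show ?thesis
    unfolding convex_hypersurface_def
  proof (intro ballI allI impI)
    fix q k assume q: "q \<in> M" and pc: "principal_curvature M n q k"
    obtain U \<rho> where qU: "q \<in> M \<inter> U" and odf: "oriented_defining_function M n U \<rho>" using q by (rule defining_function_at)
    note D = oriented_defining_functionD[OF odf]
    obtain v where v: "v \<in> tangent_space M q" "v \<noteq> 0" and k: "- second_fundamental_form M n q v v = k * (v \<bullet> v)"
      using pc by (auto simp: principal_curvature_def)
    have vn: "v \<bullet> n q = 0" using D(6)[OF qU] v(1) by simp
    let ?v = "(1 / norm v) *\<^sub>R v"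
    have "(q, ?v) \<in> unit_tangent_bundle" using q v(2) vn by (simp add: unit_tangent_bundle_def)
    from nc[OF this] have "0 \<le> dd ?v (dd ?v \<rho>) q / norm (grad \<rho> q)"
      using normal_curvature_eq[OF odf qU, of ?v] vn by simp
    also have "dd ?v (dd ?v \<rho>) q = 1 / norm v * (1 / norm v) * dd v (dd v \<rho>) q"
      by (rule dd_dd_scaleR[OF D(1,2)]) (use qU in simp)
    finally have "0 \<le> (1 / norm v * (1 / norm v)) * (dd v (dd v \<rho>) q / norm (grad \<rho> q))" by simp
    moreover have "1 / norm v * (1 / norm v) > 0" using v(2) by (intro mult_pos_pos) auto
    ultimately have "0 \<le> dd v (dd v \<rho>) q / norm (grad \<rho> q)"
      by (meson mult_pos_neg not_le)
    also have "\<dots> = k * (v \<bullet> v)"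
      using k normal_curvature_eq[OF odf qU vn] by (simp add: normal_curvature_def)
    finally have "0 \<le> k * (v \<bullet> v)" .
    moreover have "v \<bullet> v > 0" using v(2) by simp
    ultimately show "k \<ge> 0" by (meson mult_neg_pos not_le)
  qed
qed

end

theorem theorem1p2:
  fixes M :: "'a::euclidean_space set"
    and n :: "'a \<Rightarrow> 'a"
    and l :: real
  assumes "DIM('a) \<ge> 2"
    and "l \<le> 0"
    and "closed_embedded_hypersurface M"
    and "outer_unit_normal M n"
    and "lambda_hypersurface l M n"
    and "mean_convex M n"
  shows "convex_hypersurface M n"
proof -
  interpret closed_lambda_hypersurface M n l
    using assms by unfold_locales (auto simp: closed_embedded_hypersurface_def)
  show ?thesis using assms(6) by (rule mean_convex_imp_convex)
qed

end
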